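(* Let $X=V(T_0^{l_0}+T_1^{l_1}+T_2^{l_2})\subseteq\mathbb{C}^n$ be a trinomial hypersurface of Type 2, and for $i=0,1,2$ let $d_i=\gcd(l_{i1},\ldots,l_{in_i})$. The following conditions are equivalent. (i) The hypersurface $X$ is rational. (ii) The hypersurface $X$ admits a horizontal polynomial curve. (iii) Either at least one of the numbers $d_0,d_1,d_2$ is coprime with the others (i.e. with each of the other two), or $\gcd(d_0,d_1)=\gcd(d_0,d_2)=\gcd(d_1,d_2)=2$.
   Context: The ground field is $\mathbb{C}$. Trinomial hypersurface of Type 2: fix positive integers $n_0,n_1,n_2$ and let $n=n_0+n_1+n_2$. For each $i=0,1,2$ fix a tuple $l_i=(l_{i1},\ldots,l_{in_i})\in\mathbb{Z}_{>0}^{n_i}$ and put $T_i^{l_i}:=T_{i1}^{l_{i1}}\cdots T_{in_i}^{l_{in_i}}\in\mathbb{C}[T_{ij};\ i=0,1,2,\ j=1,\ldots,n_i]$. The trinomial hypersurface of Type 2 is the zero set $X=V(T_0^{l_0}+T_1^{l_1}+T_2^{l_2})\subseteq\mathbb{C}^n$; it is an irreducible normal affine variety of dimension $n-1$. Torus action: the group of all invertible diagonal matrices acts on $\mathbb{C}^n$ by scaling the coordinates $T_{ij}$. Consider the subgroup of those diagonal matrices for which the scaling factors $w_{ij}$ (written additively as weights of the coordinates $T_{ij}$) satisfy $\sum_{j=1}^{n_0} l_{0j}w_{0j}=\sum_{j=1}^{n_1} l_{1j}w_{1j}=\sum_{j=1}^{n_2} l_{2j}w_{2j}$, i.e. the three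 monomials $T_0^{l_0},T_1^{l_1},T_2^{l_2}$ are scaled by the same factor. Let $T$ be the connected component of the identity of this subgroup; it is a torus of codimension $2$ in the diagonal torus, and it acts effectively on $X$ with complexity $\dim X-\dim T=1$. A polynomial curve on an algebraic variety $X$ is a non-constant morphism $\tau\colon\mathbb{C}\to X$. A polynomial curve $\tau\colon\mathbb{C}\to X$ on an irreducible $T$-variety $X$ is called horizontal if there exists a nonempty $T$-invariant open subset $W$ of $X$ such that $\tau(\mathbb{C})$ intersects all $T$-orbits on $W$. For trinomial hypersurfaces, horizontal is meant with respect to the torus $T$ just described. *)

theory Defs
  imports "HOL-Analysis.Analysis"
begin

section \<open>Zariski topology and morphisms\<close>

text \<open>A point of the affine space with coordinates indexed by a set \<open>I\<close> is a complex function on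
  \<open>I\<close>, extended by \<^const>\<open>undefined\<close> outside \<open>I\<close>. Since the ground field is infinite, polynomials
  are identified with polynomial functions.\<close>

definition affine_space :: "'i set \<Rightarrow> ('i \<Rightarrow> complex) set" where
  "affine_space I = extensional I"

inductive_set poly_fun :: "'i set \<Rightarrow> (('i \<Rightarrow> complex) \<Rightarrow> complex) set" for I :: "'i set" where
  const: "(\<lambda>_. c) \<in> poly_fun I"
| coord: "i \<in> I \<Longrightarrow> (\<lambda>x. x i) \<in> poly_fun I"
| add: "p \<in> poly_fun I \<Longrightarrow> q \<in> poly_fun I \<Longrightarrow> (\<lambda>x. p x + q x) \<in> poly_fun I"
| mult: "p \<in> poly_fun I \<Longrightarrow> q \<in> poly_fun I \<Longrightarrow> (\<lambda>x. p x * q x) \<in> poly_fun I"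

definition zero_locus :: "'i set \<Rightarrow> (('i \<Rightarrow> complex) \<Rightarrow> complex) set \<Rightarrow> ('i \<Rightarrow> complex) set" where
  "zero_locus I P = {x \<in> affine_space I. \<forall>p\<in>P. p x = 0}"

definition zariski :: "'i set \<Rightarrow> ('i \<Rightarrow> complex) topology" where
  "zariski I = topology (\<lambda>U. \<exists>P\<subseteq>poly_fun I. U = affine_space I - zero_locus I P)"

lemma openin_zariski:
  "openin (zariski I) U \<longleftrightarrow> (\<exists>P\<subseteq>poly_fun I. U = affine_space I - zero_locus I P)"
proof -
  let ?open = "\<lambda>U. \<exists>P\<subseteq>poly_fun I. U = affine_space I - zero_locus I P"
  have "?open (S \<inter> T)" if S: "?open S" and T: "?open T" for S T
  proof -
    obtain P Q where P: "P \<subseteq> poly_fun I" "S = affine_space I - zero_locus I P"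
      and Q: "Q \<subseteq> poly_fun I" "T = affine_space I - zero_locus I Q"
      using S T by blast
    let ?R = "(\<lambda>(p, q) x. p x * q x) ` (P \<times> Q)"
    have "?R \<subseteq> poly_fun I" using P(1) Q(1) by (auto intro!: poly_fun.mult)
    moreover have "S \<inter> T = affine_space I - zero_locus I ?R"
      unfolding P(2) Q(2) zero_locus_def by auto
    ultimately show ?thesis by blast
  qed
  moreover have "?open (\<Union>K)" if K: "\<forall>S\<in>K. ?open S" for K
  proof -
    obtain F where F: "\<And>S. S \<in> K \<Longrightarrow> F S \<subseteq> poly_fun I \<and> S = affine_space I - zero_locus I (F S)"
      using bchoice[OF K] by blast
    have "\<Union>(F ` K) \<subseteq> poly_fun I" using F by blast
    moreover have "\<Union>K = affine_space I - zero_locus I (\<Union>(F ` K))"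
    proof -
      have "\<Union>K = (\<Union>S\<in>K. affine_space I - zero_locus I (F S))" using F by auto
      also have "\<dots> = affine_space I - zero_locus I (\<Union>(F ` K))"
        unfolding zero_locus_def by auto
      finally show ?thesis .
    qed
    ultimately show ?thesis by blast
  qed
  ultimately have "istopology ?open" unfolding istopology_def by blast
  then show ?thesis unfolding zariski_def by (simp add: topology_inverse')
qed

lemma topspace_zariski: "topspace (zariski I) = affine_space I"
proof -
  have "affine_space I = affine_space I - zero_locus I {\<lambda>_. 1}"
    by (auto simp: zero_locus_def)
  then have "openin (zariski I) (affine_space I)"
    unfolding openin_zariski by (intro exI[of _ "{\<lambda>_. 1}"]) (auto intro: poly_fun.const)
  moreover have "U \<subseteq> affine_space I" if "openin (zariski I) U" for U
    using that unfolding openin_zariski by blast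
  ultimately show ?thesis unfolding topspace_def by blast
qed

definition regular_on :: "'i set \<Rightarrow> ('i \<Rightarrow> complex) set \<Rightarrow> (('i \<Rightarrow> complex) \<Rightarrow> complex) \<Rightarrow> bool" where
  "regular_on I U f \<longleftrightarrow> (\<forall>x\<in>U. \<exists>V. openin (subtopology (zariski I) U) V \<and> x \<in> V \<and>
     (\<exists>p\<in>poly_fun I. \<exists>q\<in>poly_fun I. \<forall>y\<in>V. q y \<noteq> 0 \<and> f y = p y / q y))"

definition morphism ::
  "'i set \<Rightarrow> ('i \<Rightarrow> complex) set \<Rightarrow> 'j set \<Rightarrow> ('j \<Rightarrow> complex) set
    \<Rightarrow> (('i \<Rightarrow> complex) \<Rightarrow> ('j \<Rightarrow> complex)) \<Rightarrow> bool" where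
  "morphism I U J V \<phi> \<longleftrightarrow> \<phi> \<in> U \<rightarrow> V \<and> (\<forall>j\<in>J. regular_on I U (\<lambda>x. \<phi> x j))"

text \<open>For irreducible \<open>X\<close> and \<open>Y\<close>: birational equivalence means that some nonempty open subsets
  are isomorphic.\<close>

definition birational ::
  "'i set \<Rightarrow> ('i \<Rightarrow> complex) set \<Rightarrow> 'j set \<Rightarrow> ('j \<Rightarrow> complex) set \<Rightarrow> bool" where
  "birational I X J Y \<longleftrightarrow> (\<exists>U V \<phi> \<psi>.
     openin (subtopology (zariski I) X) U \<and> U \<noteq> {} \<and>
     openin (subtopology (zariski J) Y) V \<and> V \<noteq> {} \<and>
     morphism I U J V \<phi> \<and> morphism J V I U \<psi> \<and>
     (\<forall>x\<in>U. \<psi> (\<phi> x) = x) \<and> (\<forall>y\<in>V. \<phi> (\<psi> y) = y))"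

definition rational_variety :: "'i set \<Rightarrow> ('i \<Rightarrow> complex) set \<Rightarrow> bool" where
  "rational_variety I X \<longleftrightarrow> (\<exists>m::nat. birational I X {..<m} (affine_space {..<m}))"

section \<open>Polynomial curves and diagonal torus actions\<close>

text \<open>The affine line is the affine space with coordinate index type \<^typ>\<open>unit\<close>.\<close>

definition polynomial_curve :: "'i set \<Rightarrow> ('i \<Rightarrow> complex) set \<Rightarrow> (complex \<Rightarrow> ('i \<Rightarrow> complex)) \<Rightarrow> bool" where
  "polynomial_curve I X \<tau> \<longleftrightarrow>
     morphism (UNIV :: unit set) (affine_space UNIV) I X (\<lambda>s. \<tau> (s ())) \<and> (\<exists>a b. \<tau> a \<noteq> \<tau> b)"

definition diag_torus :: "'i set \<Rightarrow> ('i \<Rightarrow> complex) set" where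
  "diag_torus I = {t \<in> affine_space I. \<forall>i\<in>I. t i \<noteq> 0}"

definition diag_act :: "'i set \<Rightarrow> ('i \<Rightarrow> complex) \<Rightarrow> ('i \<Rightarrow> complex) \<Rightarrow> ('i \<Rightarrow> complex)" where
  "diag_act I t x = (\<lambda>i\<in>I. t i * x i)"

definition diag_orbit :: "'i set \<Rightarrow> ('i \<Rightarrow> complex) set \<Rightarrow> ('i \<Rightarrow> complex) \<Rightarrow> ('i \<Rightarrow> complex) set" where
  "diag_orbit I T x = (\<lambda>t. diag_act I t x) ` T"

definition horizontal ::
  "'i set \<Rightarrow> ('i \<Rightarrow> complex) set \<Rightarrow> ('i \<Rightarrow> complex) set \<Rightarrow> (complex \<Rightarrow> ('i \<Rightarrow> complex)) \<Rightarrow> bool" where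
  "horizontal I T X \<tau> \<longleftrightarrow> (\<exists>W. openin (subtopology (zariski I) X) W \<and> W \<noteq> {} \<and>
     (\<forall>x\<in>W. diag_orbit I T x \<subseteq> W) \<and>
     (\<forall>x\<in>W. range \<tau> \<inter> diag_orbit I T x \<noteq> {}))"

section \<open>Trinomial hypersurfaces of Type 2\<close>

definition tri_index :: "(nat \<Rightarrow> nat) \<Rightarrow> (nat \<times> nat) set" where
  "tri_index n = (SIGMA i:{0, 1, 2}. {1..n i})"

definition tri_monom ::
  "(nat \<Rightarrow> nat) \<Rightarrow> (nat \<Rightarrow> nat \<Rightarrow> nat) \<Rightarrow> nat \<Rightarrow> (nat \<times> nat \<Rightarrow> complex) \<Rightarrow> complex" where
  "tri_monom n l i x = (\<Prod>j=1..n i. x (i, j) ^ l i j)"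

definition trinomial_hypersurface ::
  "(nat \<Rightarrow> nat) \<Rightarrow> (nat \<Rightarrow> nat \<Rightarrow> nat) \<Rightarrow> (nat \<times> nat \<Rightarrow> complex) set" where
  "trinomial_hypersurface n l = zero_locus (tri_index n)
     {\<lambda>x. tri_monom n l 0 x + tri_monom n l 1 x + tri_monom n l 2 x}"

definition tri_group ::
  "(nat \<Rightarrow> nat) \<Rightarrow> (nat \<Rightarrow> nat \<Rightarrow> nat) \<Rightarrow> (nat \<times> nat \<Rightarrow> complex) set" where
  "tri_group n l = {t \<in> diag_torus (tri_index n).
     tri_monom n l 0 t = tri_monom n l 1 t \<and> tri_monom n l 1 t = tri_monom n l 2 t}"

definition tri_torus ::
  "(nat \<Rightarrow> nat) \<Rightarrow> (nat \<Rightarrow> nat \<Rightarrow> nat) \<Rightarrow> (nat \<times> nat \<Rightarrow> complex) set" where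
  "tri_torus n l =
     connected_component_of_set (subtopology (zariski (tri_index n)) (tri_group n l))
       (\<lambda>k\<in>tri_index n. 1)"

definition tri_gcd :: "(nat \<Rightarrow> nat) \<Rightarrow> (nat \<Rightarrow> nat \<Rightarrow> nat) \<Rightarrow> nat \<Rightarrow> nat" where
  "tri_gcd n l i = Gcd (l i ` {1..n i})"

end

theory Submission
  imports Defs "HOL-Computational_Algebra.Computational_Algebra" "HOL-Computational_Algebra.Field_as_Ring"
    "HOL-Complex_Analysis.Conformal_Mappings"
begin

text \<open>On the locus \<open>X0\<close> where no coordinate vanishes, a unimodular change of monomial coordinates turns
  the three monomials into \<open>y\<^sub>0 ^ d\<^sub>0\<close>, \<open>y\<^sub>1 ^ d\<^sub>1\<close>, \<open>y\<^sub>2 ^ d\<^sub>2\<close>. Hence \<open>X\<close> is birational to a product of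
  an affine space with a curve covering the line \<open>z\<^sub>0 + z\<^sub>1 + z\<^sub>2 = 0\<close> in the projective plane, with
  ramification orders \<open>e\<^sub>i = gcd d\<^sub>i (lcm d\<^sub>j d\<^sub>k)\<close> over the three points \<open>z\<^sub>i = 0\<close>.

  A rational parametrization of \<open>X\<close>, as well as a horizontal polynomial curve, yields polynomials with
  \<open>g\<^sub>0 ^ d\<^sub>0 + g\<^sub>1 ^ d\<^sub>1 + g\<^sub>2 ^ d\<^sub>2 = 0\<close> and non-proportional summands. The Mason--Stothers inequality then
  gives \<open>1/e\<^sub>0 + 1/e\<^sub>1 + 1/e\<^sub>2 > 1\<close>, and among the triples \<open>e\<close> arising from gcds this leaves only
  \<open>(1, e, e)\<close> up to order and \<open>(2, 2, 2)\<close>, which is the arithmetic condition. Conversely, in these two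
  cases the curve is parametrized by \<open>- (1 + s\<^sup>e) + s\<^sup>e + 1 = 0\<close> and by
  \<open>(2 s)\<^sup>2 + (1 - s\<^sup>2)\<^sup>2 + (\<i> (1 + s\<^sup>2))\<^sup>2 = 0\<close>, respectively. Such a parametrization lifts to a section of
  the quotient of \<open>X0\<close> by the torus, which gives both the birational map and, after clearing denominators
  with the torus, the horizontal curve.\<close>

section \<open>Polynomial solutions of power relations\<close>

text \<open>The numbers e_i come from local orders. Once the common factor \<open>G\<close> of the
  three summands is removed, at a zero of the i-th cofactor the order of \<open>G\<close> is a
  multiple of d_j and d_k, and adding the order of the cofactor gives a multiple of d_i; so e_i
  divides that order. Infinity obeys the same rule through degrees. The triples (2, 3, 3), (2, 3,
  4), (2, 3, 5) drop out because a prime dividing one e_i must divide a second one. Both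
  parametrizations put s = infinity over a point where a summand vanishes. Hence all of
  \<open>X0\<close> has finite parameter, and a single polynomial curve can meet every orbit in it.
  Two obstacles shape the rest. Regular maps are only local quotients, so denominators have to be
  cleared along a line. And the torus is only the identity component of \<open>tri_group\<close>, so
  equality of the three monomials does not show membership; the roots \<open>\<nu>\<close> of the
  monomials do.\<close>

lemma prime_3: "prime (3 :: nat)"
proof (rule prime_nat_iff'[THEN iffD2], safe)
  fix k :: nat assume "k \<in> {2..<3}" "k dvd 3"
  then have "k = 2" by auto
  with \<open>k dvd 3\<close> show False by simp
qed simp

text \<open>If \<open>e1 = 2\<close>, every pairwise gcd is 1 or 2, and two of them equal to 2 force
  the third; so at most one is 2. If \<open>e1 = 3\<close>, then 3 does not divide \<open>d0\<close>
  and 2 does not divide \<open>d1\<close>, so both must divide \<open>d2\<close>; then 6 divides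
  \<open>e2\<close>, which violates the strict inequality.\<close>

lemma spherical_triple_aux:
  fixes d0 d1 d2 :: nat
  defines "e0 \<equiv> gcd d0 (lcm d1 d2)" and "e1 \<equiv> gcd d1 (lcm d0 d2)" and "e2 \<equiv> gcd d2 (lcm d0 d1)"
  assumes pos: "d0 > 0" "d1 > 0" "d2 > 0"
    and sph: "e0 * e1 * e2 < e1 * e2 + e0 * e2 + e0 * e1"
    and e: "e0 = 2" "e1 = 2 \<or> e1 = 3"
    and not2: "\<not> (gcd d0 d1 = 2 \<and> gcd d0 d2 = 2 \<and> gcd d1 d2 = 2)"
  shows "coprime d0 d1 \<and> coprime d0 d2 \<or> coprime d0 d1 \<and> coprime d1 d2 \<or> coprime d0 d2 \<and> coprime d1 d2"
proof -
  have c: "gcd d0 d1 dvd e0" "gcd d0 d1 dvd e1" "gcd d0 d2 dvd e0" "gcd d1 d2 dvd e1"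
    unfolding e0_def e1_def by (meson dvd_lcm1 dvd_lcm2 dvd_trans gcd_dvd1 gcd_dvd2 gcd_greatest)+
  from e(2) show ?thesis
  proof
    assume e1: "e1 = 2"
    have two: "k = 1 \<or> k = 2" if "k dvd 2" for k :: nat
      using that by (metis One_nat_def prime_nat_iff two_is_prime_nat)
    have "gcd d0 d1 = 1 \<or> gcd d0 d1 = 2" "gcd d0 d2 = 1 \<or> gcd d0 d2 = 2" "gcd d1 d2 = 1 \<or> gcd d1 d2 = 2"
      using c e e1 two by auto
    moreover have "gcd d1 d2 \<noteq> 1" if "gcd d0 d1 = 2" "gcd d0 d2 = 2"
      using that by (metis gcd_dvd2 gcd_greatest nat_dvd_1_iff_1 numeral_eq_one_iff semiring_norm(85))
    moreover have "gcd d0 d2 \<noteq> 1" if "gcd d0 d1 = 2" "gcd d1 d2 = 2"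
      using that by (metis gcd_dvd1 gcd_dvd2 gcd_greatest nat_dvd_1_iff_1 numeral_eq_one_iff semiring_norm(85))
    moreover have "gcd d0 d1 \<noteq> 1" if "gcd d0 d2 = 2" "gcd d1 d2 = 2"
      using that by (metis gcd_dvd1 gcd_greatest nat_dvd_1_iff_1 numeral_eq_one_iff semiring_norm(85))
    ultimately show ?thesis using not2 unfolding coprime_iff_gcd_eq_1 by argo
  next
    assume e1: "e1 = 3"
    have n3: "\<not> 3 dvd d0"
    proof
      assume "3 dvd d0"
      moreover have "3 dvd d1" using e1 unfolding e1_def by (metis gcd_dvd1)
      ultimately have "3 dvd e0" unfolding e0_def by (meson dvd_lcm1 dvd_trans gcd_greatest)
      then show False using e by simp
    qed
    have n2: "\<not> 2 dvd d1"
    proof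
      assume "2 dvd d1"
      moreover have "2 dvd d0" using e unfolding e0_def by (metis gcd_dvd1)
      ultimately have "2 dvd e1" unfolding e1_def by (meson dvd_lcm1 dvd_trans gcd_greatest)
      then show False using e1 by simp
    qed
    have "3 dvd lcm d0 d2" using e1 unfolding e1_def by (metis gcd_dvd2)
    then have "3 dvd d0 * d2" by (meson dvd_trans dvd_triv_left dvd_triv_right lcm_least)
    then have "3 dvd d2" using n3 by (metis prime_dvd_mult_iff prime_3)
    moreover have "2 dvd lcm d1 d2" using e unfolding e0_def by (metis gcd_dvd2)
    then have "2 dvd d1 * d2" by (meson dvd_trans dvd_triv_left dvd_triv_right lcm_least)
    then have "2 dvd d2" using n2 by (metis prime_dvd_mult_iff two_is_prime_nat)
    moreover have "2 dvd d0" "3 dvd d1" using e e1 unfolding e0_def e1_def by (metis gcd_dvd1)+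
    ultimately have "2 dvd e2" "3 dvd e2"
      unfolding e2_def by (auto intro: dvd_lcmI1 dvd_lcmI2)
    then have "6 dvd e2" by presburger
    moreover have "e2 > 0" using pos by (simp add: e2_def)
    ultimately have "e2 \<ge> 6" by (simp add: dvd_imp_le)
    then have False using sph e e1 by simp
    then show ?thesis ..
  qed
qed

text \<open>Divided by \<open>e0 * e1 * e2\<close>, the hypothesis says that the reciprocals sum to
  more than 1. If some \<open>e\<close> is 1, the corresponding \<open>d\<close> is coprime to the
  other two. Otherwise the two smallest are 2 and at most 3, and the previous lemma applies after a
  permutation.\<close>

lemma spherical_triple:
  fixes d0 d1 d2 :: nat
  defines "e0 \<equiv> gcd d0 (lcm d1 d2)" and "e1 \<equiv> gcd d1 (lcm d0 d2)" and "e2 \<equiv> gcd d2 (lcm d0 d1)"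
  assumes pos: "d0 > 0" "d1 > 0" "d2 > 0"
    and sph: "e0 * e1 * e2 < e1 * e2 + e0 * e2 + e0 * e1"
  shows "coprime d0 d1 \<and> coprime d0 d2 \<or> coprime d0 d1 \<and> coprime d1 d2 \<or> coprime d0 d2 \<and> coprime d1 d2
    \<or> gcd d0 d1 = 2 \<and> gcd d0 d2 = 2 \<and> gcd d1 d2 = 2"
    (is "?Q d0 d1 d2")
proof -
  have pe: "e0 > 0" "e1 > 0" "e2 > 0" using pos by (simp_all add: e0_def e1_def e2_def)
  have c: "gcd d0 d1 dvd e0" "gcd d0 d1 dvd e1" "gcd d0 d2 dvd e0" "gcd d1 d2 dvd e1" "gcd d0 d2 dvd e2" "gcd d1 d2 dvd e2"
    unfolding e0_def e1_def e2_def by (meson dvd_lcm1 dvd_lcm2 dvd_trans gcd_dvd1 gcd_dvd2 gcd_greatest)+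
  show ?thesis
  proof (cases "e0 = 1 \<or> e1 = 1 \<or> e2 = 1")
    case True
    then have "gcd d0 d1 dvd 1 \<and> gcd d0 d2 dvd 1 \<or> gcd d0 d1 dvd 1 \<and> gcd d1 d2 dvd 1 \<or> gcd d0 d2 dvd 1 \<and> gcd d1 d2 dvd 1"
      using c by metis
    then show ?thesis unfolding coprime_iff_gcd_eq_1 nat_dvd_1_iff_1 by blast
  next
    case False
    then have ge: "e0 \<ge> 2" "e1 \<ge> 2" "e2 \<ge> 2" using pe by auto
    \<comment> \<open>From 3/x > 1 follows x = 2, and then 2/y > 1/2 leaves y < 4.\<close>
    have small: "x = 2 \<and> (y = 2 \<or> y = 3) \<or> x = 2 \<and> (z = 2 \<or> z = 3) \<or> y = 2 \<and> (z = 2 \<or> z = 3)"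
      if "x \<le> y" "y \<le> z" "x \<ge> 2" "x * y * z < y * z + x * z + x * y" for x y z :: nat
    proof -
      have "x * y \<le> x * z" "x * z \<le> y * z" "x * y \<le> y * z" using that by (simp_all add: mult_le_mono)
      then have "x * (y * z) < 3 * (y * z)" using that(4) unfolding mult.assoc by linarith
      then have "x < 3" using mult_less_cancel2 by blast
      then have x: "x = 2" using that(3) by simp
      then have "2 * y * z < y * z + 2 * z + 2 * y" using that(4) by simp
      then have "y * z < 4 * z" using that(2) by linarith
      then have "y < 4" using mult_less_cancel2 by blast
      then show ?thesis using x that by auto
    qed
    have pairs: "e0 = 2 \<and> (e1 = 2 \<or> e1 = 3) \<or> e0 = 2 \<and> (e2 = 2 \<or> e2 = 3) \<or> e1 = 2 \<and> (e2 = 2 \<or> e2 = 3)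
      \<or> e1 = 2 \<and> (e0 = 2 \<or> e0 = 3) \<or> e2 = 2 \<and> (e0 = 2 \<or> e0 = 3) \<or> e2 = 2 \<and> (e1 = 2 \<or> e1 = 3)"
    proof -
      consider "e0 \<le> e1" "e1 \<le> e2" | "e0 \<le> e2" "e2 \<le> e1" | "e1 \<le> e0" "e0 \<le> e2" | "e1 \<le> e2" "e2 \<le> e0"
        | "e2 \<le> e0" "e0 \<le> e1" | "e2 \<le> e1" "e1 \<le> e0" by linarith
      then show ?thesis
      proof cases
        case 1 with small[of e0 e1 e2] ge sph show ?thesis by (auto simp: ac_simps)
      next
        case 2 with small[of e0 e2 e1] ge sph show ?thesis by (auto simp: ac_simps)
      next
        case 3 with small[of e1 e0 e2] ge sph show ?thesis by (auto simp: ac_simps)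
      next
        case 4 with small[of e1 e2 e0] ge sph show ?thesis by (auto simp: ac_simps)
      next
        case 5 with small[of e2 e0 e1] ge sph show ?thesis by (auto simp: ac_simps)
      next
        case 6 with small[of e2 e1 e0] ge sph show ?thesis by (auto simp: ac_simps)
      qed
    qed
    have aux: "?Q x y z"
      if "gcd x (lcm y z) = 2" "gcd y (lcm x z) = 2 \<or> gcd y (lcm x z) = 3" "x > 0" "y > 0" "z > 0"
        "gcd x (lcm y z) * gcd y (lcm x z) * gcd z (lcm x y) < gcd y (lcm x z) * gcd z (lcm x y)
          + gcd x (lcm y z) * gcd z (lcm x y) + gcd x (lcm y z) * gcd y (lcm x z)" for x y z
      using spherical_triple_aux[of x y z] that by argo
    from sph have sph': "e0 * e2 * e1 < e2 * e1 + e0 * e1 + e0 * e2" "e1 * e2 * e0 < e2 * e0 + e1 * e0 + e1 * e2"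
      "e1 * e0 * e2 < e0 * e2 + e1 * e2 + e1 * e0" "e2 * e0 * e1 < e0 * e1 + e2 * e1 + e2 * e0"
      "e2 * e1 * e0 < e1 * e0 + e2 * e0 + e2 * e1"
      by (simp_all add: ac_simps)
    note com = lcm.commute[of d1 d0] lcm.commute[of d2 d0] lcm.commute[of d2 d1]
    from pairs consider "e0 = 2" "e1 = 2 \<or> e1 = 3" | "e0 = 2" "e2 = 2 \<or> e2 = 3" | "e1 = 2" "e2 = 2 \<or> e2 = 3" | "e1 = 2" "e0 = 2 \<or> e0 = 3" | "e2 = 2" "e0 = 2 \<or> e0 = 3" | "e2 = 2" "e1 = 2 \<or> e1 = 3" by blast
    then have "?Q d0 d1 d2 \<or> ?Q d0 d2 d1 \<or> ?Q d1 d2 d0 \<or> ?Q d1 d0 d2 \<or> ?Q d2 d0 d1 \<or> ?Q d2 d1 d0"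
    proof cases
      case 1 then show ?thesis using aux[of d0 d1 d2, unfolded com, folded e0_def e1_def e2_def] pos sph sph' by argo
    next
      case 2 then show ?thesis using aux[of d0 d2 d1, unfolded com, folded e0_def e1_def e2_def] pos sph sph' by argo
    next
      case 3 then show ?thesis using aux[of d1 d2 d0, unfolded com, folded e0_def e1_def e2_def] pos sph sph' by argo
    next
      case 4 then show ?thesis using aux[of d1 d0 d2, unfolded com, folded e0_def e1_def e2_def] pos sph sph' by argo
    next
      case 5 then show ?thesis using aux[of d2 d0 d1, unfolded com, folded e0_def e1_def e2_def] pos sph sph' by argo
    next
      case 6 then show ?thesis using aux[of d2 d1 d0, unfolded com, folded e0_def e1_def e2_def] pos sph sph' by argo
    qed
    then show ?thesis by (simp only: gcd.commute coprime_commute) argo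
  qed
qed

section \<open>The Mason-Stothers inequality for polynomial powers\<close>

lemma exists_root_of_orders:
  fixes p :: "complex poly"
  assumes "p \<noteq> 0" and "e > 0" and "\<And>z. e dvd order z p"
  shows "\<exists>k. p = k ^ e"
  using assms
proof (induction "degree p" arbitrary: p rule: less_induct)
  case less
  show ?case
  proof (cases "degree p = 0")
    case True
    then obtain c where c: "p = [:c:]" using degree_eq_zeroE by blast
    obtain b where "b ^ e = c" using less.prems(2) using nth_root_exists by blast
    then have "p = [:b:] ^ e" by (simp add: c poly_const_pow)
    then show ?thesis ..
  next
    case False
    then obtain z where z: "poly p z = 0"
      using alg_closed_imp_poly_has_root by blast
    let ?q = "[:-z, 1:] ^ e"
    have "order z p > 0" using z less.prems(1) by (simp add: order_root)
    then have "e \<le> order z p" using less.prems(3)[of z] by (simp add: dvd_imp_le)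
    \<comment> \<open>A zero has order at least \<open>e\<close>, so the \<open>e\<close>-th power
      of its linear factor splits off, and the quotient again has all orders divisible by
      \<open>e\<close>.\<close>
    then have "?q dvd p" by (simp add: order_divides)
    then obtain r where r: "p = ?q * r" by auto
    have r0: "r \<noteq> 0" using r less.prems by auto
    have deg: "degree p = e + degree r" using r r0 by (simp add: degree_mult_eq degree_linear_power)
    have "e dvd order w r" for w
    proof -
      have "order w p = order w ?q + order w r" unfolding r using r less.prems(1) by (intro order_mult) auto
      moreover have "e dvd order w ?q"
      proof (cases "w = z")
        case False
        then have "order w ?q = 0" by (intro order_0I) auto
        then show ?thesis by simp
      qed (simp add: order_power_n_n)
      ultimately show ?thesis using less.prems(3)[of w] by (simp add: dvd_add_right_iff)
    qed
    then obtain k where "r = k ^ e" using less.hyps[of r] deg r0 less.prems(2) by auto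
    then have "p = ([:-z, 1:] * k) ^ e" using r by (simp only: power_mult_distrib)
    then show ?thesis ..
  qed
qed


lemma degree_wronskian:
  fixes p q :: "complex poly"
  assumes "p * pderiv q - pderiv p * q \<noteq> 0"
  shows "degree (p * pderiv q - pderiv p * q) + 1 \<le> degree p + degree q"
proof -
  have pos: "degree p + degree q > 0"
  proof (rule ccontr)
    assume "\<not> degree p + degree q > 0"
    then have "pderiv p = 0" "pderiv q = 0" by (simp_all add: pderiv_eq_0_iff)
    then show False using assms by simp
  qed
  have *: "degree (a * pderiv b) + 1 \<le> degree a + degree b" if "degree a + degree b > 0" for a b :: "complex poly"
  proof (cases "degree b = 0")
    case True
    then have "pderiv b = 0" by (simp add: pderiv_eq_0_iff)
    then show ?thesis using that by auto
  next
    case False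
    have "degree (a * pderiv b) \<le> degree a + (degree b - 1)" by (metis degree_mult_le degree_pderiv)
    then show ?thesis using False by linarith
  qed
  have "degree (p * pderiv q) + 1 \<le> degree p + degree q" using *[of p q] pos by simp
  moreover have "degree (pderiv p * q) + 1 \<le> degree p + degree q" using *[of q p] pos by (simp add: ac_simps)
  ultimately have "max (degree (p * pderiv q)) (degree (pderiv p * q)) + 1 \<le> degree p + degree q" by simp
  then show ?thesis using degree_diff_le_max[of "p * pderiv q" "pderiv p * q"] by linarith
qed

text \<open>Subtracting a multiple of \<open>p\<close> from \<open>q\<close> cancels the leading term and preserves the Wronskian.\<close>

lemma degree_wronskian_eq_degree:
  fixes p q :: "complex poly"
  assumes W: "p * pderiv q - pderiv p * q \<noteq> 0" and deg: "degree p = degree q"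
  shows "degree (p * pderiv q - pderiv p * q) + 2 \<le> degree p + degree q"
proof -
  have pos: "degree p > 0"
  proof (rule ccontr)
    assume "\<not> degree p > 0"
    then have "pderiv p = 0" "pderiv q = 0" using deg by (simp_all add: pderiv_eq_0_iff)
    then show False using W by simp
  qed
  then have p0: "lead_coeff p \<noteq> 0" by auto
  define c where "c = lead_coeff q / lead_coeff p"
  define r where "r = q - smult c p"
  have pr: "pderiv r = pderiv q - smult c (pderiv p)" by (simp add: r_def pderiv_diff pderiv_smult)
  then have Wr: "p * pderiv r - pderiv p * r = p * pderiv q - pderiv p * q"
    unfolding pr by (simp add: r_def algebra_simps)
  have "coeff r (degree p) = 0" using p0 deg by (simp add: r_def c_def)
  moreover have "degree r \<le> degree p" using deg unfolding r_def by (metis degree_diff_le degree_smult_le order_refl)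
  ultimately have "degree r < degree p" using pos by (metis eq_zero_or_degree_less degree_0)
  moreover have "degree (p * pderiv q - pderiv p * q) + 1 \<le> degree p + degree r"
    using degree_wronskian[of p r] W unfolding Wr .
  ultimately show ?thesis using deg by linarith
qed

lemma power_pred_dvd_pderiv:
  fixes k :: "complex poly"
  assumes "e > 0"
  shows "k ^ (e - 1) dvd k ^ e" "k ^ (e - 1) dvd pderiv (k ^ e)"
proof -
  obtain m where "e = Suc m" using assms gr0_conv_Suc by blast
  then show "k ^ (e - 1) dvd k ^ e" "k ^ (e - 1) dvd pderiv (k ^ e)"
    using pderiv_power_Suc[of k m] by (auto simp del: power_Suc intro: dvd_mult2 dvd_smult le_imp_power_dvd)
qed

text \<open>A Mason--Stothers argument: the Wronskian is divisible by every \<open>k\<^sub>i ^ (e\<^sub>i - 1)\<close>.\<close>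

lemma coprime_power_relation_aux:
  fixes k0 k1 k2 :: "complex poly"
  assumes sum: "k0 ^ e0 + k1 ^ e1 + k2 ^ e2 = 0"
    and e: "e0 > 0" "e1 > 0" "e2 > 0" and k2: "k2 \<noteq> 0"
    and cop: "coprime k0 k1" "coprime k0 k2" "coprime k1 k2"
    and deg: "degree (k1 ^ e1) = degree (k0 ^ e0)" "degree (k2 ^ e2) \<le> degree (k0 ^ e0)"
    and dvd: "e2 dvd degree (k0 ^ e0) - degree (k2 ^ e2)"
    and pos: "degree (k0 ^ e0) > 0"
  shows "e0 * e1 * e2 < e1 * e2 + e0 * e2 + e0 * e1"
proof -
  define p where "p = k0 ^ e0"
  define q where "q = k1 ^ e1"
  define r where "r = k2 ^ e2"
  define W where "W = p * pderiv q - pderiv p * q"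
  define N where "N = degree p"
  have k: "k0 \<noteq> 0" "k1 \<noteq> 0" using pos deg(1) e by (auto simp: power_0_left)
  have degs: "degree p = N" "degree q = N" "degree r \<le> N" "N > 0" "e2 dvd N - degree r"
    using deg pos dvd by (simp_all add: p_def q_def r_def N_def)
  have Nk: "e0 * degree k0 = N" "e1 * degree k1 = N" "e2 * degree k2 = degree r"
    using degs k k2 by (simp_all add: p_def q_def r_def degree_power_eq)
  have "p + q + r = 0" using sum by (simp add: p_def q_def r_def)
  then have "r = - p - q" by (simp add: algebra_simps add_eq_0_iff)
  then have pr: "pderiv r = - pderiv p - pderiv q" by (simp add: pderiv_diff pderiv_minus)
  \<comment> \<open>The Wronskian of any two of \<open>p\<close>, \<open>q\<close>, \<open>r\<close>
    is the same up to sign, so the third power contributes a divisor of \<open>W\<close> as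
    well.\<close>
  have Wr: "W = pderiv p * r - p * pderiv r"
    unfolding W_def pr by (simp add: \<open>r = - p - q\<close> algebra_simps)
  have W0: "W \<noteq> 0"
  proof
    assume "W = 0"
    then have "p dvd pderiv p * q" by (metis W_def dvd_triv_left eq_iff_diff_eq_0)
    moreover have "coprime p q" using cop by (simp add: p_def q_def)
    ultimately have "p dvd pderiv p" by (simp add: coprime_dvd_mult_left_iff)
    moreover have "pderiv p \<noteq> 0" using degs by (simp add: pderiv_eq_0_iff)
    ultimately have "degree p \<le> degree (pderiv p)" by (rule dvd_imp_degree_le)
    then show False using degs by (simp add: degree_pderiv)
  qed
  have "k0 ^ (e0 - 1) dvd W" "k1 ^ (e1 - 1) dvd W"
    using power_pred_dvd_pderiv[OF e(1), of k0] power_pred_dvd_pderiv[OF e(2), of k1]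
    unfolding W_def p_def q_def by (metis dvd_diff dvd_mult dvd_mult2)+
  moreover have "k2 ^ (e2 - 1) dvd W"
    using power_pred_dvd_pderiv[OF e(3), of k2] unfolding Wr r_def by (metis dvd_diff dvd_mult)
  ultimately have "k0 ^ (e0 - 1) * k1 ^ (e1 - 1) * k2 ^ (e2 - 1) dvd W"
    using cop by (intro divides_mult) auto
  then have "degree (k0 ^ (e0 - 1) * k1 ^ (e1 - 1) * k2 ^ (e2 - 1)) \<le> degree W"
    using W0 by (rule dvd_imp_degree_le)
  then have "(e0 - 1) * degree k0 + (e1 - 1) * degree k1 + (e2 - 1) * degree k2 \<le> degree W"
    using k k2 by (simp add: degree_mult_eq degree_power_eq)
  then have le: "N + N + degree r \<le> degree W + (degree k0 + degree k1 + degree k2)"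
    using Nk e by (simp add: diff_mult_distrib)
  have "e2 dvd (N - degree r) + degree r" using degs(5) Nk(3) by (metis dvd_add dvd_triv_left)
  then have "e2 dvd N" using degs(3) by simp
  \<comment> \<open>\<open>m\<close> replaces \<open>degree k2\<close>: it bounds the size of the
    fibre over the third point when infinity is counted too, which lies in that fibre exactly if
    \<open>degree r < N\<close>.\<close>
  then obtain m where m: "N = e2 * m" by auto
  \<comment> \<open>This is Riemann-Hurwitz for the degree \<open>N\<close> self-map of the
    projective line given by \<open>p\<close> and \<open>q\<close>. If \<open>degree r = N\<close>,
    the sharper Wronskian bound supplies the 2. Otherwise the weaker bound loses one unit, and
    \<open>degree k2 < m\<close> gives it back.\<close>
  have "N + 2 \<le> degree k0 + degree k1 + m"
  proof (cases "degree r = N")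
    case True
    then have "m = degree k2" using m Nk(3) e by simp
    moreover have "degree W + 2 \<le> N + N"
      using degree_wronskian_eq_degree[of p q] W0 degs by (simp add: W_def)
    ultimately show ?thesis using le True by linarith
  next
    case False
    then have "e2 * degree k2 < e2 * m" using degs(3) Nk(3) m by simp
    then have "degree k2 < m" by simp
    moreover have "- W = p * pderiv r - pderiv p * r" by (simp add: Wr)
    then have "degree W + 1 \<le> N + degree r"
      using degree_wronskian[of p r] W0 degs(1) by (metis degree_minus neg_equal_0_iff_equal)
    ultimately show ?thesis using le by linarith
  qed
  then have "e0 * e1 * e2 * (N + 2) \<le> e0 * e1 * e2 * (degree k0 + degree k1 + m)" by (rule mult_le_mono2)
  also have "\<dots> = e1 * e2 * (e0 * degree k0) + e0 * e2 * (e1 * degree k1) + e0 * e1 * (e2 * m)"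
    by (simp add: algebra_simps)
  also have "\<dots> = (e1 * e2 + e0 * e2 + e0 * e1) * N"
    unfolding Nk m[symmetric] by (simp add: algebra_simps)
  finally have "e0 * e1 * e2 * (N + 2) \<le> (e1 * e2 + e0 * e2 + e0 * e1) * N" .
  moreover have "e0 * e1 * e2 * N < e0 * e1 * e2 * (N + 2)" using e by simp
  ultimately have "e0 * e1 * e2 * N < (e1 * e2 + e0 * e2 + e0 * e1) * N" by linarith
  then show ?thesis by simp
qed

lemma order_power:
  fixes p :: "'a :: idom poly"
  assumes "p \<noteq> 0"
  shows "order z (p ^ n) = n * order z p"
  using assms by (induction n) (simp_all add: order_mult order_1_eq_0)

text \<open>At a zero of \<open>h0\<close> the other cofactors do not vanish, so \<open>d1\<close>
  and \<open>d2\<close>, hence their lcm, divide the order of \<open>G\<close>. The gcd with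
  \<open>d0\<close> then divides both the order of \<open>G\<close> and that of
  \<open>G * h0\<close>.\<close>

lemma order_cofactor:
  fixes G h0 h1 h2 :: "complex poly"
  assumes nz: "G \<noteq> 0" "h0 \<noteq> 0" "h1 \<noteq> 0" "h2 \<noteq> 0" and cop: "coprime h0 h1" "coprime h0 h2"
    and d: "d0 dvd order z (G * h0)" "d1 dvd order z (G * h1)" "d2 dvd order z (G * h2)"
  shows "gcd d0 (lcm d1 d2) dvd order z h0"
proof (cases "poly h0 z = 0")
  case True
  have "poly h z \<noteq> 0" if "coprime h0 h" for h
  proof
    assume "poly h z = 0"
    then have "[:-z, 1:] dvd h0" "[:-z, 1:] dvd h" using True by (simp_all add: poly_eq_0_iff_dvd)
    then have "is_unit [:-z, 1:]" using that by (meson coprime_common_divisor)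
    then show False by (simp add: is_unit_pCons_iff)
  qed
  then have "order z h1 = 0" "order z h2 = 0" using cop by (auto intro: order_0I)
  then have "d1 dvd order z G" "d2 dvd order z G" using d nz by (simp_all add: order_mult)
  then have "gcd d0 (lcm d1 d2) dvd order z G" by (meson dvd_trans gcd_dvd2 lcm_least)
  moreover have "gcd d0 (lcm d1 d2) dvd order z G + order z h0"
    using d(1) nz by (metis dvd_trans gcd_dvd1 mult_eq_0_iff order_mult)
  ultimately show ?thesis by (simp add: dvd_add_right_iff)
qed (simp add: order_0I)

text \<open>Dividing by \<open>G\<close> leaves pairwise coprime cofactors summing to zero. All
  their orders are divisible by the numbers \<open>e0\<close>, so they are perfect powers with these
  exponents and the Mason-Stothers argument applies. The exclusion of proportional summands makes
  the cofactors non-constant.\<close>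

lemma power_relation_imp_spherical:
  fixes g0 g1 g2 :: "complex poly"
  defines "e0 \<equiv> \<lambda>(d0 :: nat) d1 d2. gcd d0 (lcm d1 d2)"
  assumes sum: "g0 ^ d0 + g1 ^ d1 + g2 ^ d2 = 0" and d: "d0 > 0" "d1 > 0" "d2 > 0"
    and nz: "g0 \<noteq> 0" "g1 \<noteq> 0" "g2 \<noteq> 0"
    and nonprop: "\<And>c. g0 ^ d0 \<noteq> smult c (g2 ^ d2)"
  shows "e0 d0 d1 d2 * e0 d1 d0 d2 * e0 d2 d0 d1 <
    e0 d1 d0 d2 * e0 d2 d0 d1 + e0 d0 d1 d2 * e0 d2 d0 d1 + e0 d0 d1 d2 * e0 d1 d0 d2"
proof -
  define G where "G = gcd (g0 ^ d0) (g1 ^ d1)"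
  have G0: "G \<noteq> 0" using nz by (simp add: G_def)
  obtain h0 where h0: "g0 ^ d0 = G * h0" unfolding G_def by (meson dvdE gcd_dvd1)
  obtain h1 where h1: "g1 ^ d1 = G * h1" unfolding G_def by (meson dvdE gcd_dvd2)
  define h2 where "h2 = - h0 - h1"
  have "g2 ^ d2 = - (g0 ^ d0) - g1 ^ d1" using sum by (simp add: algebra_simps add_eq_0_iff)
  then have h2: "g2 ^ d2 = G * h2" by (simp add: h0 h1 h2_def algebra_simps)
  have hn: "h0 \<noteq> 0" "h1 \<noteq> 0" "h2 \<noteq> 0" using h0 h1 h2 nz by auto
  have cop01: "coprime h0 h1"
    using gcd_coprime[of "g0 ^ d0" "g1 ^ d1" h0 h1, folded G_def] G0 h0 h1 by (metis mult.commute)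
  have sumh: "h0 + h1 + h2 = 0" by (simp add: h2_def)
  have cop: "coprime h0 h2" "coprime h1 h2"
  proof -
    have "h1 = - h0 - h2" "h0 = - h1 - h2" by (simp_all add: h2_def)
    then show "coprime h0 h2" "coprime h1 h2"
      using cop01 by (metis coprime_common_divisor coprimeI dvd_diff dvd_minus_iff)+
  qed
  have ord: "d0 dvd order z (G * h0)" "d1 dvd order z (G * h1)" "d2 dvd order z (G * h2)" for z
    by (simp_all add: h0[symmetric] h1[symmetric] h2[symmetric] order_power nz)
  have degd: "d0 dvd degree G + degree h0" "d1 dvd degree G + degree h1" "d2 dvd degree G + degree h2"
    using h0 h1 h2 G0 hn nz by (metis degree_mult_eq degree_power_eq dvd_triv_left)+
  define a where "a = e0 d0 d1 d2"
  define b where "b = e0 d1 d0 d2"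
  define c where "c = e0 d2 d0 d1"
  have abc: "a > 0" "b > 0" "c > 0" using d by (simp_all add: a_def b_def c_def e0_def)
  have "a dvd order z h0" "b dvd order z h1" "c dvd order z h2" for z
    using order_cofactor[OF G0 hn(1,2,3) cop01 cop(1) ord(1,2,3)]
      order_cofactor[OF G0 hn(2,1,3) _ cop(2) ord(2,1,3)] cop01
      order_cofactor[OF G0 hn(3,1,2) _ _ ord(3,1,2)] cop
    unfolding a_def b_def c_def e0_def by (simp_all add: coprime_commute)
  then obtain k0 k1 k2 where k: "h0 = k0 ^ a" "h1 = k1 ^ b" "h2 = k2 ^ c"
    using exists_root_of_orders hn abc by metis
  have kn: "k0 \<noteq> 0" "k1 \<noteq> 0" "k2 \<noteq> 0" using k hn abc by auto
  have kc: "coprime k0 k1" "coprime k0 k2" "coprime k1 k2"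
    using cop01 cop abc unfolding k by simp_all
  \<comment> \<open>The analogue of \<open>order_cofactor\<close> at infinity: the two cofactors of
    top degree do not vanish there, and the degree drop of \<open>y\<close> is its order of
    vanishing.\<close>
  have dd: "gcd d0' (lcm d1' d2') dvd degree x - degree y"
    if "degree x = degree x'" "d1' dvd degree G + degree x" "d2' dvd degree G + degree x'" "d0' dvd degree G + degree y"
    for x x' y :: "complex poly" and d0' d1' d2' :: nat
  proof -
    have "gcd d0' (lcm d1' d2') dvd degree G + degree x" using that by (metis dvd_trans gcd_dvd2 lcm_least)
    moreover have "gcd d0' (lcm d1' d2') dvd degree G + degree y" using that by (meson dvd_trans gcd_dvd1)
    ultimately have "gcd d0' (lcm d1' d2') dvd (degree G + degree x) - (degree G + degree y)" by (rule dvd_diff_nat)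
    then show ?thesis by simp
  qed
  have not0: "\<not> (degree h0 = 0 \<and> degree h1 = 0 \<and> degree h2 = 0)"
  proof
    assume "degree h0 = 0 \<and> degree h1 = 0 \<and> degree h2 = 0"
    then obtain x y where xy: "h0 = [:x:]" "h2 = [:y:]" by (meson degree_eq_zeroE)
    then have "g0 ^ d0 = smult (x / y) (g2 ^ d2)" using h0 h2 hn by simp
    then show False using nonprop by blast
  qed
  \<comment> \<open>In a vanishing sum of three the top degree occurs at least twice; the pair
    attaining it has to come first in \<open>coprime_power_relation_aux\<close>.\<close>
  have "degree h0 = degree h1 \<and> degree h2 \<le> degree h0 \<or> degree h0 = degree h2 \<and> degree h1 \<le> degree h0
      \<or> degree h1 = degree h2 \<and> degree h0 \<le> degree h1"
  proof -
    have "degree h2 = degree (h0 + h1)" using degree_minus[of "h0 + h1"] by (simp add: h2_def)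
    then show ?thesis
      using degree_add_eq_left[of h1 h0] degree_add_eq_right[of h0 h1] degree_add_le_max[of h0 h1]
      by (cases "degree h0" "degree h1" rule: linorder_cases) auto
  qed
  then consider "degree h1 = degree h0" "degree h2 \<le> degree h0" | "degree h2 = degree h0" "degree h1 \<le> degree h0"
    | "degree h2 = degree h1" "degree h0 \<le> degree h1" by auto
  then have "a * b * c < b * c + a * c + a * b"
  proof cases
    case 1
    then have "degree h0 > 0" using not0 by auto
    have "c dvd degree h0 - degree h2"
      using 1 dd[of h0 h1 d0 d1 d2 h2] degd unfolding c_def e0_def by simp
    then show ?thesis
      using 1 \<open>degree h0 > 0\<close> coprime_power_relation_aux[of k0 a k1 b k2 c] kc kn abc sumh not0 by (simp add: k[symmetric])
  next
    case 2
    then have "degree h0 > 0" using not0 by auto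
    have "b dvd degree h0 - degree h1"
      using 2 dd[of h0 h2 d0 d2 d1 h1] degd unfolding b_def e0_def by simp
    then show ?thesis
      using 2 \<open>degree h0 > 0\<close> coprime_power_relation_aux[of k0 a k2 c k1 b] kc kn abc sumh not0
      by (simp add: k[symmetric] coprime_commute ac_simps)
  next
    case 3
    then have "degree h1 > 0" using not0 by auto
    have "a dvd degree h1 - degree h0"
      using 3 dd[of h1 h2 d1 d2 d0 h0] degd unfolding a_def e0_def by simp
    then show ?thesis
      using 3 \<open>degree h1 > 0\<close> coprime_power_relation_aux[of k1 b k2 c k0 a] kc kn abc sumh not0
      by (simp add: k[symmetric] coprime_commute ac_simps)
  qed
  then show ?thesis by (simp add: a_def b_def c_def)
qed

section \<open>Parametrization of trinomial surfaces\<close>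

text \<open>Bezout coefficients \<open>u\<close>, \<open>v\<close> express the parameter of the
  curve as the Laurent monomial \<open>z powi v * w powi u\<close>. This is how torus parameters are
  recovered without choosing roots.\<close>

lemma common_root_of_coprime_powers:
  fixes z w :: complex
  assumes zw: "z ^ a = w ^ b" "coprime a b" "z \<noteq> 0" "w \<noteq> 0"
  shows "\<exists>\<rho>. \<rho> \<noteq> 0 \<and> z = \<rho> ^ b \<and> w = \<rho> ^ a"
proof -
  obtain u v where uv: "u * int a + v * int b = 1"
    using bezout_int[of "int a" "int b"] assms(2) by (auto simp: coprime_iff_gcd_eq_1)
  define \<rho> where "\<rho> = z powi v * w powi u"
  have pw: "(x powi q) ^ m = x powi (q * int m)" for x :: complex and q m
    by (simp add: power_int_mult)
  have zi: "z powi (q * int a) = w powi (q * int b)" for q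
    using zw(1) by (metis power_int_mult power_int_of_nat mult.commute)
  have "\<rho> ^ b = z powi (v * int b) * z powi (u * int a)"
    by (simp add: \<rho>_def power_mult_distrib pw zi)
  also have "\<dots> = z powi (v * int b + u * int a)" using zw by (simp add: power_int_add)
  also have "v * int b + u * int a = 1" using uv by simp
  finally have 1: "\<rho> ^ b = z" by simp
  have "\<rho> ^ a = w powi (v * int b) * w powi (u * int a)"
    by (simp add: \<rho>_def power_mult_distrib pw zi)
  also have "\<dots> = w powi (v * int b + u * int a)" using zw by (simp add: power_int_add)
  also have "v * int b + u * int a = 1" using uv by simp
  finally have "\<rho> ^ a = w" by simp
  then show ?thesis using 1 zw by (intro exI[of _ \<rho>]) (auto simp: \<rho>_def)
qed

text \<open>The congruences \<open>\<alpha>\<close> = 0 mod \<open>y\<close> and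
  \<open>\<alpha>\<close> = -\<open>e\<close> mod \<open>x\<close> are compatible because the gcd
  divides \<open>e\<close>; natural-number Bezout gives a nonnegative solution.\<close>

lemma exists_shifted_multiple:
  fixes x y e :: nat
  assumes "x > 0" and "gcd x y dvd e"
  shows "\<exists>\<alpha>. y dvd \<alpha> \<and> x dvd \<alpha> + e"
proof -
  obtain p q where pq: "x * p = y * q + gcd x y" using bezout_nat[of x y] assms(1) by auto
  obtain e' where e': "e = gcd x y * e'" using assms(2) by blast
  have "y * q * e' + e = x * (p * e')" by (simp add: e' pq[symmetric] distrib_right[symmetric] mult.assoc[symmetric])
  then show ?thesis by (intro exI[of _ "y * q * e'"]) (simp add: mult.assoc)
qed

text \<open>Multiplying a solution \<open>G\<^sub>0 ^ e\<^sub>0 + G\<^sub>1 ^ e\<^sub>1 + G\<^sub>2 ^ e\<^sub>2 = 0\<close> by \<open>\<Prod>\<^sub>k G\<^sub>k ^ \<alpha>\<^sub>k\<close> turns its \<open>i\<close>-th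
  summand into a \<open>d\<^sub>i\<close>-th power.\<close>

lemma exists_exponent_matrix:
  fixes d e :: "nat \<Rightarrow> nat"
  assumes d: "\<And>i. i \<in> {0, 1, 2} \<Longrightarrow> d i > 0"
    and e: "\<And>k. k \<in> {0, 1, 2} \<Longrightarrow> gcd (d k) (Lcm (d ` ({0, 1, 2} - {k}))) dvd e k"
  shows "\<exists>\<alpha> m. \<forall>i\<in>{0, 1, 2}. \<forall>k\<in>{0, 1, 2}. m i k * d i = \<alpha> k + (if i = k then e k else 0)"
proof -
  have "\<forall>k\<in>{0, 1, 2}. \<exists>\<alpha>. Lcm (d ` ({0, 1, 2} - {k})) dvd \<alpha> \<and> d k dvd \<alpha> + e k"
    using exists_shifted_multiple[OF d e] by blast
  then obtain \<alpha> where \<alpha>: "\<And>k. k \<in> {0, 1, 2} \<Longrightarrow> Lcm (d ` ({0, 1, 2} - {k})) dvd \<alpha> k \<and> d k dvd \<alpha> k + e k"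
    by (metis (no_types, lifting))
  define m where "m i k = (\<alpha> k + (if i = k then e k else 0)) div d i" for i k
  have dvd: "d i dvd \<alpha> k + (if i = k then e k else 0)" if "i \<in> {0, 1, 2}" "k \<in> {0, 1, 2}" for i k
  proof (cases "i = k")
    case False
    then have "d i dvd Lcm (d ` ({0, 1, 2} - {k}))" using that by (intro dvd_Lcm) auto
    then show ?thesis using False \<alpha>[OF that(2)] by (auto intro: dvd_trans)
  qed (use \<alpha> that in auto)
  then have "\<forall>i\<in>{0, 1, 2}. \<forall>k\<in>{0, 1, 2}. m i k * d i = \<alpha> k + (if i = k then e k else 0)"
    unfolding m_def by (intro ballI dvd_div_mult_self dvd)
  then show ?thesis by blast
qed

text \<open>The surface \<open>y\<^sub>0 ^ d\<^sub>0 + y\<^sub>1 ^ d\<^sub>1 + y\<^sub>2 ^ d\<^sub>2 = 0\<close> with its one-dimensional torus of weights \<open>w\<close>: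
  the curve \<open>g\<close> is a section of the quotient by this torus over a rational curve with coordinate
  \<open>rp / rq\<close>.\<close>

locale trinomial_section =
  fixes d w :: "nat \<Rightarrow> nat" and D :: nat and G :: "nat \<Rightarrow> complex poly" and m :: "nat \<Rightarrow> nat \<Rightarrow> nat"
    and rp rq :: "(nat \<Rightarrow> complex) \<Rightarrow> complex"
  assumes weights: "\<forall>i\<in>{0, 1, 2}. w i * d i = D" "D > 0" "gcd (gcd (w 0) (w 1)) (w 2) = 1"
    and rp_rq: "rp \<in> poly_fun {0, 1, 2}" "rq \<in> poly_fun {0, 1, 2}"
    and root: "\<exists>k\<in>{0, 1, 2}. poly (G k) 0 = 0"
    and nonroot: "\<exists>s. \<forall>k\<in>{0, 1, 2}. poly (G k) s \<noteq> 0"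
    and section_sum: "\<forall>s. (\<Sum>i\<in>{0, 1, 2}. (\<Prod>k\<in>{0, 1, 2}. poly (G k) s ^ m i k) ^ d i) = 0"
    and section_surj: "\<forall>y. (\<forall>i\<in>{0, 1, 2}. y i \<noteq> 0) \<longrightarrow> (\<Sum>i\<in>{0, 1, 2}. y i ^ d i) = 0 \<longrightarrow>
      rq y \<noteq> 0 \<and> (\<forall>k\<in>{0, 1, 2}. poly (G k) (rp y / rq y) \<noteq> 0) \<and>
      (\<exists>\<sigma>. \<sigma> \<noteq> 0 \<and> (\<forall>i\<in>{0, 1, 2}. y i = \<sigma> ^ w i * (\<Prod>k\<in>{0, 1, 2}. poly (G k) (rp y / rq y) ^ m i k)))"
    and section_inj: "\<forall>s \<sigma>. (\<forall>k\<in>{0, 1, 2}. poly (G k) s \<noteq> 0) \<longrightarrow> \<sigma> \<noteq> 0 \<longrightarrow>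
      (\<forall>y. (\<forall>i\<in>{0, 1, 2}. y i = \<sigma> ^ w i * (\<Prod>k\<in>{0, 1, 2}. poly (G k) s ^ m i k)) \<longrightarrow> rp y / rq y = s)"

text \<open>The factor with exponents \<open>\<alpha>\<close> does not depend on \<open>i\<close>.
  It is the common factor that a relation among the \<open>G i ^ e i\<close> may be multiplied
  by.\<close>

lemma prod_exponent_matrix:
  fixes G :: "nat \<Rightarrow> complex" and i :: nat
  assumes "finite K" "i \<in> K" and "\<And>k. k \<in> K \<Longrightarrow> m k * x = \<alpha> k + (if i = k then e k else 0)"
  shows "(\<Prod>k\<in>K. G k ^ m k) ^ x = (\<Prod>k\<in>K. G k ^ \<alpha> k) * G i ^ e i"
proof -
  have "(\<Prod>k\<in>K. G k ^ m k) ^ x = (\<Prod>k\<in>K. G k ^ \<alpha> k * (if i = k then G k ^ e k else 1))"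
    unfolding prod_power_distrib using assms(3)
    by (intro prod.cong) (auto simp: power_mult[symmetric] power_add)
  also have "\<dots> = (\<Prod>k\<in>K. G k ^ \<alpha> k) * G i ^ e i"
    using assms(1,2) by (simp add: prod.distrib prod.delta)
  finally show ?thesis .
qed

text \<open>With \<open>d i\<close> coprime to the others and \<open>e = gcd (d j) (d k)\<close>,
  the exponents e_i, e_j, e_k are 1, e, e, and \<open>- (1 + s ^ e)\<close>, \<open>s\<close>,
  \<open>1\<close> solve the relation. The parameter is a quotient of monomials, and the torus
  element comes from two extractions of coprime roots.\<close>

lemma trinomial_section_coprime:
  fixes d :: "nat \<Rightarrow> nat"
  assumes d: "\<And>i. i \<in> {0, 1, 2} \<Longrightarrow> d i > 0"
    and i: "i \<in> {0, 1, 2}" and cop: "\<And>k. k \<in> {0, 1, 2} - {i} \<Longrightarrow> coprime (d i) (d k)"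
  shows "\<exists>w D G m rp rq. trinomial_section d w D G m rp rq"
proof -
  obtain j k where ijk: "{0, 1, 2} = {i, j, k}" "i \<noteq> j" "i \<noteq> k" "j \<noteq> k"
  proof -
    have "{0, 1, 2 :: nat} = {0, 1, 2}" "{0, 1, 2 :: nat} = {1, 0, 2}" "{0, 1, 2 :: nat} = {2, 0, 1}" by auto
    then show thesis using i that[of 1 2] that[of 0 2] that[of 0 1] by auto
  qed
  have dp: "d i > 0" "d j > 0" "d k > 0" using d ijk by blast+
  have ci: "coprime (d i) (d j)" "coprime (d i) (d k)" using cop unfolding ijk(1) using ijk(2-4) by blast+
  define e where "e = gcd (d j) (d k)"
  have e: "e > 0" using dp by (simp add: e_def)
  obtain a b where ab: "d j = e * a" "d k = e * b" "coprime a b"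
    using gcd_coprime_exists[of "d j" "d k"] dp unfolding e_def by (metis gcd_eq_0_iff mult.commute less_not_refl)
  have abp: "a > 0" "b > 0" using ab dp by auto
  define ee where "ee q = (if q = i then 1 else e)" for q
  have "gcd (d q) (Lcm (d ` ({i, j, k} - {q}))) dvd ee q" if "q \<in> {i, j, k}" for q
  proof -
    have "lcm (d j) (d k) dvd d j * d k" by simp
    moreover have "coprime (d i) (d j * d k)" using ci by simp
    ultimately have "coprime (d i) (lcm (d j) (d k))" using coprime_divisors dvd_refl by blast
    moreover have "gcd x (lcm (d i) y) dvd gcd x y" if "coprime (d i) x" for x y
    proof -
      have "gcd x (lcm (d i) y) dvd d i * y" by (meson dvd_trans dvd_triv_left dvd_triv_right gcd_dvd2 lcm_least)
      moreover have "coprime (gcd x (lcm (d i) y)) (d i)" using that by (meson coprime_commute coprime_divisors dvd_refl gcd_dvd1)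
      ultimately show ?thesis by (simp add: coprime_dvd_mult_right_iff)
    qed
    ultimately have "gcd (d i) (lcm (d j) (d k)) dvd 1" "gcd (d j) (lcm (d i) (d k)) dvd e" "gcd (d k) (lcm (d i) (d j)) dvd e"
      using ci unfolding e_def by (simp, blast, metis gcd.commute)
    then have A: "gcd (d i) (lcm (d j) (d k)) dvd ee i" "gcd (d j) (lcm (d i) (d k)) dvd ee j"
      "gcd (d k) (lcm (d i) (d j)) dvd ee k"
      using ijk(2-4) unfolding ee_def by metis+
    have "{i, j, k} - {i} = {j, k}" "{i, j, k} - {j} = {i, k}" "{i, j, k} - {k} = {i, j}" using ijk(2-4) by blast+
    then have "Lcm (d ` ({i, j, k} - {i})) = lcm (d j) (d k)" "Lcm (d ` ({i, j, k} - {j})) = lcm (d i) (d k)"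
      "Lcm (d ` ({i, j, k} - {k})) = lcm (d i) (d j)" by simp_all
    then show ?thesis using A that by fastforce
  qed
  then obtain \<alpha> m where "\<forall>p\<in>{i, j, k}. \<forall>q\<in>{i, j, k}. m p q * d p = \<alpha> q + (if p = q then ee q else 0)"
    using exists_exponent_matrix[of d ee, unfolded ijk(1), OF d[unfolded ijk(1)]] by blast
  then have m: "\<And>p q. p \<in> {i, j, k} \<Longrightarrow> q \<in> {i, j, k} \<Longrightarrow> m p q * d p = \<alpha> q + (if p = q then ee q else 0)"
    by blast
  define G :: "nat \<Rightarrow> complex poly" where "G q = (if q = i then - (1 + monom 1 e) else if q = j then [:0, 1:] else 1)" for q
  have G: "poly (G i) s = - (1 + s ^ e)" "poly (G j) s = s" "poly (G k) s = 1" for s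
    using ijk by (simp_all add: G_def poly_monom)
  define g where "g q s = (\<Prod>k\<in>{i, j, k}. poly (G k) s ^ m q k)" for q s
  define P where "P s = (\<Prod>k\<in>{i, j, k}. poly (G k) s ^ \<alpha> k)" for s
  have gP: "g q s ^ d q = P s * poly (G q) s ^ ee q" if "q \<in> {i, j, k}" for q s
    unfolding g_def P_def using that m[OF that] by (intro prod_exponent_matrix) auto
  have gd: "g i s ^ d i = - (1 + s ^ e) * P s" "g j s ^ d j = s ^ e * P s" "g k s ^ d k = P s" for s
    using gP[of i s] gP[of j s] gP[of k s] ijk by (simp_all add: G ee_def)
  \<comment> \<open>The \<open>e\<close>-th root of
    \<open>g j s ^ d j = s ^ e * g k s ^ d k\<close>. Taking it on the exponents, not on the values,
    leaves no ambiguity by a root of unity.\<close>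
  have gs: "g j s ^ a = s * g k s ^ b" for s
  proof -
    have "m j q * a + (if k = q then 1 else 0) = m k q * b + (if j = q then 1 else 0)" if "q \<in> {i, j, k}" for q
    proof -
      have "e * (m j q * a + (if k = q then 1 else 0)) = e * (m k q * b + (if j = q then 1 else 0))"
        using m[of j q] m[of k q] that ijk by (auto simp: ab ee_def algebra_simps)
      then show ?thesis using e by (metis mult_left_cancel less_not_refl)
    qed
    then have eq: "(\<Prod>q\<in>{i, j, k}. poly (G q) s ^ (m j q * a + (if k = q then 1 else 0)))
        = (\<Prod>q\<in>{i, j, k}. poly (G q) s ^ (m k q * b + (if j = q then 1 else 0)))"
      by (intro prod.cong) (simp_all only:)
    have "(\<Prod>q\<in>{i, j, k}. poly (G q) s ^ (m j q * a + (if k = q then 1 else 0))) = g j s ^ a"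
      using ijk by (simp add: g_def power_add power_mult power_mult_distrib G)
    moreover have "(\<Prod>q\<in>{i, j, k}. poly (G q) s ^ (m k q * b + (if j = q then 1 else 0))) = s * g k s ^ b"
      using ijk by (simp add: g_def power_add power_mult power_mult_distrib G)
    ultimately show ?thesis using eq by simp
  qed
  \<comment> \<open>The coprime positive solution of \<open>w q * d q = D\<close>, where
    \<open>D\<close> is the lcm of the three \<open>d q\<close>.\<close>
  define w where "w q = (if q = i then e * a * b else if q = j then d i * b else d i * a)" for q
  have w: "w i = e * a * b" "w j = d i * b" "w k = d i * a" using ijk by (simp_all add: w_def)
  define D where "D = d i * e * a * b"
  \<comment> \<open>Both monomials have weight \<open>d i * a * b\<close>, so \<open>rp / rq\<close>
    is invariant under the torus; on the section it equals \<open>s\<close> by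
    \<open>gs\<close>.\<close>
  define rp where "rp y = y j ^ a" for y :: "nat \<Rightarrow> complex"
  define rq where "rq y = y k ^ b" for y :: "nat \<Rightarrow> complex"
  have pow: "(\<lambda>y. y q ^ c) \<in> poly_fun {i, j, k}" if "q \<in> {i, j, k}" for q c
    using that by (induction c) (auto intro: poly_fun.intros)
  have "trinomial_section d w D G m rp rq"
    unfolding trinomial_section_def ijk(1) g_def[symmetric]
  proof (intro conjI allI impI)
    show "\<forall>q\<in>{i, j, k}. w q * d q = D" by (simp add: w ab D_def)
    show "D > 0" using dp e abp by (simp add: D_def)
    show "gcd (gcd (w 0) (w 1)) (w 2) = 1"
    proof (rule ccontr)
      assume "gcd (gcd (w 0) (w 1)) (w 2) \<noteq> 1"
      then obtain p where p: "prime p" "p dvd gcd (gcd (w 0) (w 1)) (w 2)" using prime_factor_nat by blast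
      then have "p dvd w q" if "q \<in> {0, 1, 2}" for q using that by auto
      then have pw: "p dvd e * a * b" "p dvd d i * b" "p dvd d i * a" unfolding ijk(1) w[symmetric] by blast+
      have "\<not> p dvd d i"
      proof
        assume "p dvd d i"
        moreover have "p dvd d j \<or> p dvd d k" using pw(1) p(1) by (auto simp: ab prime_dvd_mult_iff)
        ultimately show False using ci p(1) by (meson coprime_common_divisor_nat not_prime_1 coprime_common_divisor not_prime_unit)
      qed
      then have "p dvd a" "p dvd b" using pw p(1) by (auto simp: prime_dvd_mult_iff)
      then show False using ab(3) p(1) by (meson coprime_common_divisor not_prime_unit)
    qed
    show "rp \<in> poly_fun {i, j, k}" "rq \<in> poly_fun {i, j, k}"
      unfolding rp_def rq_def by (auto intro: pow)
    show "\<exists>q\<in>{i, j, k}. poly (G q) 0 = 0" using G(2)[of 0] by blast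
    show "\<exists>s. \<forall>q\<in>{i, j, k}. poly (G q) s \<noteq> 0" by (intro exI[of _ 1]) (simp add: G)
    show "(\<Sum>q\<in>{i, j, k}. g q s ^ d q) = 0" for s using ijk by (simp add: gd algebra_simps)
  next
    fix y :: "nat \<Rightarrow> complex" assume y: "\<forall>q\<in>{i, j, k}. y q \<noteq> 0" "(\<Sum>q\<in>{i, j, k}. y q ^ d q) = 0"
    define s where "s = rp y / rq y"
    have yn: "y i \<noteq> 0" "y j \<noteq> 0" "y k \<noteq> 0" using y by auto
    show "rq y \<noteq> 0" using yn by (simp add: rq_def)
    have sj: "y j ^ a = s * y k ^ b" using yn by (simp add: s_def rp_def rq_def)
    then have "y j ^ d j = s ^ e * y k ^ d k" by (metis ab(1,2) mult.commute power_mult power_mult_distrib)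
    moreover have "y i ^ d i + y j ^ d j + y k ^ d k = 0" using y(2) ijk by (simp add: add.assoc)
    ultimately have yd: "y i ^ d i = - (1 + s ^ e) * y k ^ d k" "y j ^ d j = s ^ e * y k ^ d k"
      by (simp_all add: algebra_simps eq_neg_iff_add_eq_0)
    have "s \<noteq> 0" using sj yn abp by auto
    moreover have sn': "- (1 + s ^ e) \<noteq> 0" using yd(1) yn(1) by (metis mult_zero_left power_not_zero)
    then have "1 + s ^ e \<noteq> 0" by (simp only: neg_equal_0_iff_equal not_False_eq_True)
    ultimately have sn: "s \<noteq> 0" "1 + s ^ e \<noteq> 0" by blast+
    have "poly (G i) s \<noteq> 0" "poly (G j) s \<noteq> 0" "poly (G k) s \<noteq> 0" unfolding G using sn' sn(1) by auto
    then show Gn: "\<forall>q\<in>{i, j, k}. poly (G q) (rp y / rq y) \<noteq> 0" unfolding s_def by blast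
    then have gn: "g q s \<noteq> 0" for q by (simp add: s_def g_def)
    \<comment> \<open>The torus element carrying the section point to \<open>y\<close>. Coprimality
      of \<open>a\<close> and \<open>b\<close> gives \<open>\<rho>\<close> from its \<open>j\<close>
      and \<open>k\<close> entries; coprimality of \<open>d i\<close> and \<open>e * a * b\<close>
      then refines \<open>\<rho>\<close> to \<open>\<sigma>\<close>.\<close>
    define \<zeta> where "\<zeta> q = y q / g q s" for q
    have \<zeta>n: "\<zeta> i \<noteq> 0" "\<zeta> j \<noteq> 0" "\<zeta> k \<noteq> 0" using yn gn by (simp_all add: \<zeta>_def)
    have "\<zeta> j ^ a = \<zeta> k ^ b" using sn gn yn by (simp add: \<zeta>_def power_divide sj gs)
    then obtain \<rho> where \<rho>: "\<rho> \<noteq> 0" "\<zeta> j = \<rho> ^ b" "\<zeta> k = \<rho> ^ a"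
      using common_root_of_coprime_powers ab(3) \<zeta>n by blast
    have "\<zeta> i ^ d i = (- (1 + s ^ e) * y k ^ d k) / (- (1 + s ^ e) * P s)"
      by (simp only: \<zeta>_def power_divide yd gd)
    also have "\<dots> = y k ^ d k / P s" using sn' by (rule mult_divide_mult_cancel_left)
    also have "\<dots> = \<zeta> k ^ d k" by (simp only: \<zeta>_def power_divide gd)
    also have "\<zeta> k ^ d k = \<rho> ^ (e * a * b)" by (simp add: \<rho> ab power_mult[symmetric] ac_simps)
    finally have "\<zeta> i ^ d i = \<rho> ^ (e * a * b)" .
    moreover have "coprime (d i) (e * a * b)" using ci by (simp add: ab)
    ultimately obtain \<sigma> where \<sigma>: "\<sigma> \<noteq> 0" "\<zeta> i = \<sigma> ^ (e * a * b)" "\<rho> = \<sigma> ^ d i"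
      using common_root_of_coprime_powers \<zeta>n(1) \<rho>(1) by blast
    have "\<zeta> q = \<sigma> ^ w q" if "q \<in> {i, j, k}" for q
      using that \<sigma> \<rho> by (auto simp: w power_mult)
    then have "\<forall>q\<in>{i, j, k}. y q = \<sigma> ^ w q * g q s" using gn by (auto simp: \<zeta>_def field_simps)
    then show "\<exists>\<sigma>. \<sigma> \<noteq> 0 \<and> (\<forall>q\<in>{i, j, k}. y q = \<sigma> ^ w q * g q (rp y / rq y))"
      using \<sigma>(1) unfolding s_def by blast
  next
    fix s \<sigma> :: complex and y :: "nat \<Rightarrow> complex"
    assume s: "\<forall>q\<in>{i, j, k}. poly (G q) s \<noteq> 0" "\<sigma> \<noteq> 0" and y: "\<forall>q\<in>{i, j, k}. y q = \<sigma> ^ w q * g q s"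
    then have gn: "g q s \<noteq> 0" for q by (simp add: g_def)
    have "y j ^ a = s * y k ^ b"
      using y by (simp add: w power_mult_distrib gs power_mult[symmetric] ac_simps)
    moreover have "y k ^ b \<noteq> 0" using y s(2) gn by simp
    ultimately show "rp y / rq y = s" by (simp add: rp_def rq_def)
  qed
  then show ?thesis by blast
qed

text \<open>Here \<open>d i = 2 * p i\<close> with pairwise coprime \<open>p i\<close>, so all e_i
  are 2 and the variables \<open>y i ^ p i\<close> satisfy the equation of a conic, which the
  Pythagorean formulas parametrize.\<close>

lemma trinomial_section_even:
  fixes d :: "nat \<Rightarrow> nat"
  assumes d: "\<And>i. i \<in> {0, 1, 2} \<Longrightarrow> d i > 0"
    and gcd2: "gcd (d 0) (d 1) = 2" "gcd (d 0) (d 2) = 2" "gcd (d 1) (d 2) = 2"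
  shows "\<exists>w D G m rp rq. trinomial_section d w D G m rp rq"
proof -
  define p where "p i = d i div 2" for i
  have "2 dvd d i" if "i \<in> {0, 1, 2}" for i using that gcd2 by (metis gcd_dvd1 gcd_dvd2 insertE singletonD)
  then have dp: "d i = 2 * p i" if "i \<in> {0, 1, 2}" for i using that by (simp add: p_def)
  have pp: "p i > 0" if "i \<in> {0, 1, 2}" for i using d[OF that] dp[OF that] by simp
  have d012: "d 0 = 2 * p 0" "d 1 = 2 * p 1" "d 2 = 2 * p 2" using dp by simp_all
  have cop: "coprime (p 0) (p 1)" "coprime (p 0) (p 2)" "coprime (p 1) (p 2)"
    using gcd2 unfolding d012 by (simp_all add: gcd_mult_distrib_nat[symmetric] coprime_iff_gcd_eq_1)
  have "gcd (d q) (Lcm (d ` ({0, 1, 2} - {q}))) dvd 2" if "q \<in> {0, 1, 2}" for q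
  proof -
    have "gcd (2 * x) (lcm (2 * y) (2 * z)) = 2" if "coprime x y" "coprime x z" for x y z :: nat
    proof -
      have "lcm y z dvd y * z" by simp
      then have "coprime x (lcm y z)" using that by (meson coprime_divisors coprime_mult_right_iff dvd_refl)
      then have "gcd x (lcm y z) = 1" by simp
      then show ?thesis by (simp add: gcd_mult_left lcm_mult_left)
    qed
    note two = this[of "p 0" "p 1" "p 2"] this[of "p 1" "p 0" "p 2"] this[of "p 2" "p 0" "p 1"]
    have "{0, 1, 2} - {0 :: nat} = {1, 2}" "{0, 1, 2} - {1 :: nat} = {0, 2}" "{0, 1, 2} - {2 :: nat} = {0, 1}" by auto
    then show ?thesis using that two cop unfolding coprime_commute[of "p 2"] coprime_commute[of "p 1" "p 0"]
      by (elim insertE) (simp_all add: d012[unfolded One_nat_def])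
  qed
  then obtain \<alpha> m where m: "\<And>i k. i \<in> {0, 1, 2} \<Longrightarrow> k \<in> {0, 1, 2} \<Longrightarrow> m i k * d i = \<alpha> k + (if i = k then 2 else 0)"
    using exists_exponent_matrix[of d "\<lambda>_. 2"] d by metis
  \<comment> \<open>\<open>\<alpha> k\<close> is even, since \<open>m i k * d i\<close> is. Halving
    makes \<open>g q ^ p q\<close> exactly \<open>P * G q\<close>, with no sign left open.\<close>
  define \<beta> where "\<beta> k = \<alpha> k div 2" for k
  have m': "m i k * p i = \<beta> k + (if i = k then 1 else 0)" if "i \<in> {0, 1, 2}" "k \<in> {0, 1, 2}" for i k
    using m[OF that] dp[OF that(1)] by (auto simp: \<beta>_def split: if_splits)
  define G :: "nat \<Rightarrow> complex poly" where "G q = (if q = 0 then [:0, 2:] else if q = 1 then [:1, 0, -1:] else [:\<i>, 0, \<i>:])" for q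
  have G: "poly (G 0) s = 2 * s" "poly (G 1) s = 1 - s\<^sup>2" "poly (G 2) s = \<i> * (1 + s\<^sup>2)" for s
    by (simp_all add: G_def power2_eq_square algebra_simps)
  define g where "g q s = (\<Prod>k\<in>{0, 1, 2}. poly (G k) s ^ m q k)" for q s
  define P where "P s = (\<Prod>k\<in>{0, 1, 2}. poly (G k) s ^ \<beta> k)" for s
  have gp: "g q s ^ p q = P s * poly (G q) s" if "q \<in> {0, 1, 2}" for q s
    using prod_exponent_matrix[of "{0, 1, 2}" q "m q" "p q" \<beta> "\<lambda>_. 1" "\<lambda>k. poly (G k) s"] that m'[OF that]
    by (simp only: g_def P_def power_one_right) simp
  have gp': "g 0 s ^ p 0 = P s * (2 * s)" "g 1 s ^ p 1 = P s * (1 - s\<^sup>2)" "g 2 s ^ p 2 = P s * (\<i> * (1 + s\<^sup>2))" for s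
    using gp[of 0 s] gp[of 1 s] gp[of 2 s] G by simp_all
  define w where "w q = (if q = 0 then p 1 * p 2 else if q = 1 then p 0 * p 2 else p 0 * p 1)" for q :: nat
  have w: "w 0 = p 1 * p 2" "w 1 = p 0 * p 2" "w 2 = p 0 * p 1" by (simp_all add: w_def)
  define D where "D = 2 * p 0 * p 1 * p 2"
  \<comment> \<open>Projection of the conic from the point (0, 1, -i): up to the common factor,
    \<open>rp\<close> and \<open>rq\<close> are \<open>2 * s\<close> and \<open>2\<close>.\<close>
  define rp where "rp y = y 0 ^ p 0" for y :: "nat \<Rightarrow> complex"
  define rq where "rq y = y 1 ^ p 1 + (- \<i>) * y 2 ^ p 2" for y :: "nat \<Rightarrow> complex"
  have pow: "(\<lambda>y. y q ^ c) \<in> poly_fun {0, 1, 2}" if "q \<in> {0, 1, 2}" for q c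
    using that by (induction c) (auto intro: poly_fun.intros)
  have "trinomial_section d w D G m rp rq"
    unfolding trinomial_section_def g_def[symmetric]
  proof (intro conjI allI impI)
    show "\<forall>q\<in>{0, 1, 2}. w q * d q = D" using w d012 by (simp add: D_def)
    show "D > 0" using pp by (simp add: D_def)
    show "gcd (gcd (w 0) (w 1)) (w 2) = 1"
    proof (rule ccontr)
      assume "gcd (gcd (w 0) (w 1)) (w 2) \<noteq> 1"
      then obtain q where q: "prime q" "q dvd gcd (gcd (w 0) (w 1)) (w 2)" using prime_factor_nat by blast
      then have "q dvd w 0" "q dvd w 1" "q dvd w 2" by auto
      then have "q dvd p 1 \<or> q dvd p 2" "q dvd p 0 \<or> q dvd p 2" "q dvd p 0 \<or> q dvd p 1"
        by (simp_all only: w prime_dvd_mult_iff[OF q(1)])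
      then show False using cop q(1) by (meson coprime_common_divisor not_prime_unit)
    qed
    show "rp \<in> poly_fun {0, 1, 2}" "rq \<in> poly_fun {0, 1, 2}"
      unfolding rp_def rq_def by (intro pow poly_fun.intros; simp)+
    show "\<exists>q\<in>{0, 1, 2}. poly (G q) 0 = 0" using G(1)[of 0] by auto
    have "\<forall>q\<in>{0, 1, 2}. poly (G q) 2 \<noteq> 0" using G[of 2] by (simp add: complex_eq_iff)
    then show "\<exists>s. \<forall>q\<in>{0, 1, 2}. poly (G q) s \<noteq> 0" by blast
    have "g q s ^ d q = (P s * poly (G q) s)\<^sup>2" if "q \<in> {0, 1, 2}" for q s
      using gp[OF that] by (simp only: dp[OF that] mult.commute[of 2] power_mult)
    then have "(\<Sum>q\<in>{0, 1, 2}. g q s ^ d q) = (P s)\<^sup>2 * ((2 * s)\<^sup>2 + (1 - s\<^sup>2)\<^sup>2 + (\<i> * (1 + s\<^sup>2))\<^sup>2)" for s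
      using G[of s] by (simp add: power_mult_distrib distrib_left)
    then show "(\<Sum>q\<in>{0, 1, 2}. g q s ^ d q) = 0" for s
      by (simp add: power_mult_distrib power2_eq_square algebra_simps)
  next
    fix y :: "nat \<Rightarrow> complex" assume y: "\<forall>q\<in>{0, 1, 2}. y q \<noteq> 0" "(\<Sum>q\<in>{0, 1, 2}. y q ^ d q) = 0"
    define z where "z q = y q ^ p q" for q
    have zn: "z 0 \<noteq> 0" "z 1 \<noteq> 0" "z 2 \<noteq> 0" using y(1) by (simp_all add: z_def)
    have "y q ^ d q = (z q)\<^sup>2" if "q \<in> {0, 1, 2}" for q
      by (simp only: z_def dp[OF that] mult.commute[of 2] power_mult)
    then have z: "(z 0)\<^sup>2 + (z 1)\<^sup>2 + (z 2)\<^sup>2 = 0" using y(2) by (simp add: add.assoc)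
    define Q where "Q = (z 1 - \<i> * z 2) / 2"
    \<comment> \<open>\<open>rq\<close> cannot vanish on the locus of nonzero coordinates, since it
      is a factor of the square of \<open>z 0\<close>.\<close>
    have factor: "2 * Q * (z 1 + \<i> * z 2) = - (z 0)\<^sup>2"
      using z by (simp add: Q_def algebra_simps power2_eq_square eq_neg_iff_add_eq_0)
    then have Qn: "Q \<noteq> 0" using zn by auto
    have rq: "rq y = 2 * Q" by (simp add: rq_def Q_def z_def)
    then show "rq y \<noteq> 0" using Qn by simp
    define s where "s = rp y / rq y"
    have z0: "z 0 = Q * (2 * s)" using Qn by (simp add: s_def rq rp_def z_def)
    have "2 * Q * (z 1 + \<i> * z 2) = 2 * Q * (- 2 * s\<^sup>2 * Q)"
      unfolding factor by (simp add: z0 power2_eq_square)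
    moreover have "2 * Q \<noteq> 0" using Qn by simp
    ultimately have sum: "z 1 + \<i> * z 2 = - 2 * s\<^sup>2 * Q" using mult_left_cancel by blast
    have diff: "z 1 - \<i> * z 2 = 2 * Q" by (simp add: Q_def)
    have z1: "z 1 = Q * (1 - s\<^sup>2)" using sum diff by algebra
    have "\<i> * z 2 = - Q * (1 + s\<^sup>2)" using sum diff by algebra
    then have "\<i> * (\<i> * z 2) = \<i> * (- Q * (1 + s\<^sup>2))" by simp
    then have z2: "z 2 = Q * (\<i> * (1 + s\<^sup>2))" by (simp add: algebra_simps)
    have zG: "z q = Q * poly (G q) s" if "q \<in> {0, 1, 2}" for q
      using that z0 z1 z2 G[of s] by auto
    show Gn: "\<forall>q\<in>{0, 1, 2}. poly (G q) (rp y / rq y) \<noteq> 0"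
      using zG zn unfolding s_def[symmetric] by (metis insertE mult_zero_right singletonD)
    then have gn: "g q s \<noteq> 0" for q by (simp add: s_def g_def)
    have Pn: "P s \<noteq> 0" using Gn by (simp add: s_def P_def)
    define \<zeta> where "\<zeta> q = y q / g q s" for q
    have \<zeta>n: "\<zeta> q \<noteq> 0" if "q \<in> {0, 1, 2}" for q using y(1) gn that by (auto simp: \<zeta>_def)
    have \<zeta>p: "\<zeta> q ^ p q = Q / P s" if q: "q \<in> {0, 1, 2}" for q
    proof -
      have "poly (G q) s \<noteq> 0" using Gn q by (auto simp: s_def)
      moreover have "\<zeta> q ^ p q = z q / (P s * poly (G q) s)" using gp[OF q] by (simp add: \<zeta>_def power_divide z_def)
      ultimately show ?thesis using zG[OF q] Pn by simp
    qed
    obtain \<rho> where \<rho>: "\<rho> \<noteq> 0" "\<zeta> 0 = \<rho> ^ p 1" "\<zeta> 1 = \<rho> ^ p 0"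
      using common_root_of_coprime_powers[of "\<zeta> 0" "p 0" "\<zeta> 1" "p 1"] \<zeta>p[of 0] \<zeta>p[of 1] \<zeta>n[of 0] \<zeta>n[of 1] cop by auto
    have "\<rho> ^ (p 0 * p 1) = \<zeta> 2 ^ p 2" using \<zeta>p[of 1] \<zeta>p[of 2] \<rho>(3) by (simp add: power_mult)
    moreover have "coprime (p 0 * p 1) (p 2)" using cop by simp
    ultimately obtain \<sigma> where \<sigma>: "\<sigma> \<noteq> 0" "\<rho> = \<sigma> ^ p 2" "\<zeta> 2 = \<sigma> ^ (p 0 * p 1)"
      using common_root_of_coprime_powers \<zeta>n[of 2] \<rho>(1) by blast
    have "\<zeta> q = \<sigma> ^ w q" if "q \<in> {0, 1, 2}" for q
      using that \<sigma> \<rho> w by (auto simp: power_mult[symmetric] mult.commute)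
    then have "\<forall>q\<in>{0, 1, 2}. y q = \<sigma> ^ w q * g q s" using gn by (auto simp: \<zeta>_def field_simps)
    then show "\<exists>\<sigma>. \<sigma> \<noteq> 0 \<and> (\<forall>q\<in>{0, 1, 2}. y q = \<sigma> ^ w q * g q (rp y / rq y))"
      using \<sigma>(1) unfolding s_def by blast
  next
    fix s \<sigma> :: complex and y :: "nat \<Rightarrow> complex"
    assume s: "\<forall>q\<in>{0, 1, 2}. poly (G q) s \<noteq> 0" "\<sigma> \<noteq> 0" and y: "\<forall>q\<in>{0, 1, 2}. y q = \<sigma> ^ w q * g q s"
    have Pn: "P s \<noteq> 0" using s by (simp add: P_def)
    define Q where "Q = \<sigma> ^ (p 0 * p 1 * p 2) * P s"
    have "y q ^ p q = \<sigma> ^ (w q * p q) * (P s * poly (G q) s)" if "q \<in> {0, 1, 2}" for q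
    proof -
      have "y q = \<sigma> ^ w q * g q s" using y that by blast
      then show ?thesis using gp[OF that] by (simp add: power_mult_distrib power_mult)
    qed
    then have "y q ^ p q = Q * poly (G q) s" if "q \<in> {0, 1, 2}" for q
      using that w by (auto simp: Q_def ac_simps)
    then have "y 0 ^ p 0 = Q * (2 * s)" "y 1 ^ p 1 = Q * (1 - s\<^sup>2)" "y 2 ^ p 2 = Q * (\<i> * (1 + s\<^sup>2))"
      using G[of s] by simp_all
    then have "rp y = 2 * Q * s" "rq y = 2 * Q" by (simp_all add: rp_def rq_def algebra_simps)
    moreover have "Q \<noteq> 0" using Pn s(2) by (simp add: Q_def)
    ultimately show "rp y / rq y = s" by simp
  qed
  then show ?thesis by blast
qed

section \<open>Trinomial hypersurfaces\<close>

lemma mem_tri_index: "(i, j) \<in> tri_index n \<longleftrightarrow> i \<in> {0, 1, 2} \<and> j \<in> {1..n i}"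
  by (auto simp: tri_index_def)

lemma finite_tri_index: "finite (tri_index n)"
  unfolding tri_index_def by (intro finite_SigmaI) auto

section \<open>Polynomial and regular functions along polynomial curves; points of \<open>X\<close>
  in general position\<close>

lemma poly_fun_continuous_on:
  assumes "p \<in> poly_fun I" and "\<And>i. i \<in> I \<Longrightarrow> continuous_on S (\<lambda>z. \<gamma> z i)"
  shows "continuous_on S (\<lambda>z. p (\<gamma> z))"
  using assms by (induction rule: poly_fun.induct) (auto intro: continuous_intros)

lemma poly_fun_pullback:
  assumes "p \<in> poly_fun I" and "\<And>i. i \<in> I \<Longrightarrow> \<exists>P. \<forall>t. \<gamma> t i = poly P t"
  shows "\<exists>P. \<forall>t. p (\<gamma> t) = poly P t"
  using assms
proof (induction rule: poly_fun.induct)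
  case (const c)
  have "\<forall>t. c = poly [:c:] t" by simp
  then show ?case by blast
next
  case (add p q)
  then obtain P Q where "\<forall>t. p (\<gamma> t) = poly P t" "\<forall>t. q (\<gamma> t) = poly Q t" by blast
  then have "\<forall>t. p (\<gamma> t) + q (\<gamma> t) = poly (P + Q) t" by simp
  then show ?case by blast
next
  case (mult p q)
  then obtain P Q where "\<forall>t. p (\<gamma> t) = poly P t" "\<forall>t. q (\<gamma> t) = poly Q t" by blast
  then have "\<forall>t. p (\<gamma> t) * q (\<gamma> t) = poly (P * Q) t" by simp
  then show ?case by blast
qed

lemma openin_zariski_basic:
  assumes "openin (subtopology (zariski I) X) U" and "a \<in> U"
  shows "\<exists>q\<in>poly_fun I. q a \<noteq> 0 \<and> (\<forall>x\<in>X \<inter> affine_space I. q x \<noteq> 0 \<longrightarrow> x \<in> U)"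
proof -
  obtain P where P: "P \<subseteq> poly_fun I" "U = (affine_space I - zero_locus I P) \<inter> X"
    using assms(1) unfolding openin_subtopology openin_zariski by blast
  then have "a \<in> affine_space I" "a \<notin> zero_locus I P" using assms(2) by auto
  then obtain q where "q \<in> P" "q a \<noteq> 0" unfolding zero_locus_def by blast
  then show ?thesis using P unfolding zero_locus_def by blast
qed

text \<open>Regularity only gives a quotient near \<open>L a\<close>. Multiplying numerator and
  denominator by the functions that cut out the two neighbourhoods encodes their membership
  conditions in the nonvanishing of one polynomial.\<close>

lemma regular_on_curve:
  assumes V: "openin (subtopology (zariski J) (affine_space J)) V" and f: "regular_on J V f"
    and L: "\<And>t. L t \<in> affine_space J" "\<And>j. j \<in> J \<Longrightarrow> \<exists>P. \<forall>t. L t j = poly P t" and a: "L a \<in> V"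
  shows "\<exists>P Q. poly Q a \<noteq> 0 \<and> (\<forall>t. poly Q t \<noteq> 0 \<longrightarrow> L t \<in> V \<and> f (L t) = poly P t / poly Q t)"
proof -
  obtain w where w: "w \<in> poly_fun J" "w (L a) \<noteq> 0" "\<And>x. x \<in> affine_space J \<Longrightarrow> w x \<noteq> 0 \<Longrightarrow> x \<in> V"
    using openin_zariski_basic[OF V a] by auto
  obtain V' p q where V': "openin (subtopology (zariski J) V) V'" "L a \<in> V'"
    and p: "p \<in> poly_fun J" and q: "q \<in> poly_fun J" and pq: "\<And>y. y \<in> V' \<Longrightarrow> q y \<noteq> 0 \<and> f y = p y / q y"
    using f a unfolding regular_on_def by meson
  obtain w' where w': "w' \<in> poly_fun J" "w' (L a) \<noteq> 0" "\<And>x. x \<in> V \<Longrightarrow> x \<in> affine_space J \<Longrightarrow> w' x \<noteq> 0 \<Longrightarrow> x \<in> V'"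
    using openin_zariski_basic[OF V'] by auto
  obtain W W' P Q where pull: "\<forall>t. w (L t) = poly W t" "\<forall>t. w' (L t) = poly W' t"
    "\<forall>t. p (L t) = poly P t" "\<forall>t. q (L t) = poly Q t"
    using poly_fun_pullback[OF w(1), of L, OF L(2)] poly_fun_pullback[OF w'(1), of L, OF L(2)]
      poly_fun_pullback[OF p, of L, OF L(2)] poly_fun_pullback[OF q, of L, OF L(2)] by blast
  have "poly (Q * (W * W')) a \<noteq> 0" using w w' pq[OF V'(2)] by (simp add: pull)
  moreover have "L t \<in> V \<and> f (L t) = poly (P * (W * W')) t / poly (Q * (W * W')) t"
    if "poly (Q * (W * W')) t \<noteq> 0" for t
  proof -
    have nz: "poly W t \<noteq> 0" "poly W' t \<noteq> 0" "poly Q t \<noteq> 0" using that by auto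
    then have V: "L t \<in> V" using w(3) L(1) by (simp add: pull)
    then have "L t \<in> V'" using w'(3) L(1) nz by (simp add: pull)
    then show ?thesis using pq V nz by (simp add: pull)
  qed
  ultimately show ?thesis by blast
qed

lemma poly_eqI_generic:
  fixes B p q :: "complex poly"
  assumes "B \<noteq> 0" and "\<And>t. poly B t \<noteq> 0 \<Longrightarrow> poly p t = poly q t"
  shows "p = q"
proof -
  have "poly (B * p) = poly (B * q)" using assms(2) by (intro ext) auto
  then show ?thesis using assms(1) by (simp add: poly_eq_poly_eq_iff)
qed

locale trinomial =
  fixes n :: "nat \<Rightarrow> nat" and l :: "nat \<Rightarrow> nat \<Rightarrow> nat"
  assumes n_pos: "\<And>i. i \<in> {0, 1, 2} \<Longrightarrow> n i > 0"
    and l_pos: "\<And>i j. i \<in> {0, 1, 2} \<Longrightarrow> j \<in> {1..n i} \<Longrightarrow> l i j > 0"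
begin

abbreviation I :: "(nat \<times> nat) set" where "I \<equiv> tri_index n"
abbreviation X :: "(nat \<times> nat \<Rightarrow> complex) set" where "X \<equiv> trinomial_hypersurface n l"
abbreviation \<mu> :: "nat \<Rightarrow> (nat \<times> nat \<Rightarrow> complex) \<Rightarrow> complex" where "\<mu> \<equiv> tri_monom n l"
abbreviation d :: "nat \<Rightarrow> nat" where "d \<equiv> tri_gcd n l"

definition X0 :: "(nat \<times> nat \<Rightarrow> complex) set" where
  "X0 = {x \<in> X. \<forall>k\<in>I. x k \<noteq> 0}"

lemma mem_X: "x \<in> X \<longleftrightarrow> x \<in> extensional I \<and> \<mu> 0 x + \<mu> 1 x + \<mu> 2 x = 0"
  by (simp add: trinomial_hypersurface_def zero_locus_def affine_space_def)

lemma \<mu>_nonzero: "\<mu> i x \<noteq> 0" if "\<And>k. k \<in> I \<Longrightarrow> x k \<noteq> 0" "i \<in> {0, 1, 2}"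
  using that by (simp add: tri_monom_def mem_tri_index)

lemma nonzero_of_\<mu>: "x (i, j) \<noteq> 0" if "\<mu> i x \<noteq> 0" "i \<in> {0, 1, 2}" "j \<in> {1..n i}"
  using that l_pos[of i j] by (force simp: tri_monom_def)

lemma d_dvd: "d i dvd l i j" if "j \<in> {1..n i}"
  using that by (simp add: tri_gcd_def)

lemma d_pos: "d i > 0" if "i \<in> {0, 1, 2}"
proof -
  have "1 \<in> {1..n i}" using n_pos[OF that] by simp
  then have "d i dvd l i 1" "l i 1 > 0" using d_dvd l_pos[OF that] by auto
  then show ?thesis by (meson dvd_pos_nat)
qed

text \<open>Replaces an appeal to irreducibility of \<open>X\<close>. Near any point of
  \<open>U\<close> the three monomials, each in its own variables, can be prescribed independently
  by the open mapping theorem. So there are points of \<open>U\<close> with nonzero monomials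
  summing to zero and with two different ratios.\<close>

lemma dense_two_ratios:
  assumes U: "openin (subtopology (zariski I) X) U" "U \<noteq> {}"
  obtains x y where "x \<in> U" "y \<in> U" "x \<in> X0" "y \<in> X0" "\<mu> 0 x * \<mu> 2 y \<noteq> \<mu> 0 y * \<mu> 2 x"
proof -
  obtain a where a: "a \<in> U" using U by blast
  have "U \<subseteq> X" using openin_subset[OF U(1)] by simp
  then have aX: "a \<in> X" using a by blast
  obtain q where q: "q \<in> poly_fun I" "q a \<noteq> 0" "\<And>x. x \<in> X \<Longrightarrow> q x \<noteq> 0 \<Longrightarrow> x \<in> U"
    using openin_zariski_basic[OF U(1) a] by (auto simp: mem_X affine_space_def)
  \<comment> \<open>Each block of variables is shifted by its own complex number, so each monomial
    becomes a polynomial \<open>p i\<close> in one variable.\<close>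
  define \<gamma> where "\<gamma> s = (\<lambda>(i, j)\<in>I. a (i, j) + (if i = 0 then fst s else if i = 1 then fst (snd s) else snd (snd s)))"
    for s :: "complex \<times> complex \<times> complex"
  define p where "p i z = (\<Prod>j=1..n i. (a (i, j) + z) ^ l i j)" for i :: nat and z :: complex
  have \<mu>\<gamma>: "\<mu> 0 (\<gamma> s) = p 0 (fst s)" "\<mu> 1 (\<gamma> s) = p 1 (fst (snd s))" "\<mu> 2 (\<gamma> s) = p 2 (snd (snd s))" for s
    by (auto simp: tri_monom_def p_def \<gamma>_def mem_tri_index intro!: prod.cong)
  have \<gamma>0: "\<gamma> (0, 0, 0) = a"
    using aX by (auto simp: \<gamma>_def mem_X extensional_def fun_eq_iff)
  have "continuous_on UNIV (\<lambda>s. \<gamma> s k)" if "k \<in> I" for k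
    using that by (cases k) (auto simp: \<gamma>_def mem_tri_index intro!: continuous_intros)
  then have "continuous_on UNIV (\<lambda>s. q (\<gamma> s))" using poly_fun_continuous_on[OF q(1), of UNIV \<gamma>] by simp
  then have "open {s. q (\<gamma> s) \<noteq> 0}"
    using open_Collect_neq[of "\<lambda>s. q (\<gamma> s)" "\<lambda>_. 0"] by simp
  moreover have "(0, 0, 0) \<in> {s. q (\<gamma> s) \<noteq> 0}" using q(2) \<gamma>0 by simp
  ultimately obtain A0 S where AS: "open A0" "open S" "(0, 0, 0) \<in> A0 \<times> S" "A0 \<times> S \<subseteq> {s. q (\<gamma> s) \<noteq> 0}"
    by (rule open_prod_elim)
  have "(0, 0) \<in> S" using AS(3) by simp
  with \<open>open S\<close> obtain A1 A2 where A12: "open A1" "open A2" "(0, 0) \<in> A1 \<times> A2" "A1 \<times> A2 \<subseteq> S"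
    by (rule open_prod_elim)
  have A: "q (\<gamma> (s0, s1, s2)) \<noteq> 0" if "s0 \<in> A0" "s1 \<in> A1" "s2 \<in> A2" for s0 s1 s2
    using AS(4) A12(4) that by blast
  have op: "open (p i ` B)" if "open B" and i: "i \<in> {0, 1, 2}" for i B
  proof (rule open_mapping_thm[of _ UNIV])
    show "p i holomorphic_on UNIV" unfolding p_def by (intro holomorphic_intros)
    show "\<not> p i constant_on UNIV"
    proof
      assume "p i constant_on UNIV"
      then obtain c where c: "\<And>z. p i z = c" unfolding constant_on_def by blast
      have "1 \<in> {1..n i}" using n_pos[OF i] by simp
      then have "p i (- a (i, 1)) = 0" unfolding p_def using l_pos[OF i] by (intro prod_zero) force+
      then have z: "p i z = 0" for z using c by simp
      have "finite ((\<lambda>j. - a (i, j)) ` {1..n i})" by simp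
      then obtain z where "z \<notin> (\<lambda>j. - a (i, j)) ` {1..n i}" using infinite_UNIV_char_0 ex_new_if_finite by blast
      then have "p i z \<noteq> 0" unfolding p_def by (auto simp: eq_neg_iff_add_eq_0 add.commute image_iff)
      then show False using z by simp
    qed
  qed (use that in auto)
  define z where "z i = p i 0" for i :: nat
  have z: "z 0 + z 1 + z 2 = 0"
    using aX \<mu>\<gamma>[of "(0,0,0)"] unfolding \<gamma>0 mem_X by (simp add: z_def)
  have "z 0 \<in> p 0 ` A0" "z 1 \<in> p 1 ` A1" "z 2 \<in> p 2 ` A2" using AS(3) A12(3) by (auto simp: z_def)
  moreover have "open (p 0 ` A0)" "open (p 1 ` A1)" "open (p 2 ` A2)" using AS A12 op by auto
  ultimately obtain e0 e1 e2 where e: "e0 > 0" "ball (z 0) e0 \<subseteq> p 0 ` A0" "e1 > 0" "ball (z 1) e1 \<subseteq> p 1 ` A1"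
    "e2 > 0" "ball (z 2) e2 \<subseteq> p 2 ` A2" unfolding open_contains_ball by metis
  \<comment> \<open>The half is for the middle monomial: \<open>- v - w2\<close> moves by the sum of
    the two displacements and must stay within \<open>e1\<close>.\<close>
  define e where "e = min e0 (min e1 e2) / 2"
  have e_pos: "e > 0" using e by (simp add: e_def)
  have inf: "infinite (ball w e)" for w :: complex using e_pos using uncountable_ball countable_finite by blast
  obtain w2 where w2: "w2 \<in> ball (z 2) e" "w2 \<noteq> 0" by (metis inf finite.emptyI finite.insertI finite_subset singletonI subsetI)
  \<comment> \<open>Excluding \<open>- w2\<close> keeps the middle monomial \<open>- w0 - w2\<close>
    nonzero.\<close>
  obtain w0 where w0: "w0 \<in> ball (z 0) e" "w0 \<notin> {0, - w2}" by (metis inf finite.emptyI finite.insertI finite_subset subsetI)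
  obtain w0' where w0': "w0' \<in> ball (z 0) e" "w0' \<notin> {0, - w2, w0}" by (metis inf finite.emptyI finite.insertI finite_subset subsetI)
  have point: "\<exists>x. x \<in> U \<and> x \<in> X0 \<and> \<mu> 0 x = v \<and> \<mu> 2 x = w2" if v: "v \<in> ball (z 0) e" "v \<notin> {0, - w2}" for v
  proof -
    have "dist (z 1) (- v - w2) = norm ((v - z 0) + (w2 - z 2))"
    proof -
      have "z 1 - (- v - w2) = (v - z 0) + (w2 - z 2)" using z by algebra
      then show ?thesis unfolding dist_norm by (rule arg_cong)
    qed
    also have "\<dots> \<le> norm (v - z 0) + norm (w2 - z 2)" by (rule norm_triangle_ineq)
    also have "\<dots> < e + e" using v w2 by (simp add: dist_norm norm_minus_commute)
    also have "\<dots> \<le> e1" by (simp add: e_def)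
    finally have "- v - w2 \<in> p 1 ` A1" using e by auto
    moreover have "v \<in> p 0 ` A0" "w2 \<in> p 2 ` A2" using e v(1) w2(1) by (auto simp: e_def subset_iff)
    ultimately obtain s0 s1 s2 where s: "s0 \<in> A0" "s1 \<in> A1" "s2 \<in> A2" "p 0 s0 = v" "p 1 s1 = - v - w2" "p 2 s2 = w2"
      by (auto simp: image_iff)
    let ?x = "\<gamma> (s0, s1, s2)"
    have \<mu>x: "\<mu> 0 ?x = v" "\<mu> 1 ?x = - v - w2" "\<mu> 2 ?x = w2" using s by (simp_all only: \<mu>\<gamma> fst_conv snd_conv)
    have "?x \<in> X" using \<mu>x by (simp add: mem_X \<gamma>_def)
    then have "?x \<in> U" using q(3) A s by blast
    have "- v - w2 \<noteq> 0" using v(2) by (auto simp: algebra_simps add_eq_0_iff)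
    then have "\<mu> i ?x \<noteq> 0" if "i \<in> {0, 1, 2}" for i using that \<mu>x v w2 by auto
    then have "?x \<in> X0" using \<open>?x \<in> X\<close> nonzero_of_\<mu> by (auto simp: X0_def mem_tri_index)
    then show ?thesis using \<open>?x \<in> U\<close> \<mu>x by blast
  qed
  obtain x where "x \<in> U" "x \<in> X0" "\<mu> 0 x = w0" "\<mu> 2 x = w2" using point[of w0] w0 by blast
  moreover obtain y where "y \<in> U" "y \<in> X0" "\<mu> 0 y = w0'" "\<mu> 2 y = w2" using point[of w0'] w0' by blast
  ultimately show thesis using that w0' w2 by simp
qed

text \<open>Cocharacters with positive entries along which the three monomials have equal weight; moving
  along them clears denominators.\<close>

lemma exists_positive_weights:
  "\<exists>c M. (\<forall>k\<in>I. c k > (0 :: nat)) \<and> (\<forall>i\<in>{0, 1, 2}. (\<Sum>j=1..n i. l i j * c (i, j)) = M) \<and> M > 0"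
proof -
  \<comment> \<open>A common multiple of all \<open>n i * l i j\<close>; with the weights
    \<open>c\<close>, each of the \<open>n i\<close> variables of a block contributes
    \<open>M div n i\<close>.\<close>
  define M where "M = (\<Prod>k\<in>I. l (fst k) (snd k)) * (\<Prod>i\<in>{0, 1, 2}. n i)"
  define c where "c k = M div (n (fst k) * l (fst k) (snd k))" for k
  have M: "M > 0"
    unfolding M_def using n_pos l_pos by (auto simp: mem_tri_index intro!: prod_pos)
  have dvd: "n i * l i j dvd M" if "(i, j) \<in> I" for i j
  proof -
    have "l i j dvd (\<Prod>k\<in>I. l (fst k) (snd k))"
      using that dvd_prodI[OF finite_tri_index that, of "\<lambda>k. l (fst k) (snd k)"] by simp
    moreover have "n i dvd (\<Prod>i\<in>{0, 1, 2}. n i)"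
      using that by (intro dvd_prodI) (auto simp: mem_tri_index)
    ultimately show ?thesis unfolding M_def mult.commute[of "n i"] by (rule mult_dvd_mono)
  qed
  have "c k > 0" if "k \<in> I" for k
    using that dvd[of "fst k" "snd k"] M
      by (metis c_def prod.collapse dvd_div_eq_0_iff gr0I less_not_refl)
  moreover have "(\<Sum>j=1..n i. l i j * c (i, j)) = M" if i: "i \<in> {0, 1, 2}" for i
  proof -
    have "(\<Sum>j=1..n i. l i j * c (i, j)) = (\<Sum>j=1..n i. M div n i)"
    proof (rule sum.cong)
      fix j assume j: "j \<in> {1..n i}"
      then have "n i * l i j dvd M" using dvd i by (simp add: mem_tri_index)
      then obtain m where "M = n i * l i j * m" by blast
      then show "l i j * c (i, j) = M div n i"
        using n_pos[OF i] l_pos[OF i j] by (simp add: c_def)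
    qed simp
    also have "\<dots> = M"
    proof -
      have "1 \<in> {1..n i}" using n_pos[OF i] by simp
      then have "n i dvd M" using dvd[of i 1] i by (auto simp: mem_tri_index intro: dvd_mult_left)
      then show ?thesis by simp
    qed
    finally show ?thesis .
  qed
  ultimately show ?thesis using M by blast
qed

lemma \<mu>_scale:
  assumes "i \<in> {0, 1, 2}" and "(\<Sum>j=1..n i. l i j * c (i, j)) = M"
    and "\<And>j. j \<in> {1..n i} \<Longrightarrow> y (i, j) = x (i, j) * b ^ c (i, j)"
  shows "\<mu> i y = \<mu> i x * b ^ M"
proof -
  have "\<mu> i y = (\<Prod>j=1..n i. x (i, j) ^ l i j * b ^ (l i j * c (i, j)))"
    unfolding tri_monom_def using assms(3)
    by (intro prod.cong) (simp_all add: power_mult_distrib power_mult[symmetric] mult.commute)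
  then show ?thesis by (simp add: tri_monom_def prod.distrib power_sum assms(2)[symmetric])
qed

text \<open>\<open>B\<close> is the product of the denominators of all coordinates. Since
  \<open>c k > 0\<close>, one factor \<open>B\<close> of \<open>B ^ c k\<close> is available to
  cancel the denominator of coordinate \<open>k\<close>.\<close>

lemma curve_clear_denominators:
  assumes V: "openin (subtopology (zariski J) (affine_space J)) V" and \<psi>: "morphism J V I Y \<psi>"
    and L: "\<And>t. L t \<in> affine_space J" "\<And>j. j \<in> J \<Longrightarrow> \<exists>P. \<forall>t. L t j = poly P t" and a: "L a \<in> V"
    and c: "\<And>k. k \<in> I \<Longrightarrow> c k > 0"
  shows "\<exists>B Z. poly B a \<noteq> 0 \<and> (\<forall>t. poly B t \<noteq> 0 \<longrightarrow> L t \<in> V \<and> (\<forall>k\<in>I. poly (Z k) t = \<psi> (L t) k * poly B t ^ c k))"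
proof -
  have "\<forall>k\<in>I. \<exists>P Q. poly Q a \<noteq> 0 \<and> (\<forall>t. poly Q t \<noteq> 0 \<longrightarrow> L t \<in> V \<and> \<psi> (L t) k = poly P t / poly Q t)"
    using \<psi> regular_on_curve[OF V _ L a] unfolding morphism_def by blast
  then obtain P Q where Q: "\<And>k. k \<in> I \<Longrightarrow> poly (Q k) a \<noteq> 0"
    and PQ: "\<And>k t. k \<in> I \<Longrightarrow> poly (Q k) t \<noteq> 0 \<Longrightarrow> L t \<in> V \<and> \<psi> (L t) k = poly (P k) t / poly (Q k) t"
    by metis
  define B where "B = (\<Prod>k\<in>I. Q k)"
  define Z where "Z k = P k * (\<Prod>k'\<in>I - {k}. Q k') * B ^ (c k - 1)" for k
  have B: "poly B t \<noteq> 0 \<longleftrightarrow> (\<forall>k\<in>I. poly (Q k) t \<noteq> 0)" for t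
    by (simp add: B_def poly_prod finite_tri_index)
  \<comment> \<open>\<open>L t \<in> V\<close> is read off from the presentation of a single
    coordinate, so some index must exist.\<close>
  have "1 \<in> {1..n 0}" using n_pos[of 0] by simp
  then have "(0, 1) \<in> I" by (simp add: mem_tri_index)
  moreover have "poly (Z k) t = \<psi> (L t) k * poly B t ^ c k" if k: "k \<in> I" and t: "poly B t \<noteq> 0" for k t
  proof -
    have "B = Q k * (\<Prod>k'\<in>I - {k}. Q k')" unfolding B_def by (rule prod.remove[OF finite_tri_index k])
    then have "poly B t = poly (Q k) t * poly (\<Prod>k'\<in>I - {k}. Q k') t" by simp
    moreover have "\<psi> (L t) k * poly (Q k) t = poly (P k) t" using PQ[OF k] B t k by simp
    moreover have "poly B t ^ c k = poly B t * poly B t ^ (c k - 1)" using c[OF k] by (metis Suc_pred' power_Suc)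
    ultimately show ?thesis by (simp add: Z_def)
  qed
  ultimately show ?thesis using PQ B Q by blast
qed

text \<open>The line through \<open>a\<close> and \<open>b\<close> is mapped to a rational curve in
  \<open>X\<close>; cleared of denominators, its monomials are powers \<open>g i ^ d i\<close>
  summing to zero. They are not proportional because the ratio differs at the two ends.\<close>

lemma rational_curve_imp_gcd_condition:
  assumes V: "openin (subtopology (zariski J) (affine_space J)) V" and \<psi>: "morphism J V I X \<psi>"
    and ab: "a \<in> V" "b \<in> V" "\<psi> a \<in> X0" "\<psi> b \<in> X0"
    and ne: "\<mu> 0 (\<psi> a) * \<mu> 2 (\<psi> b) \<noteq> \<mu> 0 (\<psi> b) * \<mu> 2 (\<psi> a)"
  shows "(\<exists>i\<in>{0, 1, 2}. \<forall>k\<in>{0, 1, 2} - {i}. coprime (d i) (d k)) \<or>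
    gcd (d 0) (d 1) = 2 \<and> gcd (d 0) (d 2) = 2 \<and> gcd (d 1) (d 2) = 2"
proof -
  have "V \<subseteq> affine_space J" using openin_subset[OF V] by simp
  define L where "L t = (\<lambda>j\<in>J. a j + t * (b j - a j))" for t :: complex
  have "a \<in> extensional J" "b \<in> extensional J" using ab \<open>V \<subseteq> _\<close> by (auto simp: affine_space_def)
  then have L01: "L 0 = a" "L 1 = b" by (auto simp: L_def fun_eq_iff extensional_def)
  have L: "L t \<in> affine_space J" for t by (simp add: L_def affine_space_def)
  have Lp: "\<exists>P. \<forall>t. L t j = poly P t" if "j \<in> J" for j
    using that by (intro exI[of _ "[:a j, b j - a j:]"]) (simp add: L_def)
  obtain c M where c: "\<And>k. k \<in> I \<Longrightarrow> c k > 0"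
    and M: "\<And>i. i \<in> {0, 1, 2} \<Longrightarrow> (\<Sum>j=1..n i. l i j * c (i, j)) = M" and "M > 0" using exists_positive_weights by blast
  obtain B Z where B: "poly B 0 \<noteq> 0"
    and Z: "\<And>t. poly B t \<noteq> 0 \<Longrightarrow> L t \<in> V \<and> (\<forall>k\<in>I. poly (Z k) t = \<psi> (L t) k * poly B t ^ c k)"
    using curve_clear_denominators[OF V \<psi> L Lp, of 0 c] c ab L01 by metis
  \<comment> \<open>The presentation around \<open>a\<close> may have a vanishing denominator at
    \<open>b\<close>, so \<open>b\<close> gets its own.\<close>
  obtain B' Z' where B': "poly B' 1 \<noteq> 0"
    and Z': "\<And>t. poly B' t \<noteq> 0 \<Longrightarrow> L t \<in> V \<and> (\<forall>k\<in>I. poly (Z' k) t = \<psi> (L t) k * poly B' t ^ c k)"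
    using curve_clear_denominators[OF V \<psi> L Lp, of 1 c] c ab L01 by metis
  define F where "F Z i = (\<Prod>j=1..n i. Z (i, j) ^ l i j)" for Z :: "nat \<times> nat \<Rightarrow> complex poly" and i
  have F\<mu>: "poly (F Z i) t = \<mu> i (\<lambda>k. poly (Z k) t)" for Z i t
    by (simp add: F_def tri_monom_def poly_prod)
  have F: "poly (F Z i) t = \<mu> i (\<psi> (L t)) * poly B t ^ M" if "poly B t \<noteq> 0" "i \<in> {0, 1, 2}" for i t
    unfolding F\<mu> using that Z[OF that(1)] by (intro \<mu>_scale[OF _ M]) (auto simp: mem_tri_index)
  have F': "poly (F Z' i) t = \<mu> i (\<psi> (L t)) * poly B' t ^ M" if "poly B' t \<noteq> 0" "i \<in> {0, 1, 2}" for i t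
    unfolding F\<mu> using that Z'[OF that(1)] by (intro \<mu>_scale[OF _ M]) (auto simp: mem_tri_index)
  define g where "g i = (\<Prod>j=1..n i. Z (i, j) ^ (l i j div d i))" for i
  have g: "g i ^ d i = F Z i" for i
    unfolding g_def F_def by (simp add: prod_power_distrib power_mult[symmetric] d_dvd)
  have B0: "B \<noteq> 0" "B' \<noteq> 0" using B B' by auto
  have "g 0 ^ d 0 + g 1 ^ d 1 + g 2 ^ d 2 = 0"
  proof (rule poly_eqI_generic[OF B0(1)])
    fix t assume t: "poly B t \<noteq> 0"
    then have "\<psi> (L t) \<in> X" using Z \<psi> unfolding morphism_def by blast
    then have "\<mu> 0 (\<psi> (L t)) + \<mu> 1 (\<psi> (L t)) + \<mu> 2 (\<psi> (L t)) = 0" by (simp add: mem_X)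
    moreover have "poly (g 0 ^ d 0 + g 1 ^ d 1 + g 2 ^ d 2) t
        = (\<mu> 0 (\<psi> (L t)) + \<mu> 1 (\<psi> (L t)) + \<mu> 2 (\<psi> (L t))) * poly B t ^ M"
      unfolding g poly_add using F[OF t] by (simp add: algebra_simps)
    ultimately show "poly (g 0 ^ d 0 + g 1 ^ d 1 + g 2 ^ d 2) t = poly 0 t" by simp
  qed
  moreover have "g i \<noteq> 0" if i: "i \<in> {0, 1, 2}" for i
  proof
    assume "g i = 0"
    then have "poly (F Z i) 0 = 0" using g[of i] d_pos[OF i] by (simp add: power_0_left)
    then show False using F[OF B i] B \<mu>_nonzero[OF _ i, of "\<psi> a"] ab(3) by (auto simp: L01 X0_def)
  qed
  moreover have "g 0 ^ d 0 \<noteq> smult r (g 2 ^ d 2)" for r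
  proof
    assume "g 0 ^ d 0 = smult r (g 2 ^ d 2)"
    then have r: "F Z 0 = smult r (F Z 2)" by (simp add: g)
    have r': "\<mu> 0 (\<psi> (L t)) = r * \<mu> 2 (\<psi> (L t))" if "poly B t \<noteq> 0" for t
      using arg_cong[OF r, of "\<lambda>p. poly p t"] F[OF that, of 0] F[OF that, of 2] that by simp
    \<comment> \<open>Proportionality passes from one presentation to the other through the
      parameters where neither denominator vanishes.\<close>
    have "F Z' 0 = smult r (F Z' 2)"
      using poly_eqI_generic[of "B * B'" "F Z' 0" "smult r (F Z' 2)"] B0 r' F'[of _ 0] F'[of _ 2] by simp
    then have "\<mu> 0 (\<psi> b) = r * \<mu> 2 (\<psi> b)"
      using arg_cong[of "F Z' 0" "smult r (F Z' 2)" "\<lambda>p. poly p 1"] F'[of 1 0] F'[of 1 2] B' by (simp add: L01)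
    moreover have "\<mu> 0 (\<psi> a) = r * \<mu> 2 (\<psi> a)" using r'[of 0] B by (simp add: L01)
    ultimately show False using ne by simp
  qed
  ultimately have "coprime (d 0) (d 1) \<and> coprime (d 0) (d 2) \<or> coprime (d 0) (d 1) \<and> coprime (d 1) (d 2)
      \<or> coprime (d 0) (d 2) \<and> coprime (d 1) (d 2) \<or> gcd (d 0) (d 1) = 2 \<and> gcd (d 0) (d 2) = 2 \<and> gcd (d 1) (d 2) = 2"
    using power_relation_imp_spherical[of "g 0" "d 0" "g 1" "d 1" "g 2" "d 2"] d_pos
      spherical_triple[of "d 0" "d 1" "d 2"] by simp
  then show ?thesis by (auto simp: coprime_commute)
qed

end

section \<open>Unimodular changes of monomial coordinates\<close>

lemma sum_int_delta:
  fixes f :: "'a \<Rightarrow> int"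
  assumes "finite J"
  shows "(\<Sum>i\<in>J. f i * (if i = k then c else 0)) = (if k \<in> J then f k * c else 0)"
    and "(\<Sum>i\<in>J. (if i = k then c else 0) * f i) = (if k \<in> J then c * f k else 0)"
proof -
  have "(\<Sum>i\<in>J. f i * (if i = k then c else 0)) = (\<Sum>i\<in>J. if i = k then f i * c else 0)"
    "(\<Sum>i\<in>J. (if i = k then c else 0) * f i) = (\<Sum>i\<in>J. if i = k then c * f i else 0)"
    by (auto intro: sum.cong)
  then show "(\<Sum>i\<in>J. f i * (if i = k then c else 0)) = (if k \<in> J then f k * c else 0)"
    "(\<Sum>i\<in>J. (if i = k then c else 0) * f i) = (if k \<in> J then c * f k else 0)"
    using assms by simp_all
qed

text \<open>The Smith normal form of the one-row matrix \<open>l\<close>, with the gcd placed in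
  column \<open>p\<close>. The inverse \<open>B\<close> is carried along because monomial maps are
  needed in both directions.\<close>

definition unimodular_reduction :: "'a set \<Rightarrow> ('a \<Rightarrow> nat) \<Rightarrow> 'a \<Rightarrow> ('a \<Rightarrow> 'a \<Rightarrow> int) \<Rightarrow> ('a \<Rightarrow> 'a \<Rightarrow> int) \<Rightarrow> bool" where
  "unimodular_reduction J l p A B \<longleftrightarrow>
    (\<forall>i\<in>J. \<forall>k\<in>J. (\<Sum>r\<in>J. A i r * B r k) = (if i = k then 1 else 0)) \<and>
    (\<forall>i\<in>J. \<forall>k\<in>J. (\<Sum>r\<in>J. B i r * A r k) = (if i = k then 1 else 0)) \<and>
    (\<forall>k\<in>J. (\<Sum>r\<in>J. int (l r) * A r k) = (if k = p then int (Gcd (l ` J)) else 0))"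

text \<open>The Euclidean algorithm on the entries of \<open>l\<close>, performed by elementary column operations.\<close>

lemma exists_unimodular_reduction:
  fixes l :: "'a \<Rightarrow> nat"
  assumes J: "finite J" "p \<in> J" and "j \<in> J" "l j > 0"
  shows "\<exists>A B. unimodular_reduction J l p A B"
  using assms(3-)
proof (induction "\<Sum>r\<in>J. l r" arbitrary: l j rule: less_induct)
  case less
  show ?case
  proof (cases "\<exists>j k. j \<in> J \<and> k \<in> J \<and> j \<noteq> k \<and> 0 < l k \<and> l k \<le> l j")
    case True
    then obtain j k where jk: "j \<in> J" "k \<in> J" "j \<noteq> k" "0 < l k" "l k \<le> l j" by blast
    define l' where "l' = l(j := l j - l k)"
    have "(\<Sum>r\<in>J. l' r) < (\<Sum>r\<in>J. l r)"
      using jk J by (intro sum_strict_mono_ex1) (auto simp: l'_def)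
    moreover have "l' k > 0" using jk by (simp add: l'_def)
    ultimately obtain A B where "unimodular_reduction J l' p A B"
      using less.hyps[of l' k] jk(2) by blast
    then have
      AB: "\<And>i q. i \<in> J \<Longrightarrow> q \<in> J \<Longrightarrow> (\<Sum>r\<in>J. A i r * B r q) = (if i = q then 1 else (0 :: int))" and
      BA: "\<And>i q. i \<in> J \<Longrightarrow> q \<in> J \<Longrightarrow> (\<Sum>r\<in>J. B i r * A r q) = (if i = q then 1 else 0)" and
      lA: "\<And>q. q \<in> J \<Longrightarrow> (\<Sum>r\<in>J. int (l' r) * A r q) = (if q = p then int (Gcd (l' ` J)) else 0)"
      unfolding unimodular_reduction_def by blast+
    have "Gcd (l' ` J) = Gcd (l ` J)"
    proof (rule dvd_antisym)
      have *: "Gcd (l' ` J) dvd l' r" if "r \<in> J" for r using that by simp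
      have "Gcd (l' ` J) dvd l k" using *[OF jk(2)] jk(3) by (simp add: l'_def)
      moreover have "Gcd (l' ` J) dvd l j - l k" using *[OF jk(1)] by (simp add: l'_def)
      ultimately have "Gcd (l' ` J) dvd l j" using jk(5) by (metis dvd_diffD)
      then have "Gcd (l' ` J) dvd l r" if "r \<in> J" for r
        using *[OF that] by (cases "r = j") (auto simp: l'_def)
      then show "Gcd (l' ` J) dvd Gcd (l ` J)" by (auto intro: Gcd_greatest)
      have "Gcd (l ` J) dvd l' r" if "r \<in> J" for r
        using that jk by (cases "r = j") (auto simp: l'_def intro: dvd_diff_nat)
      then show "Gcd (l ` J) dvd Gcd (l' ` J)" by (auto intro: Gcd_greatest)
    qed
    note gcd_eq = this
    \<comment> \<open>If \<open>l' = l E\<close> with the elementary matrix \<open>E\<close>, then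
      \<open>A' = E A\<close> and \<open>B' = B E^-1\<close>.\<close>
    define A' where "A' i q = A i q - (if i = k then 1 else 0) * A j q" for i q
    define B' where "B' q i = B q i + B q k * (if i = j then 1 else 0)" for q i
    have "(\<Sum>r\<in>J. A' i r * B' r q) = (if i = q then 1 else 0)" if iq: "i \<in> J" "q \<in> J" for i q
    proof -
      have "(\<Sum>r\<in>J. A' i r * B' r q) = (\<Sum>r\<in>J. A i r * B r q) + (if q = j then 1 else 0) * (\<Sum>r\<in>J. A i r * B r k)
          - (if i = k then 1 else 0) * (\<Sum>r\<in>J. A j r * B r q)
          - (if i = k then 1 else 0) * (if q = j then 1 else 0) * (\<Sum>r\<in>J. A j r * B r k)"
        unfolding A'_def B'_def sum_distrib_left sum.distrib[symmetric] sum_subtractf[symmetric]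
        by (intro sum.cong refl) (simp add: algebra_simps)
      then show ?thesis using iq jk by (simp add: AB)
    qed
    moreover have "(\<Sum>r\<in>J. B' i r * A' r q) = (if i = q then 1 else 0)" if iq: "i \<in> J" "q \<in> J" for i q
    proof -
      have "(\<Sum>r\<in>J. B' i r * A' r q) = (\<Sum>r\<in>J. B i r * A r q) - A j q * (\<Sum>r\<in>J. B i r * (if r = k then 1 else 0))
          + B i k * (\<Sum>r\<in>J. (if r = j then 1 else 0) * A r q)
          - B i k * A j q * (\<Sum>r\<in>J. (if r = j then 1 else 0) * (if r = k then 1 else 0))"
        unfolding A'_def B'_def sum_distrib_left sum.distrib[symmetric] sum_subtractf[symmetric]
        by (intro sum.cong refl) (simp add: algebra_simps)
      also have "\<dots> = (if i = q then 1 else 0)"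
        unfolding sum_int_delta[OF J(1)] BA[OF iq] using jk by simp
      finally show ?thesis .
    qed
    moreover have "(\<Sum>r\<in>J. int (l r) * A' r q) = (if q = p then int (Gcd (l ` J)) else 0)" if q: "q \<in> J" for q
    proof -
      have "(\<Sum>r\<in>J. int (l r) * A' r q) = (\<Sum>r\<in>J. int (l r) * A r q) - A j q * (\<Sum>r\<in>J. int (l r) * (if r = k then 1 else 0))"
        unfolding A'_def sum_distrib_left sum_subtractf[symmetric]
        by (intro sum.cong refl) (simp add: algebra_simps)
      also have "\<dots> = (\<Sum>r\<in>J. int (l r) * A r q) - (\<Sum>r\<in>J. (if r = j then int (l k) else 0) * A r q)"
        unfolding sum_int_delta[OF J(1)] using jk by simp
      also have "\<dots> = (\<Sum>r\<in>J. int (l' r) * A r q)"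
        unfolding sum_subtractf[symmetric] using jk
        by (intro sum.cong refl) (simp add: l'_def algebra_simps of_nat_diff)
      finally show ?thesis using lA[OF q] by (simp add: gcd_eq)
    qed
    ultimately have "unimodular_reduction J l p A' B'" unfolding unimodular_reduction_def by blast
    then show ?thesis by blast
  next
    case False
    have zero: "l r = 0" if "r \<in> J" "r \<noteq> j" for r
      using False that less.prems by (metis linorder_le_cases gr0I)
    \<comment> \<open>Only the entry at \<open>j\<close> is left; a transposition, its own inverse,
      moves it to \<open>p\<close>.\<close>
    define \<tau> where "\<tau> q = (if q = j then p else if q = p then j else q)" for q
    have \<tau>: "\<tau> (\<tau> q) = q" "q \<in> J \<Longrightarrow> \<tau> q \<in> J" for q using J(2) less.prems by (auto simp: \<tau>_def)
    define A :: "'a \<Rightarrow> 'a \<Rightarrow> int" where "A i q = (if i = \<tau> q then 1 else 0)" for i q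
    have A': "A i q = (if q = \<tau> i then 1 else 0)" for i q using \<tau>(1) by (auto simp: A_def)
    have AA: "(\<Sum>r\<in>J. A i r * A r q) = (if i = q then 1 else 0)" if "i \<in> J" "q \<in> J" for i q
    proof -
      have "(\<Sum>r\<in>J. A i r * A r q) = A i (\<tau> q) * 1"
        unfolding A_def[of _ q] sum_int_delta[OF J(1)] using \<tau>(2)[OF that(2)] by simp
      then show ?thesis using \<tau>(1) by (simp add: A_def)
    qed
    have "(\<Sum>r\<in>J. int (l r) * A r q) = (if q = p then int (Gcd (l ` J)) else 0)" if "q \<in> J" for q
    proof -
      have "(\<Sum>r\<in>J. int (l r) * A r q) = int (l (\<tau> q))"
        unfolding A_def sum_int_delta[OF J(1)] using \<tau>(2)[OF that] by simp
      moreover have "Gcd (l ` J) = l j"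
      proof (rule dvd_antisym)
        show "Gcd (l ` J) dvd l j" using less.prems by simp
        have "l j dvd l r" if "r \<in> J" for r using zero[OF that] by (cases "r = j") auto
        then show "l j dvd Gcd (l ` J)" by (auto intro: Gcd_greatest)
      qed
      moreover have "l (\<tau> q) = (if q = p then l j else 0)"
      proof (cases "q = p")
        case False
        then have "\<tau> q \<noteq> j" by (auto simp: \<tau>_def)
        then show ?thesis using False zero[OF \<tau>(2)[OF that]] by simp
      qed (auto simp: \<tau>_def)
      ultimately show ?thesis by simp
    qed
    then have "unimodular_reduction J l p A A" using AA unfolding unimodular_reduction_def by blast
    then show ?thesis by blast
  qed
qed

locale trinomial_coords = trinomial +
  fixes A B :: "nat \<Rightarrow> nat \<Rightarrow> nat \<Rightarrow> int"
  assumes unimodular: "\<And>i. i \<in> {0, 1, 2} \<Longrightarrow> unimodular_reduction {1..n i} (l i) 1 (A i) (B i)"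
begin

lemma AB: "i \<in> {0, 1, 2} \<Longrightarrow> j \<in> {1..n i} \<Longrightarrow> k \<in> {1..n i} \<Longrightarrow>
      (\<Sum>r=1..n i. A i j r * B i r k) = (if j = k then 1 else 0)"
  and BA: "i \<in> {0, 1, 2} \<Longrightarrow> j \<in> {1..n i} \<Longrightarrow> k \<in> {1..n i} \<Longrightarrow>
      (\<Sum>r=1..n i. B i j r * A i r k) = (if j = k then 1 else 0)"
  and lA: "i \<in> {0, 1, 2} \<Longrightarrow> k \<in> {1..n i} \<Longrightarrow>
      (\<Sum>r=1..n i. int (l i r) * A i r k) = (if k = 1 then int (d i) else 0)"
  using unimodular[of i] unfolding unimodular_reduction_def tri_gcd_def by blast+

end

lemma (in trinomial) exists_coords: "\<exists>A B. trinomial_coords n l A B"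
proof -
  have "\<exists>A B. unimodular_reduction {1..n i} (l i) 1 A B" if i: "i \<in> {0, 1, 2}" for i
    using exists_unimodular_reduction[of "{1..n i}" 1 1 "l i"] l_pos[OF i, of 1] n_pos[OF i] by simp
  then obtain A B where "\<And>i. i \<in> {0, 1, 2} \<Longrightarrow> unimodular_reduction {1..n i} (l i) 1 (A i) (B i)" by metis
  then have "trinomial_coords n l A B" by unfold_locales
  then show ?thesis by blast
qed

section \<open>The torus\<close>

context trinomial
begin

lemma \<mu>_mult: "\<mu> i (diag_act I t x) = \<mu> i t * \<mu> i x" if "i \<in> {0, 1, 2}"
  unfolding tri_monom_def prod.distrib[symmetric]
  using that by (intro prod.cong) (auto simp: diag_act_def mem_tri_index power_mult_distrib)

lemma tri_torus_subset: "tri_torus n l \<subseteq> tri_group n l"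
proof -
  have "topspace (subtopology (zariski I) (tri_group n l)) = tri_group n l"
    by (auto simp: topspace_zariski tri_group_def diag_torus_def)
  then show ?thesis
    unfolding tri_torus_def by (metis connected_component_of_subset_topspace)
qed

text \<open>A point \<open>exp v\<close> is joined to \<open>1\<close> by the entire curve \<open>z \<mapsto> exp (z v)\<close>.\<close>

lemma exp_mem_tri_torus:
  assumes v: "\<And>i. i \<in> {0, 1, 2} \<Longrightarrow> (\<Sum>j=1..n i. of_nat (l i j) * v (i, j)) = \<theta>"
  shows "(\<lambda>k\<in>I. exp (v k)) \<in> tri_torus n l"
proof -
  define \<gamma> where "\<gamma> z = (\<lambda>k\<in>I. exp (z * v k))" for z :: complex
  have aff: "\<gamma> z \<in> affine_space I" for z by (simp add: \<gamma>_def affine_space_def)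
  have "\<mu> i (\<gamma> z) = exp (z * \<theta>)" if i: "i \<in> {0, 1, 2}" for i z
  proof -
    have "\<mu> i (\<gamma> z) = (\<Prod>j=1..n i. exp (z * (of_nat (l i j) * v (i, j))))"
      unfolding tri_monom_def using i
      by (intro prod.cong) (auto simp: \<gamma>_def mem_tri_index exp_of_nat_mult[symmetric] algebra_simps)
    also have "\<dots> = exp (\<Sum>j=1..n i. z * (of_nat (l i j) * v (i, j)))" by (simp add: exp_sum)
    also have "\<dots> = exp (z * \<theta>)" unfolding sum_distrib_left[symmetric] v[OF i] ..
    finally show ?thesis .
  qed
  then have grp: "\<gamma> z \<in> tri_group n l" for z
    using aff by (auto simp: tri_group_def diag_torus_def \<gamma>_def)
  \<comment> \<open>Polynomial functions are continuous, so Euclidean connectedness passes to the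
    coarser Zariski topology.\<close>
  have "continuous_map euclidean (zariski I) \<gamma>"
    unfolding continuous_map_def topspace_zariski
  proof (intro conjI allI impI)
    fix U assume "openin (zariski I) U"
    then obtain P where P: "P \<subseteq> poly_fun I" "U = affine_space I - zero_locus I P" unfolding openin_zariski by blast
    have "{z. \<gamma> z \<in> U} = (\<Union>p\<in>P. {z. p (\<gamma> z) \<noteq> 0})"
      using aff by (auto simp: P(2) zero_locus_def)
    moreover have "open {z. p (\<gamma> z) \<noteq> 0}" if "p \<in> P" for p
    proof -
      have "continuous_on UNIV (\<lambda>z. \<gamma> z k)" if "k \<in> I" for k
        using that by (auto simp: \<gamma>_def intro!: continuous_intros)
      then have "continuous_on UNIV (\<lambda>z. p (\<gamma> z))"
        using poly_fun_continuous_on[of p I UNIV \<gamma>] P(1) that by blast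
      then show ?thesis using open_Collect_neq[of "\<lambda>z. p (\<gamma> z)" "\<lambda>_. 0"] by simp
    qed
    ultimately show "openin euclidean {z \<in> topspace euclidean. \<gamma> z \<in> U}" by auto
  qed (use aff in auto)
  then have "continuous_map euclidean (subtopology (zariski I) (tri_group n l)) \<gamma>"
    using grp by (auto simp: continuous_map_in_subtopology)
  then have "connectedin (subtopology (zariski I) (tri_group n l)) (range \<gamma>)"
    by (rule connectedin_continuous_map_image) (simp add: connected_UNIV)
  moreover have "(\<lambda>k\<in>I. 1) = \<gamma> 0" "(\<lambda>k\<in>I. exp (v k)) = \<gamma> 1" by (simp_all add: \<gamma>_def)
  ultimately show ?thesis
    unfolding tri_torus_def connected_component_of_def by auto
qed

end

context trinomial_coords
begin

lemma one_mem: "1 \<in> {1..n i}" if "i \<in> {0, 1, 2}"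
  using n_pos[OF that] by simp

text \<open>Multiply the row identity \<open>lA\<close> by \<open>B i\<close> on the right.\<close>

lemma B_1: "int (d i) * B i 1 j = int (l i j)" if i: "i \<in> {0, 1, 2}" and j: "j \<in> {1..n i}" for i j
proof -
  have "int (d i) * B i 1 j = (\<Sum>k=1..n i. (if k = 1 then int (d i) else 0) * B i k j)"
    using one_mem[OF i] by (simp add: sum_int_delta)
  also have "\<dots> = (\<Sum>k=1..n i. (\<Sum>r=1..n i. int (l i r) * A i r k) * B i k j)"
    by (intro sum.cong refl) (simp only: lA[OF i])
  also have "\<dots> = (\<Sum>r=1..n i. int (l i r) * (\<Sum>k=1..n i. A i r k * B i k j))"
    unfolding sum_distrib_left sum_distrib_right by (subst sum.swap) (simp add: mult.assoc)
  also have "\<dots> = (\<Sum>r=1..n i. int (l i r) * (if r = j then 1 else 0))"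
    by (intro sum.cong) (use AB[OF i _ j] in auto)
  also have "\<dots> = int (l i j)" using j by (simp add: sum_int_delta)
  finally show ?thesis .
qed

text \<open>The exponents are \<open>l i j / d i\<close> by \<open>B_1\<close>, so this is a
  \<open>d i\<close>-th root of the monomial. They are kept as integers taken from \<open>B\<close>
  to compose with the other coordinate changes.\<close>

definition \<nu> :: "nat \<Rightarrow> (nat \<times> nat \<Rightarrow> complex) \<Rightarrow> complex" where
  "\<nu> i x = (\<Prod>j=1..n i. x (i, j) powi B i 1 j)"

lemma \<nu>_power: "\<nu> i x ^ d i = \<mu> i x" if i: "i \<in> {0, 1, 2}"
  unfolding \<nu>_def tri_monom_def prod_power_distrib
proof (rule prod.cong)
  fix j assume j: "j \<in> {1..n i}"
  have "(x (i, j) powi B i 1 j) ^ d i = x (i, j) powi (B i 1 j * int (d i))" by (simp add: power_int_mult)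
  then show "(x (i, j) powi B i 1 j) ^ d i = x (i, j) ^ l i j"
    using B_1[OF i j] by (simp add: mult.commute)
qed simp

text \<open>The group \<open>tri_group\<close> can be disconnected; a common \<open>\<theta>\<close>
  for all three roots \<open>\<nu>\<close> selects its identity component. Logarithms of the
  coordinates satisfy the linear equations up to integer multiples of 2 pi i, which can be
  absorbed.\<close>

lemma mem_tri_torus:
  assumes t: "t \<in> diag_torus I" and \<nu>: "\<And>i. i \<in> {0, 1, 2} \<Longrightarrow> \<nu> i t = exp (\<theta> / of_nat (d i))"
  shows "t \<in> tri_torus n l"
proof -
  have tn: "t (i, j) \<noteq> 0" if "i \<in> {0, 1, 2}" "j \<in> {1..n i}" for i j
    using t that by (simp add: diag_torus_def mem_tri_index)
  have "\<exists>m. (\<Sum>j=1..n i. of_int (B i 1 j) * Ln (t (i, j))) = \<theta> / of_nat (d i) + of_int (2 * m) * of_real pi * \<i>"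
    if i: "i \<in> {0, 1, 2}" for i
  proof -
    have "exp (\<Sum>j=1..n i. of_int (B i 1 j) * Ln (t (i, j))) = \<nu> i t"
      unfolding \<nu>_def exp_sum[OF finite_atLeastAtMost]
      using tn[OF i] by (intro prod.cong) (auto simp: exp_power_int[symmetric])
    then show ?thesis using \<nu>[OF i] by (simp only: exp_eq of_real_mult of_real_of_int_eq)
  qed
  then obtain m where m: "\<And>i. i \<in> {0, 1, 2} \<Longrightarrow>
    (\<Sum>j=1..n i. of_int (B i 1 j) * Ln (t (i, j))) = \<theta> / of_nat (d i) + of_int (2 * m i) * of_real pi * \<i>" by metis
  \<comment> \<open>Column 1 of \<open>A i\<close> pairs with \<open>l i\<close> to
    \<open>d i\<close>, so this shift removes the defect \<open>m i\<close>. It changes each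
    logarithm by an integer multiple of 2 pi i, so the exponentials stay the same.\<close>
  define v where "v k = Ln (t k) - of_int (2 * m (fst k)) * of_real pi * \<i> * of_int (A (fst k) (snd k) 1)" for k
  have "(\<Sum>j=1..n i. of_nat (l i j) * v (i, j)) = \<theta>" if i: "i \<in> {0, 1, 2}" for i
  proof -
    define c :: complex where "c = of_int (2 * m i) * of_real pi * \<i>"
    have lB: "(of_nat (l i j) :: complex) = of_nat (d i) * of_int (B i 1 j)" if "j \<in> {1..n i}" for j
      using arg_cong[OF B_1[OF i that], of "of_int :: int \<Rightarrow> complex"] by simp
    have "(\<Sum>j=1..n i. of_nat (l i j) * v (i, j)) = (\<Sum>j=1..n i. of_nat (l i j) * Ln (t (i, j)))
        - c * (\<Sum>j=1..n i. of_nat (l i j) * of_int (A i j 1))"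
      unfolding sum_distrib_left sum_subtractf[symmetric]
      by (intro sum.cong) (simp_all add: v_def c_def algebra_simps)
    also have "(\<Sum>j=1..n i. of_nat (l i j) * of_int (A i j 1)) = (of_nat (d i) :: complex)"
      using arg_cong[OF lA[OF i one_mem[OF i]], of "of_int :: int \<Rightarrow> complex"] by simp
    also have "(\<Sum>j=1..n i. of_nat (l i j) * Ln (t (i, j))) = of_nat (d i) * (\<Sum>j=1..n i. of_int (B i 1 j) * Ln (t (i, j)))"
      unfolding sum_distrib_left by (intro sum.cong) (simp_all add: lB)
    also have "\<dots> = of_nat (d i) * (\<theta> / of_nat (d i) + c)" by (simp only: m[OF i] c_def)
    finally show ?thesis using d_pos[OF i] by (simp add: algebra_simps)
  qed
  then have "(\<lambda>k\<in>I. exp (v k)) \<in> tri_torus n l" by (rule exp_mem_tri_torus)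
  moreover have "(\<lambda>k\<in>I. exp (v k)) = t"
  proof
    fix k
    have "exp (of_int (2 * m (fst k)) * of_real pi * \<i> * of_int (A (fst k) (snd k) 1)) = (1 :: complex)"
      unfolding exp_eq_1 by (intro conjI exI[of _ "m (fst k) * A (fst k) (snd k) 1"]) simp_all
    then show "(\<lambda>k\<in>I. exp (v k)) k = t k"
      using t extensional_arb[of t I k] by (auto simp: v_def exp_diff diag_torus_def affine_space_def)
  qed
  ultimately show ?thesis by simp
qed

end

section \<open>Fractions of polynomial functions\<close>

text \<open>One quotient valid on all of \<open>U\<close>. This is closed under field operations
  without refining neighbourhoods, and implies \<open>regular_on\<close>.\<close>

definition fraction_on :: "'i set \<Rightarrow> ('i \<Rightarrow> complex) set \<Rightarrow> (('i \<Rightarrow> complex) \<Rightarrow> complex) \<Rightarrow> bool" where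
  "fraction_on I U f \<longleftrightarrow> (\<exists>p\<in>poly_fun I. \<exists>q\<in>poly_fun I. \<forall>y\<in>U. q y \<noteq> 0 \<and> f y = p y / q y)"

lemma fraction_on_poly_fun: "p \<in> poly_fun I \<Longrightarrow> fraction_on I U p"
  unfolding fraction_on_def by (rule bexI[of _ p], rule bexI[of _ "\<lambda>_. 1"]) (auto intro: poly_fun.const)

lemma fraction_on_const: "fraction_on I U (\<lambda>_. c)"
  by (intro fraction_on_poly_fun poly_fun.const)

lemma fraction_on_coord: "i \<in> I \<Longrightarrow> fraction_on I U (\<lambda>x. x i)"
  by (intro fraction_on_poly_fun poly_fun.coord)

lemma fraction_on_add:
  assumes "fraction_on I U f" "fraction_on I U g"
  shows "fraction_on I U (\<lambda>x. f x + g x)"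
proof -
  obtain p q where 1: "p \<in> poly_fun I" "q \<in> poly_fun I" "\<forall>y\<in>U. q y \<noteq> 0 \<and> f y = p y / q y"
    using assms(1) unfolding fraction_on_def by blast
  obtain p' q' where 2: "p' \<in> poly_fun I" "q' \<in> poly_fun I" "\<forall>y\<in>U. q' y \<noteq> 0 \<and> g y = p' y / q' y"
    using assms(2) unfolding fraction_on_def by blast
  have "(\<lambda>y. p y * q' y + p' y * q y) \<in> poly_fun I" "(\<lambda>y. q y * q' y) \<in> poly_fun I"
    using 1 2 by (intro poly_fun.intros; simp)+
  moreover have "\<forall>y\<in>U. q y * q' y \<noteq> 0 \<and> f y + g y = (p y * q' y + p' y * q y) / (q y * q' y)"
    using 1 2 by (simp add: add_frac_eq)
  ultimately show ?thesis unfolding fraction_on_def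
    by (intro bexI[of _ "\<lambda>y. p y * q' y + p' y * q y"] bexI[of _ "\<lambda>y. q y * q' y"]) auto
qed

lemma fraction_on_mult:
  assumes "fraction_on I U f" "fraction_on I U g"
  shows "fraction_on I U (\<lambda>x. f x * g x)"
proof -
  obtain p q where 1: "p \<in> poly_fun I" "q \<in> poly_fun I" "\<forall>y\<in>U. q y \<noteq> 0 \<and> f y = p y / q y"
    using assms(1) unfolding fraction_on_def by blast
  obtain p' q' where 2: "p' \<in> poly_fun I" "q' \<in> poly_fun I" "\<forall>y\<in>U. q' y \<noteq> 0 \<and> g y = p' y / q' y"
    using assms(2) unfolding fraction_on_def by blast
  have "(\<lambda>y. p y * p' y) \<in> poly_fun I" "(\<lambda>y. q y * q' y) \<in> poly_fun I"
    using 1 2 by (intro poly_fun.intros; simp)+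
  moreover have "\<forall>y\<in>U. q y * q' y \<noteq> 0 \<and> f y * g y = (p y * p' y) / (q y * q' y)"
    using 1 2 by simp
  ultimately show ?thesis unfolding fraction_on_def
    by (intro bexI[of _ "\<lambda>y. p y * p' y"] bexI[of _ "\<lambda>y. q y * q' y"]) auto
qed

lemma fraction_on_inverse:
  assumes "fraction_on I U f" "\<And>x. x \<in> U \<Longrightarrow> f x \<noteq> 0"
  shows "fraction_on I U (\<lambda>x. inverse (f x))"
proof -
  obtain p q where 1: "p \<in> poly_fun I" "q \<in> poly_fun I" "\<forall>y\<in>U. q y \<noteq> 0 \<and> f y = p y / q y"
    using assms(1) unfolding fraction_on_def by blast
  then have "\<forall>y\<in>U. p y \<noteq> 0 \<and> inverse (f y) = q y / p y" using assms(2) by fastforce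
  then show ?thesis unfolding fraction_on_def using 1 by blast
qed

lemma fraction_on_divide:
  assumes "fraction_on I U f" "fraction_on I U g" "\<And>x. x \<in> U \<Longrightarrow> g x \<noteq> 0"
  shows "fraction_on I U (\<lambda>x. f x / g x)"
  unfolding divide_inverse using assms by (intro fraction_on_mult fraction_on_inverse)

lemma fraction_on_power: "fraction_on I U f \<Longrightarrow> fraction_on I U (\<lambda>x. f x ^ k)"
  by (induction k) (auto intro: fraction_on_const fraction_on_mult)

lemma fraction_on_power_int:
  assumes "fraction_on I U f" "\<And>x. x \<in> U \<Longrightarrow> f x \<noteq> 0"
  shows "fraction_on I U (\<lambda>x. f x powi k)"
proof (cases "k \<ge> 0")
  case True
  then show ?thesis using fraction_on_power[OF assms(1)] by (simp add: power_int_def)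
next
  case False
  then show ?thesis using fraction_on_power[OF fraction_on_inverse[OF assms]] by (simp add: power_int_def)
qed

lemma fraction_on_prod:
  assumes "\<And>k. k \<in> K \<Longrightarrow> fraction_on I U (f k)"
  shows "fraction_on I U (\<lambda>x. \<Prod>k\<in>K. f k x)"
  using assms
  by (induction K rule: infinite_finite_induct) (auto intro: fraction_on_const fraction_on_mult)

lemma fraction_on_compose:
  assumes "p \<in> poly_fun K" "\<And>k. k \<in> K \<Longrightarrow> fraction_on I U (\<lambda>x. f x k)"
  shows "fraction_on I U (\<lambda>x. p (f x))"
  using assms by (induction rule: poly_fun.induct) (auto intro: fraction_on_const fraction_on_mult fraction_on_add)

lemma fraction_on_poly:
  assumes "fraction_on I U f"
  shows "fraction_on I U (\<lambda>x. poly p (f x))"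
proof (induction p)
  case (pCons a p)
  then show ?case
    using fraction_on_add[OF fraction_on_const fraction_on_mult[OF assms pCons.IH], of a] by simp
qed (simp add: fraction_on_const)

lemma openin_zariski_self: "U \<subseteq> affine_space I \<Longrightarrow> openin (subtopology (zariski I) U) U"
  by (metis Int_absorb1 openin_topspace topspace_subtopology topspace_zariski)

lemma regular_on_fraction:
  assumes "fraction_on I U f" "U \<subseteq> affine_space I"
  shows "regular_on I U f"
proof -
  have "openin (subtopology (zariski I) U) U"
    using assms(2) by (rule openin_zariski_self)
  then show ?thesis using assms(1) unfolding regular_on_def fraction_on_def by blast
qed

lemma openin_nonvanishing:
  assumes "p \<in> poly_fun I" "X \<subseteq> affine_space I"
  shows "openin (subtopology (zariski I) X) {x \<in> X. p x \<noteq> 0}"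
  unfolding openin_subtopology openin_zariski using assms
  by (intro exI[of _ "affine_space I - zero_locus I {p}"]) (auto simp: zero_locus_def)

lemma poly_fun_prod:
  assumes "\<And>k. k \<in> K \<Longrightarrow> f k \<in> poly_fun I"
  shows "(\<lambda>x. \<Prod>k\<in>K. f k x) \<in> poly_fun I"
  using assms by (induction K rule: infinite_finite_induct) (auto intro: poly_fun.intros)

lemma poly_fun_poly:
  assumes "f \<in> poly_fun I"
  shows "(\<lambda>x. poly p (f x)) \<in> poly_fun I"
proof (induction p)
  case (pCons a p)
  then show ?case
    using poly_fun.add[OF poly_fun.const poly_fun.mult[OF assms pCons.IH], of a] by simp
qed (simp add: poly_fun.const)

section \<open>The converse constructions\<close>

lemma power_int_sum:
  fixes x :: complex
  assumes "x \<noteq> 0"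
  shows "(\<Prod>j\<in>J. x powi f j) = x powi (\<Sum>j\<in>J. f j)"
  by (induction J rule: infinite_finite_induct) (simp_all add: power_int_add assms)

lemma prod_power_int: "(\<Prod>j\<in>J. f j) powi k = (\<Prod>j\<in>J. f j powi k)" for f :: "'a \<Rightarrow> complex"
  by (induction J rule: infinite_finite_induct) (simp_all add: power_int_mult_distrib)

text \<open>Composition of monomial maps is multiplication of exponent matrices.\<close>

lemma monomial_compose:
  fixes x :: "'a \<Rightarrow> complex"
  assumes "\<And>k. k \<in> K \<Longrightarrow> x k \<noteq> 0"
  shows "(\<Prod>j\<in>J. (\<Prod>k\<in>K. x k powi a j k) powi b j) = (\<Prod>k\<in>K. x k powi (\<Sum>j\<in>J. b j * a j k))"
proof -
  have "(\<Prod>j\<in>J. (\<Prod>k\<in>K. x k powi a j k) powi b j) = (\<Prod>j\<in>J. \<Prod>k\<in>K. x k powi (b j * a j k))"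
    by (simp add: prod_power_int power_int_mult[symmetric] mult.commute)
  also have "\<dots> = (\<Prod>k\<in>K. \<Prod>j\<in>J. x k powi (b j * a j k))" by (rule prod.swap)
  also have "\<dots> = (\<Prod>k\<in>K. x k powi (\<Sum>j\<in>J. b j * a j k))"
    using assms by (intro prod.cong) (simp_all add: power_int_sum)
  finally show ?thesis .
qed

lemma prod_powi_delta:
  fixes x :: "nat \<Rightarrow> complex"
  assumes "finite K" "j \<in> K"
  shows "(\<Prod>k\<in>K. x k powi (if j = k then 1 else 0)) = x j"
proof -
  have "(\<Prod>k\<in>K. x k powi (if j = k then 1 else 0)) = (\<Prod>k\<in>K. if j = k then x k else 1)"
    by (intro prod.cong) auto
  then show ?thesis using assms by simp
qed

section \<open>The open set \<open>X0\<close>, and necessity of the arithmetic condition\<close>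

context trinomial
begin

lemma X_subset: "X \<subseteq> affine_space I"
  by (auto simp: mem_X affine_space_def)

lemma X_nonempty: "X \<noteq> {}"
proof -
  have "\<mu> i (\<lambda>k\<in>I. 0) = 0" if i: "i \<in> {0, 1, 2}" for i
  proof -
    have "1 \<in> {1..n i}" using n_pos[OF i] by simp
    then show ?thesis unfolding tri_monom_def using i l_pos[OF i]
      by (intro prod_zero) (auto intro!: bexI[of _ 1] simp: mem_tri_index)
  qed
  then have "(\<lambda>k\<in>I. 0) \<in> X" by (simp add: mem_X)
  then show ?thesis by blast
qed

lemma X0_nonempty: "X0 \<noteq> {}"
proof -
  have "openin (subtopology (zariski I) X) X"
    using X_subset by (rule openin_zariski_self)
  then show ?thesis using dense_two_ratios[OF _ X_nonempty] by blast
qed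

lemma openin_X0: "openin (subtopology (zariski I) X) X0"
proof -
  have "X0 = {x \<in> X. (\<Prod>k\<in>I. x k) \<noteq> 0}"
    by (auto simp: X0_def finite_tri_index)
  moreover have "(\<lambda>x. \<Prod>k\<in>I. x k) \<in> poly_fun I" by (intro poly_fun_prod poly_fun.coord)
  ultimately show ?thesis using openin_nonvanishing[OF _ X_subset] by simp
qed

lemma torus_act_X0:
  assumes t: "t \<in> tri_torus n l" and x: "x \<in> X0"
  obtains \<kappa> where "\<kappa> \<noteq> 0" "\<And>i. i \<in> {0, 1, 2} \<Longrightarrow> \<mu> i (diag_act I t x) = \<kappa> * \<mu> i x" "diag_act I t x \<in> X0"
proof -
  have t': "t \<in> diag_torus I" "\<mu> 0 t = \<mu> 1 t" "\<mu> 1 t = \<mu> 2 t" using t tri_torus_subset by (auto simp: tri_group_def)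
  have act: "\<mu> i (diag_act I t x) = \<mu> 0 t * \<mu> i x" if "i \<in> {0, 1, 2}" for i
    using \<mu>_mult[OF that] that t' by auto
  have "\<mu> 0 (diag_act I t x) + \<mu> 1 (diag_act I t x) + \<mu> 2 (diag_act I t x) = \<mu> 0 t * (\<mu> 0 x + \<mu> 1 x + \<mu> 2 x)"
    using act[of 0] act[of 1] act[of 2] by (simp add: algebra_simps)
  also have "\<dots> = 0" using x by (simp add: X0_def mem_X)
  finally have "diag_act I t x \<in> X" by (simp add: mem_X diag_act_def)
  then have "diag_act I t x \<in> X0" using x t' by (auto simp: X0_def diag_act_def diag_torus_def)
  moreover have "\<mu> 0 t \<noteq> 0" using t' by (intro \<mu>_nonzero) (auto simp: diag_torus_def)
  ultimately show thesis using that act by blast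
qed

lemma rational_imp_gcd_condition:
  assumes "rational_variety I X"
  shows "(\<exists>i\<in>{0, 1, 2}. \<forall>k\<in>{0, 1, 2} - {i}. coprime (d i) (d k)) \<or>
    gcd (d 0) (d 1) = 2 \<and> gcd (d 0) (d 2) = 2 \<and> gcd (d 1) (d 2) = 2"
proof -
  obtain p :: nat and U V \<phi> \<psi> where U: "openin (subtopology (zariski I) X) U" "U \<noteq> {}"
    and V: "openin (subtopology (zariski {..<p}) (affine_space {..<p})) V"
    and \<phi>: "morphism I U {..<p} V \<phi>" and \<psi>: "morphism {..<p} V I U \<psi>" and inv: "\<forall>x\<in>U. \<psi> (\<phi> x) = x"
    using assms unfolding rational_variety_def birational_def by blast
  obtain x y where xy: "x \<in> U" "y \<in> U" "x \<in> X0" "y \<in> X0" "\<mu> 0 x * \<mu> 2 y \<noteq> \<mu> 0 y * \<mu> 2 x"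
    using dense_two_ratios[OF U] by blast
  have "U \<subseteq> X" using openin_subset[OF U(1)] by simp
  then have \<psi>': "morphism {..<p} V I X \<psi>" using \<psi> unfolding morphism_def by blast
  have "\<phi> x \<in> V" "\<phi> y \<in> V" using \<phi> xy unfolding morphism_def by blast+
  then show ?thesis
    using rational_curve_imp_gcd_condition[OF V \<psi>', of "\<phi> x" "\<phi> y"] inv xy by simp
qed

text \<open>The torus scales all monomials alike, so meeting the orbits of two points with different
  monomial ratios forces the curve to show both ratios.\<close>

lemma horizontal_imp_gcd_condition:
  assumes curve: "polynomial_curve I X \<tau>" and hor: "horizontal I (tri_torus n l) X \<tau>"
  shows "(\<exists>i\<in>{0, 1, 2}. \<forall>k\<in>{0, 1, 2} - {i}. coprime (d i) (d k)) \<or>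
    gcd (d 0) (d 1) = 2 \<and> gcd (d 0) (d 2) = 2 \<and> gcd (d 1) (d 2) = 2"
proof -
  obtain W where W: "openin (subtopology (zariski I) X) W" "W \<noteq> {}"
    and meet: "\<And>x. x \<in> W \<Longrightarrow> range \<tau> \<inter> diag_orbit I (tri_torus n l) x \<noteq> {}"
    using hor unfolding horizontal_def by blast
  obtain x y where xy: "x \<in> W" "y \<in> W" "x \<in> X0" "y \<in> X0" "\<mu> 0 x * \<mu> 2 y \<noteq> \<mu> 0 y * \<mu> 2 x"
    using dense_two_ratios[OF W] by blast
  obtain a t where a: "t \<in> tri_torus n l" "\<tau> a = diag_act I t x" using meet[OF xy(1)] unfolding diag_orbit_def by force
  obtain b u where b: "u \<in> tri_torus n l" "\<tau> b = diag_act I u y" using meet[OF xy(2)] unfolding diag_orbit_def by force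
  obtain \<kappa> where \<kappa>: "\<kappa> \<noteq> 0" "\<And>i. i \<in> {0, 1, 2} \<Longrightarrow> \<mu> i (\<tau> a) = \<kappa> * \<mu> i x" "\<tau> a \<in> X0"
    using torus_act_X0[OF a(1) xy(3)] unfolding a(2) by blast
  obtain \<kappa>' where \<kappa>': "\<kappa>' \<noteq> 0" "\<And>i. i \<in> {0, 1, 2} \<Longrightarrow> \<mu> i (\<tau> b) = \<kappa>' * \<mu> i y" "\<tau> b \<in> X0"
    using torus_act_X0[OF b(1) xy(4)] unfolding b(2) by blast
  have V: "openin (subtopology (zariski (UNIV :: unit set)) (affine_space UNIV)) (affine_space UNIV)"
    by (rule openin_zariski_self) simp
  have "\<mu> 0 (\<tau> a) * \<mu> 2 (\<tau> b) \<noteq> \<mu> 0 (\<tau> b) * \<mu> 2 (\<tau> a)"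
    using xy(5) \<kappa> \<kappa>' by (auto simp: ac_simps)
  then show ?thesis
    using rational_curve_imp_gcd_condition[OF V, of "\<lambda>s. \<tau> (s ())" "\<lambda>_. a" "\<lambda>_. b"] curve \<kappa>(3) \<kappa>'(3)
    by (simp add: polynomial_curve_def affine_space_def)
qed

end

section \<open>Sufficiency: the curve and the birational map obtained from a section\<close>

locale trinomial_rational = trinomial_coords n l A B + trinomial_section "tri_gcd n l" w D G m rp rq
  for n l A B w D G m rp rq
begin

definition g :: "nat \<Rightarrow> complex \<Rightarrow> complex" where
  "g i s = (\<Prod>k\<in>{0, 1, 2}. poly (G k) s ^ m i k)"

lemma g_nonzero: "g i s \<noteq> 0" if "\<forall>k\<in>{0, 1, 2}. poly (G k) s \<noteq> 0"
  using that by (simp add: g_def)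

lemma g_sum: "g 0 s ^ d 0 + g 1 s ^ d 1 + g 2 s ^ d 2 = 0"
  using section_sum by (simp add: g_def add.assoc)

lemma \<nu>_nonzero: "\<nu> i x \<noteq> 0" if "x \<in> X0" "i \<in> {0, 1, 2}"
  using that by (auto simp: \<nu>_def X0_def mem_tri_index)

lemma section_of_point:
  assumes x: "x \<in> X0" and s: "s = rp (\<lambda>i. \<nu> i x) / rq (\<lambda>i. \<nu> i x)"
  shows "rq (\<lambda>i. \<nu> i x) \<noteq> 0" "\<forall>k\<in>{0, 1, 2}. poly (G k) s \<noteq> 0"
    "\<exists>\<sigma>. \<sigma> \<noteq> 0 \<and> (\<forall>i\<in>{0, 1, 2}. \<nu> i x = \<sigma> ^ w i * g i s)"
proof -
  have "\<forall>i\<in>{0, 1, 2}. \<nu> i x \<noteq> 0" using \<nu>_nonzero[OF x] by blast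
  moreover have "(\<Sum>i\<in>{0, 1, 2}. \<nu> i x ^ d i) = 0"
    using x \<nu>_power[of 0] \<nu>_power[of 1] \<nu>_power[of 2] by (simp add: X0_def mem_X add.assoc)
  ultimately show "rq (\<lambda>i. \<nu> i x) \<noteq> 0" "\<forall>k\<in>{0, 1, 2}. poly (G k) s \<noteq> 0"
    "\<exists>\<sigma>. \<sigma> \<noteq> 0 \<and> (\<forall>i\<in>{0, 1, 2}. \<nu> i x = \<sigma> ^ w i * g i s)"
    using section_surj[THEN spec, of "\<lambda>i. \<nu> i x"] unfolding g_def s by blast+
qed

text \<open>The lift with coordinates \<open>g i powi A i j 1\<close> of the section may have
  negative exponents on the \<open>G k\<close>. Acting by the positive cocharacter \<open>c\<close>
  at the \<open>K\<close>-th power of the product \<open>q\<close> of the \<open>G k\<close> makes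
  them positive and, where \<open>q\<close> does not vanish, stays in the same torus orbit.\<close>

lemma exists_horizontal_curve: "\<exists>\<tau>. polynomial_curve I X \<tau> \<and> horizontal I (tri_torus n l) X \<tau>"
proof -
  obtain c M where c: "\<forall>k\<in>I. c k > (0 :: nat)" and M: "\<And>i. i \<in> {0, 1, 2} \<Longrightarrow> (\<Sum>j=1..n i. l i j * c (i, j)) = M"
    using exists_positive_weights by blast
  define N where "N i = (\<Sum>j=1..n i. B i 1 j * int (c (i, j)))" for i
  have N: "int (d i) * N i = int M" if i: "i \<in> {0, 1, 2}" for i
    unfolding N_def sum_distrib_left mult.assoc[symmetric] using B_1[OF i]
    by (simp flip: M[OF i])
  \<comment> \<open>Larger than the absolute value of every exponent that has to be
    compensated.\<close>
  define K where "K = 1 + (\<Sum>k\<in>{0, 1, 2}. \<Sum>(i, j)\<in>I. nat \<bar>A i j 1 * int (m i k)\<bar>)"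
  define E where "E i j k = nat (A i j 1 * int (m i k) + int (K * c (i, j)))" for i j k
  have Epos: "A i j 1 * int (m i k) + int (K * c (i, j)) > 0" if "(i, j) \<in> I" "k \<in> {0, 1, 2}" for i j k
  proof -
    have "nat \<bar>A i j 1 * int (m i k)\<bar> \<le> (\<Sum>(i, j)\<in>I. nat \<bar>A i j 1 * int (m i k)\<bar>)"
      using member_le_sum[OF that(1), of "\<lambda>(i, j). nat \<bar>A i j 1 * int (m i k)\<bar>"] finite_tri_index by simp
    also have "\<dots> \<le> (\<Sum>k\<in>{0, 1, 2}. \<Sum>(i, j)\<in>I. nat \<bar>A i j 1 * int (m i k)\<bar>)"
      using that(2) by (intro member_le_sum) auto
    finally have "nat \<bar>A i j 1 * int (m i k)\<bar> < K" unfolding K_def by linarith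
    moreover have "K * 1 \<le> K * c (i, j)" using c that(1) by (intro mult_le_mono2) (simp add: Suc_le_eq)
    ultimately have "\<bar>A i j 1 * int (m i k)\<bar> < int (K * c (i, j))" by linarith
    then show ?thesis by linarith
  qed
  then have E: "int (E i j k) = A i j 1 * int (m i k) + int (K * c (i, j))" "E i j k > 0"
    if "(i, j) \<in> I" "k \<in> {0, 1, 2}" for i j k
    using that by (force simp: E_def)+
  define \<tau> where "\<tau> s = (\<lambda>(i, j)\<in>I. \<Prod>k\<in>{0, 1, 2}. poly (G k) s ^ E i j k)" for s
  define q where "q s = (\<Prod>k\<in>{0, 1, 2}. poly (G k) s)" for s
  have \<mu>\<tau>: "\<mu> i (\<tau> s) = g i s ^ d i * q s ^ (K * M)" if i: "i \<in> {0, 1, 2}" for i s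
  proof -
    have lE: "(\<Sum>j=1..n i. E i j k * l i j) = m i k * d i + K * M" if k: "k \<in> {0, 1, 2}" for k
    proof -
      have "int (\<Sum>j=1..n i. E i j k * l i j) = (\<Sum>j=1..n i. int (m i k) * (int (l i j) * A i j 1) + int K * int (l i j * c (i, j)))"
        unfolding of_nat_sum using i k by (intro sum.cong) (simp_all add: E mem_tri_index algebra_simps)
      also have "\<dots> = int (m i k) * int (d i) + int K * int M"
        unfolding sum.distrib sum_distrib_left[symmetric] lA[OF i one_mem[OF i]] of_nat_sum[symmetric] M[OF i] by simp
      also have "\<dots> = int (m i k * d i + K * M)" by simp
      finally show ?thesis by (simp only: of_nat_eq_iff)
    qed
    have "\<mu> i (\<tau> s) = (\<Prod>j=1..n i. \<Prod>k\<in>{0, 1, 2}. poly (G k) s ^ (E i j k * l i j))"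
      unfolding tri_monom_def using i by (intro prod.cong) (simp_all add: \<tau>_def mem_tri_index power_mult power_mult_distrib)
    also have "\<dots> = (\<Prod>k\<in>{0, 1, 2}. \<Prod>j=1..n i. poly (G k) s ^ (E i j k * l i j))" by (rule prod.swap)
    also have "\<dots> = (\<Prod>k\<in>{0, 1, 2}. poly (G k) s ^ (m i k * d i + K * M))"
      by (intro prod.cong refl) (simp only: power_sum[symmetric] lE)
    also have "\<dots> = g i s ^ d i * q s ^ (K * M)"
      by (simp add: g_def q_def power_add power_mult power_mult_distrib)
    finally show ?thesis .
  qed
  have \<tau>X: "\<tau> s \<in> X" for s
  proof -
    have "\<mu> 0 (\<tau> s) + \<mu> 1 (\<tau> s) + \<mu> 2 (\<tau> s) = (g 0 s ^ d 0 + g 1 s ^ d 1 + g 2 s ^ d 2) * q s ^ (K * M)"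
      using \<mu>\<tau>[of 0 s] \<mu>\<tau>[of 1 s] \<mu>\<tau>[of 2 s] by (simp add: algebra_simps)
    moreover have "\<tau> s \<in> extensional I" by (simp add: \<tau>_def)
    ultimately show ?thesis unfolding mem_X g_sum by simp
  qed
  have \<nu>\<tau>: "\<nu> i (\<tau> s) = g i s * q s powi (int K * N i)" if i: "i \<in> {0, 1, 2}" and s: "\<forall>k\<in>{0, 1, 2}. poly (G k) s \<noteq> 0" for i s
  proof -
    have BE: "(\<Sum>j=1..n i. B i 1 j * int (E i j k)) = int (m i k) + int K * N i" if k: "k \<in> {0, 1, 2}" for k
    proof -
      have "(\<Sum>j=1..n i. B i 1 j * int (E i j k)) = (\<Sum>j=1..n i. int (m i k) * (B i 1 j * A i j 1) + int K * (B i 1 j * int (c (i, j))))"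
        using i k by (intro sum.cong) (simp_all add: E mem_tri_index algebra_simps)
      then show ?thesis
        using BA[OF i one_mem[OF i] one_mem[OF i]] by (simp add: sum.distrib sum_distrib_left[symmetric] N_def)
    qed
    have "\<nu> i (\<tau> s) = (\<Prod>j=1..n i. (\<Prod>k\<in>{0, 1, 2}. poly (G k) s powi int (E i j k)) powi B i 1 j)"
      unfolding \<nu>_def using i by (intro prod.cong) (simp_all add: \<tau>_def mem_tri_index)
    also have "\<dots> = (\<Prod>k\<in>{0, 1, 2}. poly (G k) s powi (\<Sum>j=1..n i. B i 1 j * int (E i j k)))"
      using s by (intro monomial_compose) blast
    also have "\<dots> = (\<Prod>k\<in>{0, 1, 2}. poly (G k) s ^ m i k * poly (G k) s powi (int K * N i))"
    proof (intro prod.cong refl)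
      fix k :: nat assume k: "k \<in> {0, 1, 2}"
      then have "poly (G k) s \<noteq> 0" using s by blast
      then show "poly (G k) s powi (\<Sum>j=1..n i. B i 1 j * int (E i j k)) = poly (G k) s ^ m i k * poly (G k) s powi (int K * N i)"
        by (simp only: BE[OF k]) (simp add: power_int_add)
    qed
    also have "\<dots> = g i s * q s powi (int K * N i)"
      unfolding prod.distrib g_def q_def prod_power_int ..
    finally show ?thesis .
  qed
  have one: "(0, 1) \<in> I" using one_mem[of 0] by (simp add: mem_tri_index)
  obtain k0 where k0: "k0 \<in> {0, 1, 2}" "poly (G k0) 0 = 0" using root by blast
  obtain s1 where s1: "\<forall>k\<in>{0, 1, 2}. poly (G k) s1 \<noteq> 0" using nonroot by blast
  \<comment> \<open>All exponents \<open>E\<close> are positive, so a root of one \<open>G k\<close>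
    annihilates the coordinate; with a parameter that is no root this shows that
    \<open>\<tau>\<close> is not constant.\<close>
  have "\<tau> 0 (0, 1) = 0"
    using k0 E(2)[OF one k0(1)] one unfolding \<tau>_def by (auto intro!: prod_zero bexI[of _ k0])
  moreover have "\<tau> s1 (0, 1) \<noteq> 0" using s1 one by (simp add: \<tau>_def)
  ultimately have "\<tau> 0 \<noteq> \<tau> s1" by metis
  moreover have "morphism (UNIV :: unit set) (affine_space UNIV) I X (\<lambda>s. \<tau> (s ()))"
    unfolding morphism_def
  proof (intro conjI ballI)
    fix k assume "k \<in> I"
    then have "(\<lambda>s :: unit \<Rightarrow> complex. \<tau> (s ()) k) = (\<lambda>s. \<Prod>k'\<in>{0, 1, 2}. poly (G k') (s ()) ^ E (fst k) (snd k) k')"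
      by (auto simp: \<tau>_def split_beta)
    moreover have "fraction_on UNIV (affine_space UNIV) \<dots>"
      by (intro fraction_on_prod fraction_on_power fraction_on_poly fraction_on_coord) simp
    ultimately show "regular_on UNIV (affine_space UNIV) (\<lambda>s :: unit \<Rightarrow> complex. \<tau> (s ()) k)"
      by (intro regular_on_fraction) simp_all
  qed (use \<tau>X in auto)
  ultimately have "polynomial_curve I X \<tau>" unfolding polynomial_curve_def by blast
  moreover have "horizontal I (tri_torus n l) X \<tau>"
    unfolding horizontal_def
  proof (intro exI[of _ X0] conjI ballI)
    fix x assume x: "x \<in> X0"
    show "diag_orbit I (tri_torus n l) x \<subseteq> X0"
      unfolding diag_orbit_def using torus_act_X0[OF _ x] by blast
    define s where "s = rp (\<lambda>i. \<nu> i x) / rq (\<lambda>i. \<nu> i x)"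
    note sec = section_of_point[OF x s_def]
    obtain \<sigma> where \<sigma>: "\<sigma> \<noteq> 0" "\<And>i. i \<in> {0, 1, 2} \<Longrightarrow> \<nu> i x = \<sigma> ^ w i * g i s" using sec(3) by blast
    have qn: "q s \<noteq> 0" using sec(2) by (simp add: q_def)
    \<comment> \<open>The only diagonal matrix taking \<open>x\<close> to \<open>\<tau> s\<close>;
      its membership in the torus remains to be checked.\<close>
    define t where "t = (\<lambda>k\<in>I. \<tau> s k / x k)"
    have xn: "x k \<noteq> 0" if "k \<in> I" for k using x that by (simp add: X0_def)
    have tt: "t \<in> diag_torus I"
      using xn sec(2) by (auto simp: t_def diag_torus_def affine_space_def \<tau>_def)
    \<comment> \<open>\<open>\<nu> i t\<close> equals
      \<open>q s powi (K * N i) / \<sigma> ^ w i\<close>; as \<open>d i * N i = M\<close> and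
      \<open>w i * d i = D\<close>, its logarithm multiplied by \<open>d i\<close> no longer depends
      on \<open>i\<close>.\<close>
    define \<theta> where "\<theta> = of_nat (K * M) * Ln (q s) - of_nat D * Ln \<sigma>"
    have "\<nu> i t = exp (\<theta> / of_nat (d i))" if i: "i \<in> {0, 1, 2}" for i
    proof -
      have "\<nu> i t = \<nu> i (\<tau> s) / \<nu> i x"
        unfolding \<nu>_def prod_dividef[symmetric] using i
        by (intro prod.cong) (simp_all add: t_def mem_tri_index power_int_divide_distrib)
      also have "\<dots> = q s powi (int K * N i) / \<sigma> ^ w i"
        using \<nu>\<tau>[OF i sec(2)] \<sigma>(2)[OF i] g_nonzero[OF sec(2), of i] by simp
      also have "\<dots> = exp (of_int (int K * N i) * Ln (q s)) / exp (of_nat (w i) * Ln \<sigma>)"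
        using qn \<sigma>(1) by (simp add: exp_power_int[symmetric] exp_of_nat_mult del: of_int_mult)
      also have "\<dots> = exp (of_int (int K * N i) * Ln (q s) - of_nat (w i) * Ln \<sigma>)"
        by (simp add: exp_diff)
      also have "of_int (int K * N i) * Ln (q s) - of_nat (w i) * Ln \<sigma> = \<theta> / of_nat (d i)"
      proof -
        have "of_nat (d i) * of_int (N i) = (of_nat M :: complex)"
          using arg_cong[OF N[OF i], of "of_int :: int \<Rightarrow> complex"] by simp
        moreover have "of_nat (w i) * of_nat (d i) = (of_nat D :: complex)"
          using weights(1) i by (metis of_nat_mult)
        ultimately have "\<theta> = of_nat (d i) * (of_int (int K * N i) * Ln (q s) - of_nat (w i) * Ln \<sigma>)"
          unfolding \<theta>_def by (simp add: algebra_simps flip: \<open>of_nat (d i) * of_int (N i) = of_nat M\<close> \<open>of_nat (w i) * of_nat (d i) = of_nat D\<close>)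
        then show ?thesis using d_pos[OF i] by simp
      qed
      finally show ?thesis .
    qed
    then have "t \<in> tri_torus n l" by (rule mem_tri_torus[OF tt])
    moreover have "diag_act I t x = \<tau> s"
      using xn \<tau>X[of s] by (auto simp: diag_act_def t_def mem_X fun_eq_iff extensional_def)
    ultimately show "range \<tau> \<inter> diag_orbit I (tri_torus n l) x \<noteq> {}" unfolding diag_orbit_def by blast
  qed (use openin_X0 X0_nonempty in auto)
  ultimately show ?thesis by blast
qed

lemma up_down:
  assumes "i \<in> {0, 1, 2}" "j \<in> {1..n i}" and "\<And>r. r \<in> {1..n i} \<Longrightarrow> x r \<noteq> (0 :: complex)"
  shows "(\<Prod>r=1..n i. (\<Prod>q=1..n i. x q powi B i r q) powi A i j r) = x j"
    and "(\<Prod>r=1..n i. (\<Prod>q=1..n i. x q powi A i r q) powi B i j r) = x j"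
proof -
  have "(\<Prod>r=1..n i. (\<Prod>q=1..n i. x q powi B i r q) powi A i j r) = (\<Prod>q=1..n i. x q powi (\<Sum>r=1..n i. A i j r * B i r q))"
    using assms(3) by (rule monomial_compose)
  also have "\<dots> = (\<Prod>q=1..n i. x q powi (if j = q then 1 else 0))"
    by (intro prod.cong refl) (simp only: AB[OF assms(1,2)])
  also have "\<dots> = x j" using assms(2) by (intro prod_powi_delta) auto
  finally show "(\<Prod>r=1..n i. (\<Prod>q=1..n i. x q powi B i r q) powi A i j r) = x j" .
  have "(\<Prod>r=1..n i. (\<Prod>q=1..n i. x q powi A i r q) powi B i j r) = (\<Prod>q=1..n i. x q powi (\<Sum>r=1..n i. B i j r * A i r q))"
    using assms(3) by (rule monomial_compose)
  also have "\<dots> = (\<Prod>q=1..n i. x q powi (if j = q then 1 else 0))"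
    by (intro prod.cong refl) (simp only: BA[OF assms(1,2)])
  also have "\<dots> = x j" using assms(2) by (intro prod_powi_delta) auto
  finally show "(\<Prod>r=1..n i. (\<Prod>q=1..n i. x q powi A i r q) powi B i j r) = x j" .
qed

text \<open>On \<open>X0\<close> the coordinates \<open>\<nu>\<^sub>0, \<nu>\<^sub>1, \<nu>\<^sub>2\<close> are replaced by the curve parameter and the torus
  parameter \<open>\<sigma>\<close>, stored at the indices \<open>(0, 1)\<close> and \<open>(1, 1)\<close>; the index \<open>(2, 1)\<close> is dropped.\<close>

lemma rational_hypersurface: "rational_variety I X"
proof -
  obtain u0 v0 where uv: "u0 * int (w 0) + v0 * int (w 1) = int (gcd (w 0) (w 1))"
    using bezout_int[of "int (w 0)" "int (w 1)"] by auto
  obtain u1 v1 where uv': "u1 * int (gcd (w 0) (w 1)) + v1 * int (w 2) = 1"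
    using bezout_int[of "int (gcd (w 0) (w 1))" "int (w 2)"] weights(3) by auto
  \<comment> \<open>Bezout coefficients of the three weights. They make \<open>\<sigma>\<close> a
    Laurent monomial in the quotients \<open>\<nu> i x / g i (sc x)\<close>, hence a rational
    function of \<open>x\<close>.\<close>
  define b where "b i = (if i = 0 then u1 * u0 else if i = 1 then u1 * v0 else v1)" for i :: nat
  have "(\<Sum>i\<in>{0, 1, 2}. int (w i) * b i) = u1 * (u0 * int (w 0) + v0 * int (w 1)) + v1 * int (w 2)"
    by (simp add: b_def algebra_simps)
  also have "\<dots> = 1" unfolding uv by (rule uv')
  finally have b: "(\<Sum>i\<in>{0, 1, 2}. int (w i) * b i) = 1" .
  define I' where "I' = I - {(2, 1)}"
  define p where "p = card I'"
  obtain h where h: "bij_betw h {..<p} I'"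
    using ex_bij_betw_nat_finite[of I'] finite_tri_index unfolding p_def I'_def lessThan_atLeast0 by auto
  define hi where "hi = the_inv_into {..<p} h"
  have hi: "hi k < p" "h (hi k) = k" if "k \<in> I'" for k
    using h that f_the_inv_into_f_bij_betw[OF h] the_inv_into_into[of h "{..<p}" k "{..<p}"]
    unfolding hi_def bij_betw_def by auto
  have h': "h a \<in> I'" "hi (h a) = a" if "a < p" for a
    using h that the_inv_into_f_f[of h "{..<p}" a] unfolding hi_def bij_betw_def by auto
  have k01: "(0, 1) \<in> I'" "(1, 1) \<in> I'" using one_mem by (auto simp: I'_def mem_tri_index)
  have hne: "hi k \<noteq> hi k'" if "k \<in> I'" "k' \<in> I'" "k \<noteq> k'" for k k' using that hi(2) by metis
  define down where "down x k = (\<Prod>r=1..n (fst k). x (fst k, r) powi B (fst k) (snd k) r)" for x :: "nat \<times> nat \<Rightarrow> complex" and k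
  have down1: "down x (i, 1) = \<nu> i x" for i x by (simp add: down_def \<nu>_def)
  define sc where "sc x = rp (\<lambda>i. \<nu> i x) / rq (\<lambda>i. \<nu> i x)" for x
  define \<sigma>c where "\<sigma>c x = (\<Prod>i\<in>{0, 1, 2}. (\<nu> i x / g i (sc x)) powi b i)" for x
  define \<Phi> where "\<Phi> x k = (if k = (0, 1) then sc x else if k = (1, 1) then \<sigma>c x else down x k)" for x k
  define \<phi> where "\<phi> x = (\<lambda>a\<in>{..<p}. \<Phi> x (h a))" for x
  \<comment> \<open>Rebuilds all monomial coordinates: those at \<open>(i, 1)\<close> from the two
    parameters, including the dropped one, and the others as stored. Then \<open>\<psi>\<close>
    applies the inverse monomial map.\<close>
  define Z where "Z v k = (if snd k = 1 then v (hi (1, 1)) ^ w (fst k) * g (fst k) (v (hi (0, 1))) else v (hi k))"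
    for v :: "nat \<Rightarrow> complex" and k
  define \<psi> where "\<psi> v = (\<lambda>k\<in>I. \<Prod>r=1..n (fst k). Z v (fst k, r) powi A (fst k) (snd k) r)" for v
  \<comment> \<open>The curve parameter only has to avoid the roots of the \<open>G k\<close>; the
    other coordinates come from monomials and must be nonzero.\<close>
  define P where "P v = (\<Prod>k\<in>{0, 1, 2}. poly (G k) (v (hi (0, 1)))) * (\<Prod>a\<in>{..<p} - {hi (0, 1)}. v a)" for v
  define V where "V = {v \<in> affine_space {..<p}. P v \<noteq> 0}"
  have memV: "v \<in> V \<longleftrightarrow> v \<in> extensional {..<p} \<and> (\<forall>k\<in>{0, 1, 2}. poly (G k) (v (hi (0, 1))) \<noteq> 0) \<and> (\<forall>a<p. a \<noteq> hi (0, 1) \<longrightarrow> v a \<noteq> 0)" for v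
    unfolding V_def P_def affine_space_def by auto
  have P: "P \<in> poly_fun {..<p}"
    unfolding P_def using hi(1)[OF k01(1)]
    by (intro poly_fun.mult poly_fun_prod poly_fun_poly poly_fun.coord) auto
  have rest: "k \<in> I' \<and> k \<noteq> (0, 1) \<and> k \<noteq> (1, 1)" if "k \<in> I" "snd k \<noteq> 1" for k
    using that by (auto simp: I'_def)
  have snd1: "snd k \<noteq> 1" if "k \<in> I'" "k \<noteq> (0, 1)" "k \<noteq> (1, 1)" for k
    using that by (cases k) (auto simp: I'_def mem_tri_index)
  have \<sigma>c: "\<sigma>c x = \<sigma>" if "\<sigma> \<noteq> 0" "\<forall>k\<in>{0, 1, 2}. poly (G k) (sc x) \<noteq> 0" "\<forall>i\<in>{0, 1, 2}. \<nu> i x = \<sigma> ^ w i * g i (sc x)" for x \<sigma>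
  proof -
    have "\<sigma>c x = (\<Prod>i\<in>{0, 1, 2}. \<sigma> powi (int (w i) * b i))"
      unfolding \<sigma>c_def
    proof (intro prod.cong refl)
      fix i :: nat assume "i \<in> {0, 1, 2}"
      then have "\<nu> i x = \<sigma> ^ w i * g i (sc x)" using that(3) by blast
      then show "(\<nu> i x / g i (sc x)) powi b i = \<sigma> powi (int (w i) * b i)"
        using g_nonzero[OF that(2), of i] by (simp add: power_int_mult)
    qed
    also have "\<dots> = \<sigma>" unfolding power_int_sum[OF that(1)] b by simp
    finally show ?thesis .
  qed
  have X0E: "\<exists>\<sigma>. \<sigma> \<noteq> 0 \<and> \<sigma>c x = \<sigma> \<and> (\<forall>k\<in>{0, 1, 2}. poly (G k) (sc x) \<noteq> 0) \<and> (\<forall>i\<in>{0, 1, 2}. \<nu> i x = \<sigma> ^ w i * g i (sc x))"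
    if "x \<in> X0" for x
    using section_of_point[OF that sc_def] \<sigma>c by metis
  have xn: "x k \<noteq> 0" if "x \<in> X0" "k \<in> I" for x k using that by (simp add: X0_def)
  have downn: "down x k \<noteq> 0" if "x \<in> X0" "k \<in> I" for x k
    using xn[OF that(1)] that(2) by (cases k) (auto simp: down_def mem_tri_index)
  have \<phi>hi: "\<phi> x (hi k) = \<Phi> x k" if "k \<in> I'" for x k using hi[OF that] by (simp add: \<phi>_def)
  have \<phi>V: "\<phi> x \<in> V" if x: "x \<in> X0" for x
  proof -
    obtain \<sigma> where \<sigma>: "\<sigma> \<noteq> 0" "\<sigma>c x = \<sigma>" "\<forall>k\<in>{0, 1, 2}. poly (G k) (sc x) \<noteq> 0" using X0E[OF x] by blast
    have "\<phi> x a \<noteq> 0" if a: "a < p" "a \<noteq> hi (0, 1)" for a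
    proof -
      have "h a \<noteq> (0, 1)" using h'(2)[OF a(1)] a(2) by metis
      moreover have "h a \<in> I" using h'(1)[OF a(1)] by (simp add: I'_def)
      ultimately show ?thesis using a \<sigma> downn[OF x] by (auto simp: \<phi>_def \<Phi>_def)
    qed
    moreover have "\<phi> x (hi (0, 1)) = sc x" unfolding \<phi>hi[OF k01(1)] \<Phi>_def by simp
    moreover have "\<phi> x \<in> extensional {..<p}" by (simp add: \<phi>_def)
    ultimately show ?thesis using \<sigma>(3) unfolding memV by simp
  qed
  have Zn: "Z v k \<noteq> 0" if v: "v \<in> V" and k: "k \<in> I" for v k
  proof (cases "snd k = 1")
    case True
    have "v (hi (1, 1)) \<noteq> 0" using v hi(1)[OF k01(2)] hne[OF k01(2,1)] unfolding memV by auto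
    then show ?thesis using True v g_nonzero unfolding memV by (simp add: Z_def)
  next
    case False
    then have "v (hi k) \<noteq> 0" using v rest[OF k False] hi(1) hne[OF _ k01(1)] unfolding memV by auto
    then show ?thesis using False by (simp add: Z_def)
  qed
  have down\<psi>: "down (\<psi> v) k = Z v k" if v: "v \<in> V" and k: "k \<in> I" for v k
  proof -
    obtain i j where ij: "k = (i, j)" "i \<in> {0, 1, 2}" "j \<in> {1..n i}" using k by (cases k) (auto simp: mem_tri_index)
    have "down (\<psi> v) k = (\<Prod>r=1..n i. (\<Prod>q=1..n i. Z v (i, q) powi A i r q) powi B i j r)"
      unfolding down_def ij(1) using ij(2) by (intro prod.cong) (auto simp: \<psi>_def mem_tri_index)
    also have "\<dots> = Z v (i, j)"
      using up_down(2)[OF ij(2,3), of "\<lambda>q. Z v (i, q)"] Zn[OF v] ij(2) by (simp add: mem_tri_index)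
    finally show ?thesis using ij(1) by simp
  qed
  have \<nu>\<psi>: "\<nu> i (\<psi> v) = v (hi (1, 1)) ^ w i * g i (v (hi (0, 1)))" if "v \<in> V" "i \<in> {0, 1, 2}" for i v
    using down\<psi>[OF that(1), of "(i, 1)"] that(2) one_mem[OF that(2)]
    unfolding down1 by (simp add: Z_def mem_tri_index)
  have \<psi>X: "\<psi> v \<in> X0" if v: "v \<in> V" for v
  proof -
    have nz: "\<psi> v k \<noteq> 0" if k: "k \<in> I" for k
      using Zn[OF v] k by (cases k) (auto simp: \<psi>_def mem_tri_index)
    have "\<mu> i (\<psi> v) = v (hi (1, 1)) ^ D * g i (v (hi (0, 1))) ^ d i" if i: "i \<in> {0, 1, 2}" for i
    proof -
      have "w i * d i = D" using weights(1) i by blast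
      then show ?thesis
        unfolding \<nu>_power[OF i, symmetric] \<nu>\<psi>[OF v i] by (simp add: power_mult_distrib flip: power_mult)
    qed
    from this[of 0] this[of 1] this[of 2]
    have "\<mu> 0 (\<psi> v) + \<mu> 1 (\<psi> v) + \<mu> 2 (\<psi> v) = v (hi (1, 1)) ^ D *
        (g 0 (v (hi (0, 1))) ^ d 0 + g 1 (v (hi (0, 1))) ^ d 1 + g 2 (v (hi (0, 1))) ^ d 2)"
      by (simp add: distrib_left)
    moreover have "\<psi> v \<in> extensional I" by (simp add: \<psi>_def)
    ultimately have "\<psi> v \<in> X" unfolding mem_X g_sum by simp
    then show ?thesis using nz by (simp add: X0_def)
  qed
  have \<psi>\<phi>: "\<psi> (\<phi> x) = x" if x: "x \<in> X0" for x
  proof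
    fix k
    obtain \<sigma> where \<sigma>: "\<sigma>c x = \<sigma>" "\<forall>i\<in>{0, 1, 2}. \<nu> i x = \<sigma> ^ w i * g i (sc x)" using X0E[OF x] by blast
    have Zd: "Z (\<phi> x) k' = down x k'" if k': "k' \<in> I" for k'
    proof (cases "snd k' = 1")
      case True
      then obtain i where i: "k' = (i, 1)" "i \<in> {0, 1, 2}" using k' by (cases k') (auto simp: mem_tri_index)
      have "\<phi> x (hi (1, 1)) = \<sigma>" "\<phi> x (hi (0, 1)) = sc x"
        unfolding \<phi>hi[OF k01(1)] \<phi>hi[OF k01(2)] \<Phi>_def using \<sigma>(1) by simp_all
      moreover have "\<nu> i x = \<sigma> ^ w i * g i (sc x)" using \<sigma>(2) i(2) by blast
      ultimately have "Z (\<phi> x) k' = \<nu> i x" using i(1) by (simp add: Z_def)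
      then show ?thesis using down1 i(1) by simp
    next
      case False
      then show ?thesis using rest[OF k' False] by (simp add: Z_def \<phi>hi \<Phi>_def)
    qed
    show "\<psi> (\<phi> x) k = x k"
    proof (cases "k \<in> I")
      case True
      then obtain i j where ij: "k = (i, j)" "i \<in> {0, 1, 2}" "j \<in> {1..n i}" by (cases k) (auto simp: mem_tri_index)
      have "\<psi> (\<phi> x) k = (\<Prod>r=1..n i. (\<Prod>q=1..n i. x (i, q) powi B i r q) powi A i j r)"
        using True unfolding \<psi>_def ij(1) using ij(2) by (auto intro!: prod.cong simp: Zd mem_tri_index down_def)
      also have "\<dots> = x (i, j)"
        using up_down(1)[OF ij(2,3), of "\<lambda>q. x (i, q)"] xn[OF x] ij(2) by (simp add: mem_tri_index)
      finally show ?thesis using ij(1) by simp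
    next
      case False
      moreover have "x \<in> extensional I" using x by (simp add: X0_def mem_X)
      ultimately show ?thesis by (simp add: \<psi>_def extensional_arb[of x I k])
    qed
  qed
  have \<phi>\<psi>: "\<phi> (\<psi> v) = v" if v: "v \<in> V" for v
  proof
    fix a
    have good: "\<forall>k\<in>{0, 1, 2}. poly (G k) (v (hi (0, 1))) \<noteq> 0" using v unfolding memV by blast
    have \<sigma>n: "v (hi (1, 1)) \<noteq> 0" using v hi(1)[OF k01(2)] hne[OF k01(2,1)] unfolding memV by auto
    have s: "sc (\<psi> v) = v (hi (0, 1))"
      unfolding sc_def
    proof (rule section_inj[THEN spec, THEN spec, THEN mp, THEN mp, THEN spec, THEN mp, OF good \<sigma>n])
      show "\<forall>i\<in>{0, 1, 2}. \<nu> i (\<psi> v) = v (hi (1, 1)) ^ w i * (\<Prod>k\<in>{0, 1, 2}. poly (G k) (v (hi (0, 1))) ^ m i k)"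
        using \<nu>\<psi>[OF v] unfolding g_def by blast
    qed
    have \<sigma>: "\<sigma>c (\<psi> v) = v (hi (1, 1))"
      using \<nu>\<psi>[OF v] good by (intro \<sigma>c \<sigma>n) (simp_all only: s, blast)
    show "\<phi> (\<psi> v) a = v a"
    proof (cases "a < p")
      case True
      have "\<Phi> (\<psi> v) (h a) = v (hi (h a))"
      proof (cases "h a = (0, 1) \<or> h a = (1, 1)")
        case True
        then show ?thesis using s \<sigma> by (auto simp: \<Phi>_def)
      next
        case False
        then have "snd (h a) \<noteq> 1" using snd1 h'(1)[OF \<open>a < p\<close>] by blast
        moreover have "h a \<in> I" using h'(1)[OF \<open>a < p\<close>] by (simp add: I'_def)
        ultimately show ?thesis using False down\<psi>[OF v, of "h a"] by (simp add: \<Phi>_def Z_def)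
      qed
      then show ?thesis using True h'(2)[OF True] by (simp add: \<phi>_def)
    next
      case False
      then show ?thesis using v unfolding memV by (simp add: \<phi>_def extensional_arb[of v "{..<p}" a])
    qed
  qed
  have X0sub: "X0 \<subseteq> affine_space I" using X_subset by (auto simp: X0_def)
  have fr_prod: "fraction_on I X0 (\<lambda>x. \<Prod>r=1..n i. x (i, r) powi e r)" if "i \<in> {0, 1, 2}" for i and e :: "nat \<Rightarrow> int"
    using that xn by (intro fraction_on_prod fraction_on_power_int fraction_on_coord) (auto simp: mem_tri_index)
  have fr_\<nu>: "fraction_on I X0 (\<lambda>x. \<nu> i x)" if "i \<in> {0, 1, 2}" for i
    unfolding \<nu>_def by (rule fr_prod[OF that])
  have fr_sc: "fraction_on I X0 sc"
    unfolding sc_def using section_of_point(1)[OF _ refl]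
    by (intro fraction_on_divide fraction_on_compose[OF rp_rq(1)] fraction_on_compose[OF rp_rq(2)] fr_\<nu>)
  have fr_g: "fraction_on J U (\<lambda>x. g i (f x))" if "fraction_on J U f" for J U f i
    unfolding g_def by (intro fraction_on_prod fraction_on_power fraction_on_poly that)
  have gn: "g i (sc x) \<noteq> 0" if "x \<in> X0" for i x using X0E[OF that] g_nonzero by blast
  have fr_\<sigma>c: "fraction_on I X0 \<sigma>c"
    unfolding \<sigma>c_def using gn \<nu>_nonzero
    by (intro fraction_on_prod fraction_on_power_int fraction_on_divide fr_\<nu> fr_g fr_sc) auto
  have fr_\<Phi>: "fraction_on I X0 (\<lambda>x. \<Phi> x k)" if "k \<in> I" for k
  proof -
    have "fraction_on I X0 (\<lambda>x. down x k)"
      unfolding down_def using that by (intro fr_prod) (auto simp: tri_index_def)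
    then show ?thesis
      unfolding \<Phi>_def using fr_sc fr_\<sigma>c by (cases "k = (0, 1)"; cases "k = (1, 1)") simp_all
  qed
  have "regular_on I X0 (\<lambda>x. \<phi> x a)" if "a \<in> {..<p}" for a
    using that h'(1)[of a] fr_\<Phi>[of "h a"] X0sub
    by (intro regular_on_fraction) (auto simp: \<phi>_def I'_def)
  then have mor\<phi>: "morphism I X0 {..<p} V \<phi>" using \<phi>V by (auto simp: morphism_def)
  have fr_Z: "fraction_on {..<p} V (\<lambda>v. Z v k)" if "k \<in> I" for k
  proof -
    have "fraction_on {..<p} V (\<lambda>v. v (hi (1, 1)) ^ w (fst k) * g (fst k) (v (hi (0, 1))))"
      using hi(1)[OF k01(1)] hi(1)[OF k01(2)]
      by (intro fraction_on_mult fraction_on_power fr_g fraction_on_coord) auto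
    moreover have "fraction_on {..<p} V (\<lambda>v. v (hi k))" if "snd k \<noteq> 1"
      using hi(1)[of k] rest[OF \<open>k \<in> I\<close> that] by (intro fraction_on_coord) auto
    ultimately show ?thesis by (cases "snd k = 1") (simp_all add: Z_def)
  qed
  have "regular_on {..<p} V (\<lambda>v. \<psi> v k)" if k: "k \<in> I" for k
  proof (rule regular_on_fraction)
    have "fraction_on {..<p} V (\<lambda>v. \<Prod>r=1..n (fst k). Z v (fst k, r) powi A (fst k) (snd k) r)"
      using k Zn by (intro fraction_on_prod fraction_on_power_int fr_Z) (auto simp: tri_index_def)
    then show "fraction_on {..<p} V (\<lambda>v. \<psi> v k)" using k by (simp add: \<psi>_def)
  qed (auto simp: V_def)
  then have mor\<psi>: "morphism {..<p} V I X0 \<psi>" using \<psi>X by (auto simp: morphism_def)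
  have "openin (subtopology (zariski {..<p}) (affine_space {..<p})) V"
    unfolding V_def by (rule openin_nonvanishing[OF P order_refl])
  moreover have "V \<noteq> {}" using X0_nonempty \<phi>V by blast
  ultimately have "birational I X {..<p} (affine_space {..<p})"
    unfolding birational_def using openin_X0 X0_nonempty mor\<phi> mor\<psi> \<psi>\<phi> \<phi>\<psi> by blast
  then show ?thesis unfolding rational_variety_def by blast
qed

end

lemma (in trinomial) gcd_condition_imp:
  assumes "(\<exists>i\<in>{0, 1, 2}. \<forall>k\<in>{0, 1, 2} - {i}. coprime (d i) (d k)) \<or>
    gcd (d 0) (d 1) = 2 \<and> gcd (d 0) (d 2) = 2 \<and> gcd (d 1) (d 2) = 2"
  shows "rational_variety I X" and "\<exists>\<tau>. polynomial_curve I X \<tau> \<and> horizontal I (tri_torus n l) X \<tau>"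
proof -
  obtain A B where "trinomial_coords n l A B" using exists_coords by blast
  moreover from assms have "\<exists>w D G m rp rq. trinomial_section d w D G m rp rq"
  proof
    assume "\<exists>i\<in>{0, 1, 2}. \<forall>k\<in>{0, 1, 2} - {i}. coprime (d i) (d k)"
    then obtain i where "i \<in> {0, 1, 2}" "\<And>k. k \<in> {0, 1, 2} - {i} \<Longrightarrow> coprime (d i) (d k)" by metis
    with d_pos show ?thesis by (rule trinomial_section_coprime)
  next
    assume "gcd (d 0) (d 1) = 2 \<and> gcd (d 0) (d 2) = 2 \<and> gcd (d 1) (d 2) = 2"
    then show ?thesis using d_pos by (intro trinomial_section_even) auto
  qed
  then obtain w D G m rp rq where "trinomial_section d w D G m rp rq" by metis
  ultimately interpret trinomial_rational n l A B w D G m rp rq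
    by (intro trinomial_rational.intro)
  show "rational_variety I X" by (rule rational_hypersurface)
  show "\<exists>\<tau>. polynomial_curve I X \<tau> \<and> horizontal I (tri_torus n l) X \<tau>" by (rule exists_horizontal_curve)
qed

theorem theorem3:
  fixes n :: "nat \<Rightarrow> nat" and l :: "nat \<Rightarrow> nat \<Rightarrow> nat"
  assumes "\<And>i. i \<in> {0, 1, 2} \<Longrightarrow> n i > 0"
    and "\<And>i j. i \<in> {0, 1, 2} \<Longrightarrow> j \<in> {1..n i} \<Longrightarrow> l i j > 0"
  defines "I \<equiv> tri_index n" and "X \<equiv> trinomial_hypersurface n l"
    and "T \<equiv> tri_torus n l" and "d \<equiv> tri_gcd n l"
  shows "(rational_variety I X \<longleftrightarrow> (\<exists>\<tau>. polynomial_curve I X \<tau> \<and> horizontal I T X \<tau>)) \<and>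
    ((\<exists>\<tau>. polynomial_curve I X \<tau> \<and> horizontal I T X \<tau>) \<longleftrightarrow>
      (\<exists>i\<in>{0, 1, 2}. \<forall>k\<in>{0, 1, 2} - {i}. coprime (d i) (d k)) \<or>
      (gcd (d 0) (d 1) = 2 \<and> gcd (d 0) (d 2) = 2 \<and> gcd (d 1) (d 2) = 2))"
proof -
  interpret trinomial n l using assms(1,2) by unfold_locales
  show ?thesis
    unfolding I_def X_def T_def d_def
    using rational_imp_gcd_condition horizontal_imp_gcd_condition gcd_condition_imp by blast
qed

end
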